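(* Let $n,h\ge1$ and $\lambda\vdash h$. Any Young–Capelli bitableau $[U|\boxed{V}]\in\mathbf U(gl(n))$ with $U,V$ tableaux on $\{1,\dots,n\}$ of shape $sh(U)=sh(V)=\lambda$ can be written as a linear combination (with complex coefficients) of Capelli immanants $Cimm_\lambda[i_1i_2\cdots i_h;j_1j_2\cdots j_h]$, $(i_1,\dots,i_h),(j_1,\dots,j_h)\in\{1,\dots,n\}^h$, associated to the same shape $\lambda$.
   Context: **Virtual variables.** Let $A_0=\{\alpha_1,\dots,\alpha_{m_0}\}$, $A_1=\{\beta_1,\dots,\beta_{m_1}\}$, $L=\{1,\dots,n\}$ be disjoint sets of symbols ($m_0,m_1$ sufficiently large), with parities $|\alpha_s|=0$, $|\beta_t|=|i|=1$ in $\mathbb Z_2$. $gl(m_0|m_1+n)$ is the complex Lie superalgebra with basis $e_{a,b}$, $a,b\in A_0\cup A_1\cup L$, $|e_{a,b}|=|a|+|b|$, and superbracket $[e_{a,b},e_{c,d}]=\delta_{bc}e_{a,d}-(-1)^{(|a|+|b|)(|c|+|d|)}\delta_{ad}e_{c,b}$; $gl(n)$ is its Lie subalgebra spanned by $e_{ij}=e_{i,j}$, $i,j\in L$. A product $e_{a_m,b_m}\cdots e_{a_1,b_1}$ in $\mathbf U(gl(m_0|m_1+n))$ is irregular if there are $i\le m$ and $\gamma\in A_0\cup A_1$ with $\#\{j\le i: b_j=\gamma\}>\#\{j<i: a_j=\gamma\}$. $\mathbf{Irr}$ is the left ideal generated by irregular products. It is known that $\mathbf U(gl(n))\cap\mathbf{Irr}=0$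 and that $Virt(m_0+m_1,n)=\mathbf U(gl(n))\oplus\mathbf{Irr}$ is a subalgebra in which $\mathbf{Irr}$ is a two-sided ideal; $\mathfrak p:Virt(m_0+m_1,n)\to\mathbf U(gl(n))$ is the projection with kernel $\mathbf{Irr}$. **Capelli and Young–Capelli bitableaux.** A tableau of shape $\lambda\vdash h$ over an alphabet is an arbitrary filling of the diagram of $\lambda$; its cells are numbered $1,\dots,h$ row by row from left to right, top to bottom, and $S(k)$ is the entry in cell $k$; $sh(S)=\lambda$ is its shape. For tableaux $S,T$ of the same shape over $A_0\cup A_1\cup L$ put $e_{S,T}=e_{S(1),T(1)}\cdots e_{S(h),T(h)}$. $C^*_\lambda$ is the tableau of shape $\lambda$ all of whose entries in row $r$ equal $\alpha_r$, and $D^*_\lambda$ is the tableau of shape $\lambda$ all of whose entries in column $c$ equal $\beta_c$. For tableaux $S,T$ of shape $\lambda$ on $\{1,\dots,n\}$, the Capelli bitableau and the Young–Capelli bitableau are $$[S|T]=\mathfrak p\big(e_{S,C^*_\lambda}\,e_{C^*_\lambda,T}\big),\qquad [S|\boxed{T}]=\mathfrak p\big(e_{S,C^*_\lambda}\,e_{C^*_\lambda,D^*_\lambda}\,e_{D^*_\lambda,T}\big)\in\mathbf U(gl(n))$$ (the arguments of $\mathfrak p$ lie in $Virt(m_0+m_1,n)$). A column Capelli bitableau is a Capelli bitableau of shape $(1^h)$. **Capelli immanants.** For $\lambda\vdash h$, $\chi^\lambda$ denotes the irreducible character of the symmetric group $\mathbf S_h$ labelled so that $\lambda=(1^h)$ gives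 the trivial and $\lambda=(h)$ the sign character (i.e. $\chi^\lambda$ is the character usually attached to the conjugate partition). Put $$Cimm_\lambda[i_1\cdots i_h;j_1\cdots j_h]=\sum_{\sigma\in\mathbf S_h}\chi^\lambda(\sigma)\left[\begin{array}{c}i_{\sigma(1)}\\ \vdots\\ i_{\sigma(h)}\end{array}\right|\left.\begin{array}{c}j_1\\ \vdots\\ j_h\end{array}\right].$$ *)

theory Defs
  imports
    Complex_Main
    "HOL-Library.Cardinality"
    "HOL-Library.Poly_Mapping"
    "HOL-Library.Function_Algebras"
    "HOL-Combinatorics.Permutations"
begin

section \<open>The superalgebra $\mathbf{U}(gl(m_0|m_1+n))$\<close>

text \<open>
  The three disjoint alphabets $A_0$, $A_1$, $L$ are three finite index types of cardinalities
  $m_0$, $m_1$, $n$. Their orderings $\alpha_1,\alpha_2,\dots$ and $\beta_1,\beta_2,\dots$ are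
  enumerations passed explicitly to the constructions which depend on them.
\<close>

datatype ('p, 'q, 'l) letter = Alpha 'p | Beta 'q | Proper 'l

fun parity :: "('p, 'q, 'l) letter \<Rightarrow> nat" where
  "parity (Alpha _) = 0"
| "parity (Beta _) = 1"
| "parity (Proper _) = 1"

fun virtual :: "('p, 'q, 'l) letter \<Rightarrow> bool" where
  "virtual (Alpha _) = True"
| "virtual (Beta _) = True"
| "virtual (Proper _) = False"

text \<open>
  Words form a monoid under concatenation, written additively as \<^typ>\<open>'a \<Rightarrow>\<^sub>0 'b\<close> requires.
  The monoid algebra \<open>'a fword \<Rightarrow>\<^sub>0 complex\<close> is the free associative algebra on \<open>'a\<close>.
\<close>

datatype 'a fword = FWord (letters: "'a list")

instantiation fword :: (type) monoid_add
begin

definition zero_fword :: "'a fword" where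
  "0 = FWord []"

definition plus_fword :: "'a fword \<Rightarrow> 'a fword \<Rightarrow> 'a fword" where
  "v + w = FWord (letters v @ letters w)"

instance
  by standard (simp_all add: zero_fword_def plus_fword_def)

end

type_synonym 'a free_alg = "'a fword \<Rightarrow>\<^sub>0 complex"

definition free_gen :: "'a \<Rightarrow> 'a free_alg" where
  "free_gen x = Poly_Mapping.single (FWord [x]) 1"

type_synonym ('p, 'q, 'l) gl_free =
  "(('p, 'q, 'l) letter \<times> ('p, 'q, 'l) letter) free_alg"

text \<open>
  The pair \<open>(a, b)\<close> stands for $e_{a,b}$. By bilinearity of the superbracket, the defining
  relations $xy-(-1)^{|x||y|}yx=[x,y]$ of the enveloping algebra are only needed on the
  homogeneous basis.
\<close>

definition super_sign ::
    "('p, 'q, 'l) letter \<times> ('p, 'q, 'l) letter \<Rightarrow> ('p, 'q, 'l) letter \<times> ('p, 'q, 'l) letter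
      \<Rightarrow> ('p, 'q, 'l) gl_free" where
  "super_sign x y =
     (- 1) ^ ((parity (fst x) + parity (snd x)) * (parity (fst y) + parity (snd y)))"

definition superbracket ::
    "('p, 'q, 'l) letter \<times> ('p, 'q, 'l) letter \<Rightarrow> ('p, 'q, 'l) letter \<times> ('p, 'q, 'l) letter
      \<Rightarrow> ('p, 'q, 'l) gl_free" where
  "superbracket x y =
     (if snd x = fst y then free_gen (fst x, snd y) else 0)
     - super_sign x y * (if fst x = snd y then free_gen (fst y, snd x) else 0)"

definition gl_relator ::
    "('p, 'q, 'l) letter \<times> ('p, 'q, 'l) letter \<Rightarrow> ('p, 'q, 'l) letter \<times> ('p, 'q, 'l) letter
      \<Rightarrow> ('p, 'q, 'l) gl_free" where
  "gl_relator x y =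
     free_gen x * free_gen y - super_sign x y * (free_gen y * free_gen x) - superbracket x y"

inductive_set gl_ideal :: "('p, 'q, 'l) gl_free set" where
  zero: "0 \<in> gl_ideal"
| add_rel: "z \<in> gl_ideal \<Longrightarrow> z + u * gl_relator x y * v \<in> gl_ideal"

lemma gl_ideal_add:
  assumes "a \<in> gl_ideal" "b \<in> gl_ideal"
  shows "a + b \<in> gl_ideal"
  using assms(2)
proof induction
  case zero
  then show ?case using assms(1) by simp
next
  case (add_rel z u x y v)
  have "a + (z + u * gl_relator x y * v) = (a + z) + u * gl_relator x y * v"
    by (rule add.assoc[symmetric])
  then show ?case using gl_ideal.add_rel[OF add_rel.IH] by (simp only:)
qed

lemma gl_ideal_mult:
  assumes "a \<in> gl_ideal"
  shows "s * a * t \<in> gl_ideal"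
  using assms
proof induction
  case zero
  then show ?case by (simp add: gl_ideal.zero)
next
  case (add_rel z u x y v)
  have "s * (z + u * gl_relator x y * v) * t = s * z * t + (s * u) * gl_relator x y * (v * t)"
    by (simp only: distrib_left distrib_right mult.assoc)
  then show ?case using gl_ideal.add_rel[OF add_rel.IH] by (simp only:)
qed

lemma gl_ideal_uminus: "a \<in> gl_ideal \<Longrightarrow> - a \<in> gl_ideal"
  using gl_ideal_mult[of a "- 1" 1] by simp

definition gl_eq :: "('p, 'q, 'l) gl_free \<Rightarrow> ('p, 'q, 'l) gl_free \<Rightarrow> bool" where
  "gl_eq a b \<longleftrightarrow> a - b \<in> gl_ideal"

lemma gl_eq_equivp: "equivp gl_eq"
proof (rule equivpI)
  show "reflp gl_eq"
    by (rule reflpI) (simp add: gl_eq_def gl_ideal.zero)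
  show "symp gl_eq"
  proof (rule sympI)
    fix a b :: "('p, 'q, 'l) gl_free"
    assume "gl_eq a b"
    then have "- (a - b) \<in> gl_ideal"
      unfolding gl_eq_def by (rule gl_ideal_uminus)
    then show "gl_eq b a" by (simp only: gl_eq_def minus_diff_eq)
  qed
  show "transp gl_eq"
  proof (rule transpI)
    fix a b c :: "('p, 'q, 'l) gl_free"
    assume "gl_eq a b" "gl_eq b c"
    then have "(a - b) + (b - c) \<in> gl_ideal"
      unfolding gl_eq_def by (rule gl_ideal_add)
    then show "gl_eq a c" by (simp only: gl_eq_def diff_add_cancel add_diff_eq)
  qed
qed

lemma gl_eq_refl: "a = b \<Longrightarrow> gl_eq a b"
  by (simp add: gl_eq_def gl_ideal.zero)

quotient_type ('p, 'q, 'l) Ugl = "('p, 'q, 'l) gl_free" / gl_eq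
  by (rule gl_eq_equivp)

lemma lookup_mult_empty:
  fixes f g :: "'a free_alg"
  shows "poly_mapping.lookup (f * g) 0 = poly_mapping.lookup f 0 * poly_mapping.lookup g 0"
proof -
  have *: "(0 = l + q) \<longleftrightarrow> l = 0 \<and> q = 0" for l q :: "'a fword"
    by (cases l; cases q) (auto simp: zero_fword_def plus_fword_def)
  have "poly_mapping.lookup f l * (Sum_any (\<lambda>q. poly_mapping.lookup g q when 0 = l + q)) =
      (poly_mapping.lookup f l * poly_mapping.lookup g 0 when l = 0)"
    for l
    unfolding * by (cases "l = 0") simp_all
  then have "poly_mapping.lookup (f * g) 0 =
      Sum_any (\<lambda>l. poly_mapping.lookup f l * poly_mapping.lookup g 0 when l = 0)"
    unfolding lookup_mult by (simp only:)
  then show ?thesis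
    by simp
qed

lemma free_gen_lookup_empty: "poly_mapping.lookup (free_gen x) 0 = 0"
  by (simp add: free_gen_def lookup_single zero_fword_def)

lemma gl_relator_lookup_empty: "poly_mapping.lookup (gl_relator x y) 0 = 0"
  by (simp add: gl_relator_def superbracket_def lookup_minus lookup_mult_empty
      free_gen_lookup_empty)

lemma gl_ideal_lookup_empty: "a \<in> gl_ideal \<Longrightarrow> poly_mapping.lookup a 0 = 0"
  by (induction rule: gl_ideal.induct)
    (simp_all add: lookup_add lookup_mult_empty gl_relator_lookup_empty)

instantiation Ugl :: (type, type, type) ring_1
begin

lift_definition zero_Ugl :: "('a, 'b, 'c) Ugl" is 0 .

lift_definition one_Ugl :: "('a, 'b, 'c) Ugl" is 1 .

lift_definition plus_Ugl :: "('a, 'b, 'c) Ugl \<Rightarrow> ('a, 'b, 'c) Ugl \<Rightarrow> ('a, 'b, 'c) Ugl" is plus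
proof -
  fix a b c d :: "('a, 'b, 'c) gl_free"
  assume "gl_eq a b" "gl_eq c d"
  then have "(a - b) + (c - d) \<in> gl_ideal"
    unfolding gl_eq_def by (rule gl_ideal_add)
  then show "gl_eq (a + c) (b + d)"
    by (simp only: gl_eq_def add_diff_add)
qed

lift_definition uminus_Ugl :: "('a, 'b, 'c) Ugl \<Rightarrow> ('a, 'b, 'c) Ugl" is uminus
proof -
  fix a b :: "('a, 'b, 'c) gl_free"
  assume "gl_eq a b"
  then have "- (a - b) \<in> gl_ideal"
    unfolding gl_eq_def by (rule gl_ideal_uminus)
  then show "gl_eq (- a) (- b)"
    by (simp only: gl_eq_def minus_diff_minus)
qed

lift_definition minus_Ugl :: "('a, 'b, 'c) Ugl \<Rightarrow> ('a, 'b, 'c) Ugl \<Rightarrow> ('a, 'b, 'c) Ugl" is minus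
proof -
  fix a b c d :: "('a, 'b, 'c) gl_free"
  assume "gl_eq a b" "gl_eq c d"
  then have "(a - b) + - (c - d) \<in> gl_ideal"
    unfolding gl_eq_def by (intro gl_ideal_add gl_ideal_uminus)
  then show "gl_eq (a - c) (b - d)"
    by (simp add: gl_eq_def algebra_simps)
qed

lift_definition times_Ugl :: "('a, 'b, 'c) Ugl \<Rightarrow> ('a, 'b, 'c) Ugl \<Rightarrow> ('a, 'b, 'c) Ugl" is times
proof -
  fix a b c d :: "('a, 'b, 'c) gl_free"
  assume "gl_eq a b" "gl_eq c d"
  then have "1 * (a - b) * c + b * (c - d) * 1 \<in> gl_ideal"
    unfolding gl_eq_def by (intro gl_ideal_add gl_ideal_mult)
  then show "gl_eq (a * c) (b * d)"
    by (simp add: gl_eq_def algebra_simps)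
qed

instance
proof
  fix a b c :: "('a, 'b, 'c) Ugl"
  show "a * b * c = a * (b * c)"
    by transfer (rule gl_eq_refl, rule mult.assoc)
  show "a + b + c = a + (b + c)"
    by transfer (rule gl_eq_refl, rule add.assoc)
  show "a + b = b + a"
    by transfer (rule gl_eq_refl, rule add.commute)
  show "0 + a = a"
    by transfer (rule gl_eq_refl, rule add_0_left)
  show "- a + a = 0"
    by transfer (rule gl_eq_refl, rule left_minus)
  show "a - b = a + - b"
    by transfer (rule gl_eq_refl, rule diff_conv_add_uminus)
  show "(a + b) * c = a * c + b * c"
    by transfer (rule gl_eq_refl, rule distrib_right)
  show "a * (b + c) = a * b + a * c"
    by transfer (rule gl_eq_refl, rule distrib_left)
  show "1 * a = a"
    by transfer (rule gl_eq_refl, rule mult_1_left)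
  show "a * 1 = a"
    by transfer (rule gl_eq_refl, rule mult_1_right)
  show "(0 :: ('a, 'b, 'c) Ugl) \<noteq> 1"
  proof (transfer, rule notI)
    assume "gl_eq (0 :: ('a, 'b, 'c) gl_free) 1"
    then have "poly_mapping.lookup (0 - 1 :: ('a, 'b, 'c) gl_free) 0 = 0"
      unfolding gl_eq_def by (rule gl_ideal_lookup_empty)
    then show False by (simp add: lookup_one)
  qed
qed

end

lift_definition egl :: "('p, 'q, 'l) letter \<times> ('p, 'q, 'l) letter \<Rightarrow> ('p, 'q, 'l) Ugl" is free_gen .

lift_definition uscale :: "complex \<Rightarrow> ('p, 'q, 'l) Ugl \<Rightarrow> ('p, 'q, 'l) Ugl" is
  "\<lambda>c x. Poly_Mapping.single 0 c * x"
proof -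
  fix c :: complex and a b :: "('p, 'q, 'l) gl_free"
  assume "gl_eq a b"
  then have "Poly_Mapping.single 0 c * (a - b) * 1 \<in> gl_ideal"
    unfolding gl_eq_def by (rule gl_ideal_mult)
  then show "gl_eq (Poly_Mapping.single 0 c * a) (Poly_Mapping.single 0 c * b)"
    by (simp add: gl_eq_def right_diff_distrib)
qed


section \<open>Irregular products and the projection onto $\mathbf{U}(gl(n))$\<close>

text \<open>$\mathbf{U}(gl(n))$, as the unital subalgebra generated by the $e_{i,j}$ with $i,j\in L$.\<close>

inductive_set Ugln :: "('p, 'q, 'l) Ugl set" where
  scalar: "uscale c 1 \<in> Ugln"
| gen: "egl (Proper i, Proper j) \<in> Ugln"
| add: "x \<in> Ugln \<Longrightarrow> y \<in> Ugln \<Longrightarrow> x + y \<in> Ugln"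
| mult: "x \<in> Ugln \<Longrightarrow> y \<in> Ugln \<Longrightarrow> x * y \<in> Ugln"

text \<open>
  Since products are indexed from right to left, the list \<open>ys\<close> is $(a_1,b_1),\dots,(a_m,b_m)$,
  with 0-based positions.
\<close>

definition irregular :: "(('p, 'q, 'l) letter \<times> ('p, 'q, 'l) letter) list \<Rightarrow> bool" where
  "irregular ys \<longleftrightarrow>
     (\<exists>i < length ys. \<exists>\<gamma>. virtual \<gamma> \<and>
        card {j. j \<le> i \<and> snd (ys ! j) = \<gamma>} > card {j. j < i \<and> fst (ys ! j) = \<gamma>})"

inductive_set Irr :: "('p, 'q, 'l) Ugl set" where
  zero: "0 \<in> Irr"
| add_irregular:
    "z \<in> Irr \<Longrightarrow> irregular ys \<Longrightarrow> z + u * prod_list (map egl (rev ys)) \<in> Irr"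

text \<open>
  The value is meaningful for \<open>z\<close> in $Virt=\mathbf{U}(gl(n))\oplus\mathbf{Irr}$, where the
  decomposition is unique.
\<close>

definition devirt :: "('p, 'q, 'l) Ugl \<Rightarrow> ('p, 'q, 'l) Ugl" where
  "devirt z = (THE x. x \<in> Ugln \<and> (\<exists>y \<in> Irr. z = x + y))"


section \<open>Tableaux and bitableaux\<close>

definition is_partition :: "nat list \<Rightarrow> nat \<Rightarrow> bool" where
  "is_partition lam h \<longleftrightarrow> sorted_wrt (\<ge>) lam \<and> 0 \<notin> set lam \<and> sum_list lam = h"

text \<open>A tableau is the list of its rows, so \<^const>\<open>concat\<close> reads its cells in order.\<close>

type_synonym 'a tableau = "'a list list"

definition shape :: "'a tableau \<Rightarrow> nat list" where
  "shape T = map length T"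

definition e_tab ::
    "('p, 'q, 'l) letter tableau \<Rightarrow> ('p, 'q, 'l) letter tableau \<Rightarrow> ('p, 'q, 'l) Ugl" where
  "e_tab S T = prod_list (map egl (zip (concat S) (concat T)))"

definition proper_tab :: "'l tableau \<Rightarrow> ('p, 'q, 'l) letter tableau" where
  "proper_tab T = map (map Proper) T"

text \<open>Rows and columns are numbered from 1 here, as are the symbols $\alpha_r$, $\beta_c$.\<close>

definition Cstar :: "(nat \<Rightarrow> 'p) \<Rightarrow> nat list \<Rightarrow> ('p, 'q, 'l) letter tableau" where
  "Cstar \<alpha> lam = map (\<lambda>r. replicate (lam ! (r - 1)) (Alpha (\<alpha> r))) [1..<length lam + 1]"

definition Dstar :: "(nat \<Rightarrow> 'q) \<Rightarrow> nat list \<Rightarrow> ('p, 'q, 'l) letter tableau" where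
  "Dstar \<beta> lam = map (\<lambda>len. map (\<lambda>c. Beta (\<beta> c)) [1..<len + 1]) lam"

definition Capelli :: "(nat \<Rightarrow> 'p) \<Rightarrow> 'l tableau \<Rightarrow> 'l tableau \<Rightarrow> ('p, 'q, 'l) Ugl" where
  "Capelli \<alpha> S T =
     (let C = Cstar \<alpha> (shape S)
      in devirt (e_tab (proper_tab S) C * e_tab C (proper_tab T)))"

definition YoungCapelli ::
    "(nat \<Rightarrow> 'p) \<Rightarrow> (nat \<Rightarrow> 'q) \<Rightarrow> 'l tableau \<Rightarrow> 'l tableau \<Rightarrow> ('p, 'q, 'l) Ugl" where
  "YoungCapelli \<alpha> \<beta> S T =
     (let C = Cstar \<alpha> (shape S); D = Dstar \<beta> (shape S)
      in devirt (e_tab (proper_tab S) C * e_tab C D * e_tab D (proper_tab T)))"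

definition column_tab :: "'a list \<Rightarrow> 'a tableau" where
  "column_tab w = map (\<lambda>x. [x]) w"


section \<open>Irreducible characters of the symmetric group\<close>

text \<open>
  $\mathbf{S}_h$ consists of the permutations of \<open>{..<h}\<close>, and its group algebra of the functions
  \<open>(nat \<Rightarrow> nat) \<Rightarrow> complex\<close> supported on these.
\<close>

global_interpretation gralg: vector_space "\<lambda>(c :: complex) (f :: 'b \<Rightarrow> complex) x. c * f x"
  by standard (simp_all add: fun_eq_iff algebra_simps)

definition lin_trace ::
    "('b \<Rightarrow> complex) set \<Rightarrow> (('b \<Rightarrow> complex) \<Rightarrow> ('b \<Rightarrow> complex)) \<Rightarrow> complex" where
  "lin_trace V \<phi> =
     (let B = (SOME B. gralg.independent B \<and> gralg.span B = V)
      in \<Sum>b\<in>B. gralg.representation B (\<phi> b) b)"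

text \<open>Cell \<open>k\<close>, in the row-by-row numbering starting from 0, as a pair (row, column).\<close>

definition cell :: "nat list \<Rightarrow> nat \<Rightarrow> nat \<times> nat" where
  "cell mu k = concat (map (\<lambda>r. map (\<lambda>c. (r, c)) [0..<mu ! r]) [0..<length mu]) ! k"

definition row_group :: "nat list \<Rightarrow> (nat \<Rightarrow> nat) set" where
  "row_group mu = {p. p permutes {..<sum_list mu} \<and>
     (\<forall>k < sum_list mu. fst (cell mu (p k)) = fst (cell mu k))}"

definition col_group :: "nat list \<Rightarrow> (nat \<Rightarrow> nat) set" where
  "col_group mu = {q. q permutes {..<sum_list mu} \<and>
     (\<forall>k < sum_list mu. snd (cell mu (q k)) = snd (cell mu k))}"

definition young_symmetrizer :: "nat list \<Rightarrow> (nat \<Rightarrow> nat) \<Rightarrow> complex" where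
  "young_symmetrizer mu \<pi> =
     (\<Sum>p\<in>row_group mu. \<Sum>q\<in>col_group mu. if p \<circ> q = \<pi> then of_int (sign q) else 0)"

definition left_mult :: "(nat \<Rightarrow> nat) \<Rightarrow> ((nat \<Rightarrow> nat) \<Rightarrow> complex) \<Rightarrow> ((nat \<Rightarrow> nat) \<Rightarrow> complex)" where
  "left_mult \<sigma> f = (\<lambda>\<pi>. f (inv \<sigma> \<circ> \<pi>))"

text \<open>The left ideal generated by the Young symmetrizer: the irreducible module labelled by \<open>mu\<close>.\<close>

definition specht :: "nat list \<Rightarrow> ((nat \<Rightarrow> nat) \<Rightarrow> complex) set" where
  "specht mu =
     gralg.span {left_mult \<sigma> (young_symmetrizer mu) | \<sigma>. \<sigma> permutes {..<sum_list mu}}"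

definition specht_character :: "nat list \<Rightarrow> (nat \<Rightarrow> nat) \<Rightarrow> complex" where
  "specht_character mu \<sigma> = lin_trace (specht mu) (left_mult \<sigma>)"

definition conjugate :: "nat list \<Rightarrow> nat list" where
  "conjugate lam = map (\<lambda>c. length (filter (\<lambda>len. c < len) lam)) [0..<foldr max lam 0]"

text \<open>Labelled so that \<open>(1\<^sup>h)\<close> is the trivial and \<open>(h)\<close> the sign character.\<close>

definition chi :: "nat list \<Rightarrow> (nat \<Rightarrow> nat) \<Rightarrow> complex" where
  "chi lam \<sigma> = specht_character (conjugate lam) \<sigma>"


section \<open>Capelli immanants\<close>

definition Cimm ::
    "(nat \<Rightarrow> 'p) \<Rightarrow> nat list \<Rightarrow> 'l list \<Rightarrow> 'l list \<Rightarrow> ('p, 'q, 'l) Ugl" where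
  "Cimm \<alpha> lam i j =
     (\<Sum>\<sigma> | \<sigma> permutes {..<sum_list lam}.
        uscale (chi lam \<sigma>)
          (Capelli \<alpha> (column_tab (map (\<lambda>k. i ! \<sigma> k) [0..<sum_list lam])) (column_tab j)))"

end

theory Submission
  imports Defs "HOL-Combinatorics.Multiset_Permutations"
begin

text \<open>
  The projection is well defined because $\mathbf{U}(gl(n)) \cap \mathbf{Irr} = 0$. Indeed the superalgebra
  acts by superpolarization on functions on words; irregular products kill the functions supported on
  words without virtual letters, whereas $\mathbf{U}(gl(n))$ acts faithfully on these, as the top degree
  parts show. The same argument works after $A_0$ is enlarged.

  Modulo irregular products, contracting virtual symbols with the help of an auxiliary copy of $A_0$ gives
  \[ [U|\boxed{V}] = \sum_{p, q} \mathrm{sgn}(p)\, [U \circ p \circ q \,|\, V], \]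
  where \<open>p\<close> and \<open>q\<close> run over the row and column groups and the right-hand side consists of column Capelli
  bitableaux. The coefficients form, up to inversion and transposition of the diagram, the Young
  symmetrizer \<open>y\<close> of the conjugate partition. Every element of a left ideal \<open>W\<close> of the group algebra lies
  in the ideal generated by the character of \<open>W\<close>: if \<open>e\<close> is the orthogonal projection of the unit onto
  \<open>W\<close>, the character is, up to inversion, the sum of the conjugates of \<open>e\<close>, which are positive operators.
  Hence \<open>y\<close> is a combination of translates of the character.
\<close>

text \<open>The conjugate labelling of characters reflects the parities. A factor pairing a proper
  letter with an even virtual symbol is odd, so a symbol \<open>\<alpha> r\<close> repeated along a
  row forces antisymmetry over that row; contracting the odd symbols \<open>\<beta> c\<close> yields
  a sum over the column group in which no sign survives.

  The enveloping algebra is given only as a quotient of a free algebra, without a basis. The linear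
  independence of a PBW basis, as far as uniqueness of the projection requires it, has to be
  extracted from an action.

  Enlarging A_0 resolves a clash of symbols: C* of shape \<lambda> uses one even symbol per row, a
  column bitableau one per cell, and both are drawn from the same enumeration
  \<open>\<alpha>\<close>. Elements of U(gl(n)) contain no virtual letter, so every embedding of A_0
  maps them to the same element; the two sides of an identity may thus be embedded with disjoint
  sets of symbols.

  For the last step, positivity over the complex numbers is decisive: orthogonality to all
  translates of the character makes a sum of squared moduli vanish, hence each of its terms.\<close>

abbreviation uword :: "(('p, 'q, 'l) letter \<times> ('p, 'q, 'l) letter) list \<Rightarrow> ('p, 'q, 'l) Ugl" where
  "uword us \<equiv> prod_list (map egl us)"

section \<open>Words and scalars in the enveloping algebra\<close>

lemma free_alg_induct [case_names add single]:
  fixes f :: "'a free_alg"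
  assumes add: "\<And>f g. P f \<Longrightarrow> P g \<Longrightarrow> P (f + g)"
    and single: "\<And>us c. P (Poly_Mapping.single (FWord us) c)"
  shows "P f"
proof (induction f rule: update_induct)
  case const
  show ?case using single[of "[]" 0] by simp
next
  case (update f a b)
  have "Poly_Mapping.update a b f = f + Poly_Mapping.single a b"
    using update by (intro poly_mapping_eqI)
      (auto simp: lookup_update lookup_add lookup_single when_def in_keys_iff)
  then show ?case
    using add[OF update.IH single[of "letters a" b]] by simp
qed

lemma uword_abs: "uword us = abs_Ugl (Poly_Mapping.single (FWord us) 1)"
proof (induction us)
  case Nil
  then show ?case by (simp add: one_Ugl.abs_eq zero_fword_def flip: single_one)
next
  case (Cons x us)
  then show ?case
    by (simp add: egl.abs_eq times_Ugl.abs_eq free_gen_def mult_single plus_fword_def)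
qed

lemma uscale_uword_abs: "uscale c (uword us) = abs_Ugl (Poly_Mapping.single (FWord us) c)"
  by (simp add: uword_abs uscale.abs_eq mult_single plus_fword_def zero_fword_def)

lemma Ugl_induct [case_names add word]:
  assumes add: "\<And>x y. P x \<Longrightarrow> P y \<Longrightarrow> P (x + y)"
    and word: "\<And>c us. P (uscale c (uword us))"
  shows "P x"
proof -
  have "P (abs_Ugl f)" for f
  proof (induction f rule: free_alg_induct)
    case (add f g)
    then show ?case using assms(1) by (metis plus_Ugl.abs_eq)
  next
    case (single us c)
    then show ?case using word[of c us] by (simp add: uscale_uword_abs)
  qed
  then show ?thesis by (metis Quotient_abs_rep[OF Quotient_Ugl])
qed

lemma single_zero_commute:
  fixes f :: "'a free_alg"
  shows "f * Poly_Mapping.single 0 c = Poly_Mapping.single 0 c * f"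
  by (induction f rule: free_alg_induct) (simp_all add: distrib_left distrib_right mult_single mult.commute)

interpretation ugl: vector_space "uscale :: complex \<Rightarrow> ('p, 'q, 'l) Ugl \<Rightarrow> _"
proof
  fix a b :: complex and x y :: "('p, 'q, 'l) Ugl"
  show "uscale a (x + y) = uscale a x + uscale a y"
    by transfer (rule gl_eq_refl, rule distrib_left)
  show "uscale (a + b) x = uscale a x + uscale b x"
    by transfer (rule gl_eq_refl, simp only: single_add distrib_right)
  show "uscale a (uscale b x) = uscale (a * b) x"
    by transfer (rule gl_eq_refl, simp add: mult.assoc[symmetric] mult_single)
  show "uscale 1 x = x"
    by transfer (rule gl_eq_refl, simp)
qed

lemma uscale_mult_left: "uscale c x * y = uscale c (x * y)"
  by transfer (rule gl_eq_refl, rule mult.assoc)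

lemma uscale_mult_right: "x * uscale c y = uscale c (x * y)"
  by transfer (rule gl_eq_refl, simp only: mult.assoc[symmetric] single_zero_commute)

definition gl_sign :: "('p, 'q, 'l) letter \<Rightarrow> ('p, 'q, 'l) letter \<Rightarrow> ('p, 'q, 'l) letter
    \<Rightarrow> ('p, 'q, 'l) letter \<Rightarrow> complex" where
  "gl_sign a b c d = (- 1) ^ ((parity a + parity b) * (parity c + parity d))"

lemma super_sign_eq: "super_sign (a, b) (c, d) = Poly_Mapping.single 0 (gl_sign a b c d)"
proof -
  have "(- 1) ^ n = (Poly_Mapping.single 0 ((- 1) ^ n) :: 'x free_alg)" for n
    by (simp add: minus_one_power_iff single_uminus)
  then show ?thesis by (simp add: super_sign_def gl_sign_def)
qed

section \<open>Linear maps defined on words\<close>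

text \<open>
  A family indexed by words which respects the defining relations extends linearly to the whole
  enveloping algebra.
\<close>

definition respects_gl :: "(complex \<Rightarrow> 'm \<Rightarrow> 'm)
    \<Rightarrow> ((('p, 'q, 'l) letter \<times> ('p, 'q, 'l) letter) list \<Rightarrow> 'm :: ab_group_add) \<Rightarrow> bool" where
  "respects_gl s G \<longleftrightarrow> (\<forall>us vs a b c d. G (us @ (a, b) # (c, d) # vs) =
     s (gl_sign a b c d) (G (us @ (c, d) # (a, b) # vs))
     + (if b = c then G (us @ (a, d) # vs) else 0)
     - s (gl_sign a b c d) (if a = d then G (us @ (c, b) # vs) else 0))"

definition word_sum :: "(complex \<Rightarrow> 'm \<Rightarrow> 'm) \<Rightarrow> ('a list \<Rightarrow> 'm :: ab_group_add) \<Rightarrow> 'a free_alg \<Rightarrow> 'm" where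
  "word_sum s G f = (\<Sum>u\<in>Poly_Mapping.keys f. s (poly_mapping.lookup f u) (G (letters u)))"

text \<open>The value is computed on the representative picked by \<open>rep_Ugl\<close>;
  \<open>ulift_abs\<close> shows that any other representative gives the same once the family
  respects the relations.\<close>

definition ulift :: "(complex \<Rightarrow> 'm \<Rightarrow> 'm)
    \<Rightarrow> ((('p, 'q, 'l) letter \<times> ('p, 'q, 'l) letter) list \<Rightarrow> 'm :: ab_group_add)
    \<Rightarrow> ('p, 'q, 'l) Ugl \<Rightarrow> 'm" where
  "ulift s G x = word_sum s G (rep_Ugl x)"

locale gl_family = vector_space s for s :: "complex \<Rightarrow> 'm :: ab_group_add \<Rightarrow> 'm" +
  fixes G :: "(('p, 'q, 'l) letter \<times> ('p, 'q, 'l) letter) list \<Rightarrow> 'm"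
  assumes respects: "respects_gl s G"
begin

lemma word_sum_superset:
  assumes "finite A" "Poly_Mapping.keys f \<subseteq> A"
  shows "word_sum s G f = (\<Sum>u\<in>A. s (poly_mapping.lookup f u) (G (letters u)))"
  unfolding word_sum_def using assms
  by (intro sum.mono_neutral_left) (auto simp: in_keys_iff)

lemma word_sum_add: "word_sum s G (f + g) = word_sum s G f + word_sum s G g"
proof -
  let ?A = "Poly_Mapping.keys f \<union> Poly_Mapping.keys g"
  have "word_sum s G h = (\<Sum>u\<in>?A. s (poly_mapping.lookup h u) (G (letters u)))"
    if "Poly_Mapping.keys h \<subseteq> ?A" for h
    using that by (intro word_sum_superset) auto
  then show ?thesis
    by (simp add: keys_add lookup_add scale_left_distrib sum.distrib)
qed

lemma word_sum_zero: "word_sum s G 0 = 0"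
  by (simp add: word_sum_def)

lemma word_sum_minus: "word_sum s G (f - g) = word_sum s G f - word_sum s G g"
  using word_sum_add[of "f - g" g] by (simp add: algebra_simps)

lemma word_sum_single: "word_sum s G (Poly_Mapping.single (FWord us) c) = s c (G us)"
  by (simp add: word_sum_def)

text \<open>With monomials on both sides the relator unfolds into exactly the combination of words
  that \<open>respects\<close> makes vanish; the general case follows by bilinearity.\<close>

lemma word_sum_relator_single:
  "word_sum s G (Poly_Mapping.single (FWord us) c * gl_relator x y * Poly_Mapping.single (FWord vs) d) = 0"
proof -
  obtain a1 a2 b1 b2 where xy: "x = (a1, a2)" "y = (b1, b2)" by fastforce
  define W where "W ws = (Poly_Mapping.single (FWord (us @ ws @ vs)) (c * d)
      :: (('p, 'q, 'l) letter \<times> ('p, 'q, 'l) letter) free_alg)" for ws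
  have gen: "Poly_Mapping.single (FWord us) c * free_gen z * Poly_Mapping.single (FWord vs) d = W [z]" for z
    by (simp add: free_gen_def mult_single plus_fword_def W_def)
  have gen2: "Poly_Mapping.single (FWord us) c * (free_gen z * free_gen z') *
      Poly_Mapping.single (FWord vs) d = W [z, z']" for z z'
    by (simp add: free_gen_def mult_single plus_fword_def W_def)
  let ?e = "Poly_Mapping.single 0 (gl_sign a1 a2 b1 b2)
      :: (('p, 'q, 'l) letter \<times> ('p, 'q, 'l) letter) free_alg"
  have scal: "Poly_Mapping.single (FWord us) c * (?e * t) * Poly_Mapping.single (FWord vs) d
     = ?e * (Poly_Mapping.single (FWord us) c * t * Poly_Mapping.single (FWord vs) d)" for t
    by (simp only: mult.assoc[symmetric] single_zero_commute)
  define D1 D2 where "D1 = (if a2 = b1 then W [(a1, b2)] else 0)"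
    and "D2 = (if a1 = b2 then W [(b1, a2)] else 0)"
  have "Poly_Mapping.single (FWord us) c * (if a2 = b1 then free_gen (a1, b2) else 0)
      * Poly_Mapping.single (FWord vs) d = D1"
    and "Poly_Mapping.single (FWord us) c * (if a1 = b2 then free_gen (b1, a2) else 0)
      * Poly_Mapping.single (FWord vs) d = D2"
    by (simp_all add: D1_def D2_def gen)
  then have "Poly_Mapping.single (FWord us) c * gl_relator x y * Poly_Mapping.single (FWord vs) d =
     W [x, y] - ?e * W [y, x] - (D1 - ?e * D2)"
    unfolding gl_relator_def superbracket_def xy super_sign_eq fst_conv snd_conv
    by (simp only: right_diff_distrib left_diff_distrib scal gen2)
  moreover have W: "word_sum s G (?e * W ws) = s (c * d) (s (gl_sign a1 a2 b1 b2) (G (us @ ws @ vs)))"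
    "word_sum s G (W ws) = s (c * d) (G (us @ ws @ vs))" for ws
    by (simp_all add: W_def mult_single plus_fword_def zero_fword_def word_sum_single mult.commute)
  moreover have "word_sum s G D1 = s (c * d) (if a2 = b1 then G (us @ (a1, b2) # vs) else 0)"
    by (simp add: D1_def W word_sum_zero)
  moreover have "word_sum s G (?e * D2) = s (c * d) (s (gl_sign a1 a2 b1 b2)
      (if a1 = b2 then G (us @ (b1, a2) # vs) else 0))"
    using W(1)[of "[(b1, a2)]"]
    by (cases "a1 = b2") (simp_all only: D2_def if_True if_False append.simps mult_zero_right
        word_sum_zero scale_zero_right simp_thms)
  ultimately show ?thesis
    using respects[unfolded respects_gl_def, rule_format, of us a1 a2 b1 b2 vs]
    by (simp only: xy word_sum_minus append.simps flip: scale_right_diff_distrib) simp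
qed

lemma word_sum_relator: "word_sum s G (u * gl_relator x y * v) = 0"
proof (induction u rule: free_alg_induct)
  case (add f g)
  then show ?case by (simp add: distrib_right word_sum_add)
next
  case (single us c)
  show ?case
    by (induction v rule: free_alg_induct)
      (simp_all add: distrib_left word_sum_add word_sum_relator_single)
qed

lemma word_sum_ideal: "f \<in> gl_ideal \<Longrightarrow> word_sum s G f = 0"
  by (induction rule: gl_ideal.induct) (simp_all add: word_sum_zero word_sum_add word_sum_relator)

lemma ulift_abs: "ulift s G (abs_Ugl f) = word_sum s G f"
proof -
  have "gl_eq (rep_Ugl (abs_Ugl f)) f"
    by (rule rep_abs_rsp_left[OF Quotient3_Ugl gl_eq_refl]) simp
  then have "rep_Ugl (abs_Ugl f) - f \<in> gl_ideal"
    by (simp add: gl_eq_def)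
  from word_sum_ideal[OF this] show ?thesis
    by (simp add: word_sum_minus ulift_def)
qed

lemma ulift_word: "ulift s G (uword us) = G us"
  by (simp add: uword_abs ulift_abs word_sum_single)

lemma ulift_add: "ulift s G (x + y) = ulift s G x + ulift s G y"
proof -
  have "ulift s G (abs_Ugl f + abs_Ugl g) = ulift s G (abs_Ugl f) + ulift s G (abs_Ugl g)" for f g
    by (simp add: plus_Ugl.abs_eq ulift_abs word_sum_add)
  then show ?thesis by (metis Quotient_abs_rep[OF Quotient_Ugl])
qed

lemma ulift_scale_word: "ulift s G (uscale c (uword us)) = s c (G us)"
  by (simp add: uscale_uword_abs ulift_abs word_sum_single)

lemma ulift_scale: "ulift s G (uscale c x) = s c (ulift s G x)"
  by (induction x rule: Ugl_induct)
    (simp_all add: ulift_add ugl.scale_right_distrib scale_right_distrib ulift_scale_word)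

lemma ulift_zero: "ulift s G 0 = 0"
  using ulift_scale[of 0 0] by simp

lemma ulift_sum: "ulift s G (\<Sum>i\<in>A. f i) = (\<Sum>i\<in>A. ulift s G (f i))"
  by (induction A rule: infinite_finite_induct) (simp_all add: ulift_add ulift_zero)

end

lemma egl_relation:
  "egl (a, b) * egl (c, d) = uscale (gl_sign a b c d) (egl (c, d) * egl (a, b))
     + (if b = c then egl (a, d) else 0)
     - uscale (gl_sign a b c d) (if a = d then egl (c, b) else 0)"
proof -
  have "gl_relator (a, b) (c, d) \<in> gl_ideal"
    using gl_ideal.add_rel[OF gl_ideal.zero, of 1 _ _ 1] by simp
  then have "abs_Ugl (free_gen (a, b) * free_gen (c, d)) =
     abs_Ugl (Poly_Mapping.single 0 (gl_sign a b c d) * (free_gen (c, d) * free_gen (a, b))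
        + superbracket (a, b) (c, d))"
    by (simp add: Ugl.abs_eq_iff gl_eq_def gl_relator_def super_sign_eq algebra_simps)
  then show ?thesis
    by (simp add: superbracket_def super_sign_eq egl.abs_eq times_Ugl.abs_eq plus_Ugl.abs_eq
        minus_Ugl.abs_eq uscale.abs_eq zero_Ugl.abs_eq algebra_simps)
qed


subsection \<open>Relabelling the symbols of $A_0$\<close>

definition ren :: "('p \<Rightarrow> 'p2) \<Rightarrow> ('p, 'q, 'l) letter \<Rightarrow> ('p2, 'q, 'l) letter" where
  "ren f = map_letter f id id"

lemma ren_simps [simp]:
  "ren f (Alpha a) = Alpha (f a)" "ren f (Beta b) = Beta b" "ren f (Proper i) = Proper i"
  by (simp_all add: ren_def)

lemma parity_ren [simp]: "parity (ren f x) = parity x"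
  by (cases x) simp_all

lemma virtual_ren [simp]: "virtual (ren f x) = virtual x"
  by (cases x) simp_all

lemma ren_eq_iff: "inj f \<Longrightarrow> ren f x = ren f y \<longleftrightarrow> x = y"
  by (cases x; cases y) (auto simp: inj_eq)

abbreviation ren_pair :: "('p \<Rightarrow> 'p2) \<Rightarrow> ('p, 'q, 'l) letter \<times> ('p, 'q, 'l) letter
    \<Rightarrow> ('p2, 'q, 'l) letter \<times> ('p2, 'q, 'l) letter" where
  "ren_pair f \<equiv> map_prod (ren f) (ren f)"

text \<open>The homomorphism induced by a relabelling. Injectivity of \<open>f\<close> is what
  preserves the brackets: identifying two symbols would create new nonzero ones.\<close>

definition iota :: "('p \<Rightarrow> 'p2) \<Rightarrow> ('p, 'q, 'l) Ugl \<Rightarrow> ('p2, 'q, 'l) Ugl" where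
  "iota f = ulift uscale (\<lambda>us. uword (map (ren_pair f) us))"

context
  fixes f :: "'p \<Rightarrow> 'p2"
  assumes f: "inj f"
begin

interpretation gl_family uscale "\<lambda>us. uword (map (ren_pair f) us) :: ('p2, 'q, 'l) Ugl"
proof
  show "respects_gl uscale (\<lambda>us. uword (map (ren_pair f) us) :: ('p2, 'q, 'l) Ugl)"
    unfolding respects_gl_def
  proof (intro allI)
    fix us vs :: "(('p, 'q, 'l) letter \<times> ('p, 'q, 'l) letter) list" and a b c d :: "('p, 'q, 'l) letter"
    have s: "gl_sign (ren f a) (ren f b) (ren f c) (ren f d) = gl_sign a b c d"
      by (simp add: gl_sign_def)
    note e = egl_relation[of "ren f a" "ren f b" "ren f c" "ren f d", unfolded s ren_eq_iff[OF f]]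
    let ?u = "uword (map (ren_pair f) us)" and ?v = "uword (map (ren_pair f) vs)"
    have "uword (map (ren_pair f) (us @ (a, b) # (c, d) # vs)) =
       ?u * ((egl (ren f a, ren f b) * egl (ren f c, ren f d)) * ?v)"
      by (simp add: mult.assoc)
    then show "uword (map (ren_pair f) (us @ (a, b) # (c, d) # vs)) =
      uscale (gl_sign a b c d) (uword (map (ren_pair f) (us @ (c, d) # (a, b) # vs))) +
      (if b = c then uword (map (ren_pair f) (us @ (a, d) # vs)) else 0) -
      uscale (gl_sign a b c d) (if a = d then uword (map (ren_pair f) (us @ (c, b) # vs)) else 0)"
      unfolding e
      by (simp add: distrib_left distrib_right left_diff_distrib right_diff_distrib
          uscale_mult_left uscale_mult_right mult.assoc)
  qed
qed

lemma iota_word: "iota f (uword us) = uword (map (ren_pair f) us)"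
  unfolding iota_def by (rule ulift_word)

lemma iota_egl: "iota f (egl x) = egl (ren_pair f x)"
  using iota_word[of "[x]"] by simp

lemma iota_one: "iota f 1 = 1"
  using iota_word[of "[]"] by simp

lemma iota_add: "iota f (x + y) = iota f x + iota f y"
  unfolding iota_def by (rule ulift_add)

lemma iota_scale: "iota f (uscale c x) = uscale c (iota f x)"
  unfolding iota_def by (rule ulift_scale)

lemma iota_zero: "iota f 0 = 0"
  unfolding iota_def by (rule ulift_zero)

lemma iota_sum: "iota f (\<Sum>i\<in>A. g i) = (\<Sum>i\<in>A. iota f (g i))"
  unfolding iota_def by (rule ulift_sum)

lemma iota_minus: "iota f (x - y) = iota f x - iota f y"
  using iota_add[of "x - y" y] by simp

lemma iota_mult: "iota f (x * y) = iota f x * iota f y"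
proof (induction x rule: Ugl_induct)
  case (add x x')
  then show ?case by (simp add: distrib_right iota_add)
next
  case (word c us)
  show ?case
  proof (induction y rule: Ugl_induct)
    case (add y y')
    then show ?case by (simp add: distrib_left iota_add)
  next
    case (word d vs)
    have "uword us * uword vs = uword (us @ vs)"
      by simp
    then show ?case
      by (simp only: uscale_mult_left uscale_mult_right iota_scale iota_word) simp
  qed
qed

lemma irregular_ren:
  assumes "irregular ys"
  shows "irregular (map (ren_pair f) ys)"
proof -
  obtain i \<gamma> where i: "i < length ys" "virtual \<gamma>"
    "card {j. j < i \<and> fst (ys ! j) = \<gamma>} < card {j. j \<le> i \<and> snd (ys ! j) = \<gamma>}"
    using assms unfolding irregular_def by blast
  have "{j. j \<le> i \<and> snd (map (ren_pair f) ys ! j) = ren f \<gamma>} = {j. j \<le> i \<and> snd (ys ! j) = \<gamma>}"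
    "{j. j < i \<and> fst (map (ren_pair f) ys ! j) = ren f \<gamma>} = {j. j < i \<and> fst (ys ! j) = \<gamma>}"
    using i(1) by (auto simp: ren_eq_iff[OF f])
  then show ?thesis
    using i unfolding irregular_def by (intro exI[of _ i] conjI exI[of _ "ren f \<gamma>"]) simp_all
qed

lemma iota_Irr: "x \<in> Irr \<Longrightarrow> iota f x \<in> Irr"
proof (induction rule: Irr.induct)
  case zero
  then show ?case by (simp add: iota_zero Irr.zero)
next
  case (add_irregular z ys u)
  show ?case
    using Irr.add_irregular[OF add_irregular.IH irregular_ren[OF add_irregular.hyps(2)], of "iota f u"]
    by (simp add: iota_add iota_mult iota_word rev_map flip: map_map)
qed

end

text \<open>The generators of \<open>Ugln\<close> involve no symbol of A_0 and are therefore fixed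
  by every relabelling. This permits different embeddings on the two sides of an identity.\<close>

lemma iota_Ugln:
  assumes "inj f" "inj g" "x \<in> Ugln"
  shows "iota f x = iota g x"
  using assms(3)
  by induction (simp_all add: iota_add iota_mult iota_scale iota_one iota_egl assms(1,2))


subsection \<open>Words with inert letters\<close>

text \<open>
  $gl(m_0|m_1+n)$ acts on functions on words by superpolarization; \<^term>\<open>None\<close> is an additional
  even letter spanning a trivial module.
\<close>

primrec act :: "('p, 'q, 'l) letter \<Rightarrow> ('p, 'q, 'l) letter
    \<Rightarrow> (('p, 'q, 'l) letter option list \<Rightarrow> complex) \<Rightarrow> ('p, 'q, 'l) letter option list \<Rightarrow> complex" where
  "act a b \<phi> [] = 0"
| "act a b \<phi> (x # w) = (if x = Some a then \<phi> (Some b # w) else 0)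
     + (- 1) ^ ((parity a + parity b) * case_option 0 parity x) * act a b (\<lambda>v. \<phi> (x # v)) w"

lemma act_linear: "act a b (\<lambda>w. c * \<phi> w + \<psi> w) w = c * act a b \<phi> w + act a b \<psi> w"
  by (induction w arbitrary: \<phi> \<psi>) (simp_all add: algebra_simps)

lemma act_zero: "act a b (\<lambda>w. 0) w = 0"
  by (induction w) simp_all

lemma act_scale: "act a b (\<lambda>w. c * \<phi> w) w = c * act a b \<phi> w"
  using act_linear[of a b c \<phi> "\<lambda>_. 0" w] by (simp add: act_zero)

lemma act_commute:
  "act a b (act c d \<phi>) w = gl_sign a b c d * act c d (act a b \<phi>) w
     + (if b = c then act a d \<phi> w else 0) - gl_sign a b c d * (if a = d then act c b \<phi> w else 0)"
proof (induction w arbitrary: \<phi>)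
  case Nil
  then show ?case by simp
next
  case (Cons x w)
  \<comment> \<open>Separates the positions on which the two operators act. When the outer one has
    already turned the head \<open>a\<close> into \<open>b\<close>, the inner one has to pass
    \<open>b\<close>, hence the sign with \<open>parity b\<close>.\<close>
  have expand: "act a b (act c d \<phi>) (x # w) =
     (if x = Some a then (if b = c then \<phi> (Some d # w) else 0)
       + (- 1) ^ ((parity c + parity d) * parity b) * act c d (\<lambda>v. \<phi> (Some b # v)) w else 0)
     + (- 1) ^ ((parity a + parity b) * case_option 0 parity x) *
       ((if x = Some c then act a b (\<lambda>v. \<phi> (Some d # v)) w else 0)
         + (- 1) ^ ((parity c + parity d) * case_option 0 parity x) * act a b (act c d (\<lambda>v. \<phi> (x # v))) w)"
    for a b c d
  proof -
    have "act a b (\<lambda>v. act c d \<phi> (x # v)) w = (if x = Some c then act a b (\<lambda>v. \<phi> (Some d # v)) w else 0)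
         + (- 1) ^ ((parity c + parity d) * case_option 0 parity x) * act a b (act c d (\<lambda>v. \<phi> (x # v))) w"
      using act_linear[of a b "(- 1) ^ ((parity c + parity d) * case_option 0 parity x)"
          "act c d (\<lambda>v. \<phi> (x # v))" "\<lambda>v. if x = Some c then \<phi> (Some d # v) else 0" w]
      by (simp add: act_zero add.commute)
    then show ?thesis by simp
  qed
  show ?case
    unfolding expand Cons.IH
    by (cases "x = Some a"; cases "x = Some c"; cases "b = c"; cases "a = d")
      (auto simp: gl_sign_def minus_one_power_iff algebra_simps)
qed

abbreviation act_word :: "(('p, 'q, 'l) letter \<times> ('p, 'q, 'l) letter) list
    \<Rightarrow> (('p, 'q, 'l) letter option list \<Rightarrow> complex) \<Rightarrow> ('p, 'q, 'l) letter option list \<Rightarrow> complex" where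
  "act_word us \<phi> \<equiv> foldr (\<lambda>(a, b). act a b) us \<phi>"

lemma act_word_linear:
  "act_word us (\<lambda>w. c * \<phi> w + \<psi> w) = (\<lambda>w. c * act_word us \<phi> w + act_word us \<psi> w)"
  by (induction us) (auto intro!: ext simp: act_linear)

lemma act_word_zero: "act_word us (\<lambda>w. 0) = (\<lambda>w. 0)"
  by (induction us) (auto intro!: ext simp: act_zero)

lemma act_nonzero:
  assumes "act a b \<phi> w \<noteq> 0"
  shows "\<exists>u v. w = u @ Some a # v \<and> \<phi> (u @ Some b # v) \<noteq> 0"
  using assms
proof (induction w arbitrary: \<phi>)
  case (Cons x w)
  show ?case
  proof (cases "x = Some a \<and> \<phi> (Some b # w) \<noteq> 0")
    case True
    then show ?thesis by (intro exI[of _ "[]"] exI[of _ w]) simp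
  next
    case False
    then have "act a b (\<lambda>v. \<phi> (x # v)) w \<noteq> 0"
      using Cons.prems by (auto split: if_splits)
    from Cons.IH[OF this] obtain u v where "w = u @ Some a # v" "\<phi> (x # u @ Some b # v) \<noteq> 0"
      by blast
    then show ?thesis by (intro exI[of _ "x # u"] exI[of _ v]) simp
  qed
qed simp

lemma card_less_Suc_filter:
  "card {j. j < Suc i \<and> P j} = card {j. j < i \<and> P j} + (if P i then 1 else 0)"
proof -
  have "{j. j < Suc i \<and> P j} = {j. j < i \<and> P j} \<union> (if P i then {i} else {})"
    by (auto simp: less_Suc_eq)
  then show ?thesis by auto
qed

text \<open>A conservation law. Each factor \<open>(a, b)\<close> passes from a word with a letter
  \<open>b\<close> to one with \<open>a\<close> in its place, so along the support the copies of
  \<open>\<gamma>\<close> present are those created minus those annihilated so far.\<close>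

lemma act_word_content:
  assumes "\<And>w. \<phi> w \<noteq> 0 \<Longrightarrow> Some \<gamma> \<notin> set w"
    and "i \<le> length ys" "act_word (rev (take i ys)) \<phi> w \<noteq> 0"
  shows "count_list w (Some \<gamma>) + card {j. j < i \<and> snd (ys ! j) = \<gamma>} = card {j. j < i \<and> fst (ys ! j) = \<gamma>}"
  using assms(2,3)
proof (induction i arbitrary: w)
  case 0
  then show ?case using assms(1)[of w] by simp
next
  case (Suc i)
  obtain a b where ab: "ys ! i = (a, b)" by fastforce
  have "act a b (act_word (rev (take i ys)) \<phi>) w \<noteq> 0"
    using Suc.prems by (simp add: take_Suc_conv_app_nth ab)
  then obtain u v where uv: "w = u @ Some a # v" "act_word (rev (take i ys)) \<phi> (u @ Some b # v) \<noteq> 0"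
    using act_nonzero by blast
  from Suc.IH[OF _ uv(2)] Suc.prems(1) show ?case
    by (auto simp: card_less_Suc_filter ab uv(1))
qed

text \<open>At the position witnessing irregularity, the conservation law would require more
  annihilations of \<open>\<gamma>\<close> than there were creations; the function must vanish there
  already, whatever acts afterwards.\<close>

lemma act_irregular:
  assumes proper: "\<And>w \<gamma>. \<phi> w \<noteq> 0 \<Longrightarrow> virtual \<gamma> \<Longrightarrow> Some \<gamma> \<notin> set w"
    and "irregular ys"
  shows "act_word (rev ys) \<phi> = (\<lambda>_. 0)"
proof -
  obtain i \<gamma> where i: "i < length ys" "virtual \<gamma>"
    "card {j. j < i \<and> fst (ys ! j) = \<gamma>} < card {j. j \<le> i \<and> snd (ys ! j) = \<gamma>}"
    using assms(2) unfolding irregular_def by blast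
  obtain a b where ab: "ys ! i = (a, b)" by fastforce
  have "act a b (act_word (rev (take i ys)) \<phi>) w = 0" for w
  proof (rule ccontr)
    assume "act a b (act_word (rev (take i ys)) \<phi>) w \<noteq> 0"
    then obtain u v where uv: "w = u @ Some a # v" "act_word (rev (take i ys)) \<phi> (u @ Some b # v) \<noteq> 0"
      using act_nonzero by blast
    have "count_list (u @ Some b # v) (Some \<gamma>) + card {j. j < i \<and> snd (ys ! j) = \<gamma>}
        = card {j. j < i \<and> fst (ys ! j) = \<gamma>}"
      by (rule act_word_content[OF _ _ uv(2)]) (use proper i in auto)
    moreover have "card {j. j \<le> i \<and> snd (ys ! j) = \<gamma>} =
        card {j. j < i \<and> snd (ys ! j) = \<gamma>} + (if b = \<gamma> then 1 else 0)"
      using card_less_Suc_filter[of i "\<lambda>j. snd (ys ! j) = \<gamma>"] by (simp add: less_Suc_eq_le ab)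
    ultimately show False
      using i(3) by (auto split: if_splits)
  qed
  then have "act_word (rev (take (Suc i) ys)) \<phi> = (\<lambda>_. 0)"
    using i(1) by (simp add: take_Suc_conv_app_nth ab fun_eq_iff)
  moreover have "act_word (rev ys) \<phi> = act_word (rev (drop (Suc i) ys)) (act_word (rev (take (Suc i) ys)) \<phi>)"
    by (metis append_take_drop_id foldr_append rev_append)
  ultimately show ?thesis by (simp add: act_word_zero)
qed


subsection \<open>Functionals separating the elements of $\mathbf{U}(gl(n))$\<close>

text \<open>A tensor product of one function per pair \<open>(i, j)\<close>: the indicator of
  \<open>Proper j\<close> and the inert letter. Acting on it by a single generator and evaluating at
  \<open>Proper i\<close> detects whether that generator is \<open>(i, j)\<close>.\<close>

primrec test_fun :: "('l \<times> 'l) list \<Rightarrow> ('p, 'q, 'l) letter option list \<Rightarrow> complex" where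
  "test_fun [] w = (if w = [] then 1 else 0)"
| "test_fun (y # r) w = (case w of [] \<Rightarrow> 0 |
     x # v \<Rightarrow> (if x = None \<or> x = Some (Proper (snd y)) then 1 else 0) * test_fun r v)"

text \<open>
  Subtracting the value at the inert letter removes the contributions in which no factor acts on
  the position in question.
\<close>

primrec test_ev :: "('l \<times> 'l) list \<Rightarrow> (('p, 'q, 'l) letter option list \<Rightarrow> complex) \<Rightarrow> complex" where
  "test_ev [] \<psi> = \<psi> []"
| "test_ev (y # r) \<psi> = test_ev r (\<lambda>v. \<psi> (Some (Proper (fst y)) # v))
     - (if fst y = snd y then 1 else 0) * test_ev r (\<lambda>v. \<psi> (None # v))"

lemma test_ev_linear: "test_ev r (\<lambda>w. c * \<phi> w + \<psi> w) = c * test_ev r \<phi> + test_ev r \<psi>"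
  by (induction r arbitrary: \<phi> \<psi>) (simp_all add: algebra_simps)

lemma test_ev_zero: "test_ev r (\<lambda>w. 0) = 0"
  by (induction r) simp_all

lemma test_ev_scale: "test_ev r (\<lambda>w. c * \<phi> w) = c * test_ev r \<phi>"
  using test_ev_linear[of r c \<phi> "\<lambda>_. 0"] by (simp add: test_ev_zero)

lemma test_ev_sum_list:
  "test_ev r (\<lambda>w. \<Sum>i\<leftarrow>is. f i w) = (\<Sum>i\<leftarrow>is. test_ev r (f i))"
proof (induction "is")
  case (Cons i "is")
  then show ?case
    using test_ev_linear[of r 1 "f i" "\<lambda>w. \<Sum>i\<leftarrow>is. f i w"] by simp
qed (simp add: test_ev_zero)

lemma test_fun_proper:
  "test_fun r w \<noteq> 0 \<Longrightarrow> virtual \<gamma> \<Longrightarrow> Some \<gamma> \<notin> set w"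
  by (induction r arbitrary: w) (auto split: list.splits if_splits)

definition test_word :: "('l \<times> 'l) list \<Rightarrow> (('p, 'q, 'l) letter \<times> ('p, 'q, 'l) letter) list \<Rightarrow> complex" where
  "test_word r us = test_ev r (act_word us (test_fun r))"

lemma test_family: "gl_family (*) (test_word r :: (('p, 'q, 'l) letter \<times> ('p, 'q, 'l) letter) list \<Rightarrow> complex)"
proof
  show "respects_gl (*) (test_word r :: (('p, 'q, 'l) letter \<times> ('p, 'q, 'l) letter) list \<Rightarrow> complex)"
    unfolding respects_gl_def
  proof (intro allI)
    fix us vs :: "(('p, 'q, 'l) letter \<times> ('p, 'q, 'l) letter) list" and a b c d :: "('p, 'q, 'l) letter"
    define \<psi> :: "('p, 'q, 'l) letter option list \<Rightarrow> complex" where "\<psi> = act_word vs (test_fun r)"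
    define E where "E \<phi> = test_ev r (act_word us \<phi>)" for \<phi>
    have E: "E (\<lambda>w. k * \<phi> w + \<phi>' w) = k * E \<phi> + E \<phi>'" "E (\<lambda>w. 0) = 0" for k \<phi> \<phi>'
      by (simp_all only: E_def act_word_linear test_ev_linear act_word_zero test_ev_zero)
    \<comment> \<open>Brought into nested form \<open>k * \<phi> w + \<phi>' w\<close> ending in 0,
      so that the linearity of \<open>E\<close> applies term by term.\<close>
    have "act a b (act c d \<psi>) = (\<lambda>w. gl_sign a b c d * act c d (act a b \<psi>) w
      + ((if b = c then 1 else 0) * act a d \<psi> w
        + (- gl_sign a b c d * (if a = d then 1 else 0) * act c b \<psi> w + 0)))"
      by (rule ext, subst act_commute) simp
    then have "E (act a b (act c d \<psi>)) = gl_sign a b c d * E (act c d (act a b \<psi>))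
      + ((if b = c then 1 else 0) * E (act a d \<psi>)
        + (- gl_sign a b c d * (if a = d then 1 else 0) * E (act c b \<psi>) + 0))"
      by (simp only: E)
    then show "test_word r (us @ (a, b) # (c, d) # vs) =
      gl_sign a b c d * test_word r (us @ (c, d) # (a, b) # vs) +
      (if b = c then test_word r (us @ (a, d) # vs) else 0) -
      gl_sign a b c d * (if a = d then test_word r (us @ (c, b) # vs) else 0)"
      by (simp add: test_word_def flip: \<psi>_def E_def)
  qed
qed (simp_all add: algebra_simps)

abbreviation test :: "('l \<times> 'l) list \<Rightarrow> ('p, 'q, 'l) Ugl \<Rightarrow> complex" where
  "test r \<equiv> ulift (*) (test_word r)"

lemmas test_uword = gl_family.ulift_word[OF test_family]
  and test_zero = gl_family.ulift_zero[OF test_family]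
  and test_add = gl_family.ulift_add[OF test_family]
  and test_scale = gl_family.ulift_scale[OF test_family]
  and test_sum = gl_family.ulift_sum[OF test_family]

text \<open>Test functions are supported on words without virtual letters, so the irregular right
  factor annihilates them before the left factor can act.\<close>

lemma test_Irr: "z \<in> Irr \<Longrightarrow> test r z = 0"
proof (induction rule: Irr.induct)
  case zero
  then show ?case by (rule test_zero)
next
  case (add_irregular z ys u)
  have "test r (u * uword (rev ys)) = 0"
  proof (induction u rule: Ugl_induct)
    case (add x y)
    then show ?case by (simp add: distrib_right test_add)
  next
    case (word c us)
    have "act_word (rev ys) (test_fun r) = (\<lambda>_. 0)"
      using test_fun_proper add_irregular.hyps(2) by (rule act_irregular)
    moreover have "uword us * uword (rev ys) = uword (us @ rev ys)"
      by simp
    ultimately show ?case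
      by (simp only: uscale_mult_left test_scale test_uword)
        (simp add: test_word_def act_word_zero test_ev_zero)
  qed
  then show ?case by (simp add: test_add add_irregular.IH)
qed


section \<open>Values of the test functionals on words in the proper generators\<close>

abbreviation proper_word :: "('l \<times> 'l) list \<Rightarrow> (('p, 'q, 'l) letter \<times> ('p, 'q, 'l) letter) list" where
  "proper_word \<equiv> map (map_prod Proper Proper)"

definition tens :: "('a \<Rightarrow> complex) \<Rightarrow> ('a list \<Rightarrow> complex) \<Rightarrow> 'a list \<Rightarrow> complex" where
  "tens f \<psi> w = (case w of [] \<Rightarrow> 0 | x # v \<Rightarrow> f x * \<psi> v)"

definition act_letter :: "'l \<times> 'l \<Rightarrow> (('p, 'q, 'l) letter option \<Rightarrow> complex)
    \<Rightarrow> ('p, 'q, 'l) letter option \<Rightarrow> complex" where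
  "act_letter z f x = (if x = Some (Proper (fst z)) then f (Some (Proper (snd z))) else 0)"

text \<open>The coproduct of a word: all ways of distributing its factors, in order and with
  multiplicity, over the first position and the remaining positions.\<close>

primrec splits :: "'a list \<Rightarrow> ('a list \<times> 'a list) list" where
  "splits [] = [([], [])]"
| "splits (z # w) = map (apfst ((#) z)) (splits w) @ map (apsnd ((#) z)) (splits w)"

lemma act_tens:
  "act (Proper i) (Proper j) (tens f \<psi>) w =
     tens (act_letter (i, j) f) \<psi> w + tens f (act (Proper i) (Proper j) \<psi>) w"
  by (cases w) (simp_all add: tens_def act_letter_def act_scale)

lemma act_sum_list: "act a b (\<lambda>w. \<Sum>i\<leftarrow>is. f i w) w = (\<Sum>i\<leftarrow>is. act a b (f i) w)"
proof (induction "is")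
  case (Cons i "is")
  then show ?case
    using act_linear[of a b 1 "f i" "\<lambda>w. \<Sum>i\<leftarrow>is. f i w" w] by simp
qed (simp add: act_zero)

text \<open>The iterated Leibniz rule. No signs occur, because generators with two proper indices
  are even.\<close>

lemma act_word_tens:
  "act_word (proper_word w) (tens f \<psi>) =
     (\<lambda>v. \<Sum>p\<leftarrow>splits w. tens (foldr act_letter (fst p) f) (act_word (proper_word (snd p)) \<psi>) v)"
proof (induction w)
  case Nil
  then show ?case by (simp add: fun_eq_iff)
next
  case (Cons z w)
  obtain i j where z: "z = (i, j)" by fastforce
  have "act (Proper i) (Proper j)
      (\<lambda>v. \<Sum>p\<leftarrow>splits w. tens (foldr act_letter (fst p) f) (act_word (proper_word (snd p)) \<psi>) v) v =
    (\<Sum>p\<leftarrow>splits w. tens (act_letter (i, j) (foldr act_letter (fst p) f)) (act_word (proper_word (snd p)) \<psi>) v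
      + tens (foldr act_letter (fst p) f) (act (Proper i) (Proper j) (act_word (proper_word (snd p)) \<psi>)) v)" for v
    by (simp only: act_sum_list act_tens)
  then show ?case
    by (simp add: Cons.IH z o_def fun_eq_iff sum_list_addf)
qed

lemma length_splits: "(I, J) \<in> set (splits w) \<Longrightarrow> length I + length J = length w"
  by (induction w arbitrary: I J) auto

lemma count_splits_Nil:
  "length (filter (\<lambda>p. fst p = [] \<and> mset (snd p) = M) (splits w)) = (if mset w = M then 1 else 0)"
proof (induction w arbitrary: M)
  case (Cons z w)
  have "(add_mset z (mset J) = M) = (z \<in># M \<and> mset J = M - {#z#})" for J
    by auto
  then have "filter (\<lambda>p. fst p = [] \<and> add_mset z (mset (snd p)) = M) (splits w) =
    (if z \<in># M then filter (\<lambda>p. fst p = [] \<and> mset (snd p) = M - {#z#}) (splits w) else [])"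
    by simp
  then show ?case
    using Cons.IH[of "M - {#z#}"] by (auto simp: filter_map o_def)
qed auto

text \<open>Such a split takes out one occurrence of \<open>y\<close> and leaves everything else,
  which can be done once for every occurrence.\<close>

lemma count_splits_single:
  "length (filter (\<lambda>p. fst p = [y] \<and> mset (snd p) = M) (splits w)) =
     (if mset w = add_mset y M then count (mset w) y else 0)"
proof (induction w arbitrary: M)
  case (Cons z w)
  have "(add_mset z (mset J) = M) = (z \<in># M \<and> mset J = M - {#z#})" for J
    by auto
  then have *: "filter (\<lambda>p. fst p = [y] \<and> add_mset z (mset (snd p)) = M) (splits w) =
    (if z \<in># M then filter (\<lambda>p. fst p = [y] \<and> mset (snd p) = M - {#z#}) (splits w) else [])"
    by simp
  have "length (filter (\<lambda>p. fst p = [y] \<and> mset (snd p) = M) (splits (z # w))) =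
    (if z = y \<and> mset w = M then 1 else 0) +
    (if z \<in># M \<and> mset w = add_mset y (M - {#z#}) then count (mset w) y else 0)"
    using Cons.IH[of "M - {#z#}"] * count_splits_Nil[of M w]
    by (cases "z = y") (auto simp: filter_map o_def)
  also have "\<dots> = (if mset (z # w) = add_mset y M then count (mset (z # w)) y else 0)"
  proof (cases "mset (z # w) = add_mset y M")
    case True
    show ?thesis
    proof (cases "z = y")
      case True
      with \<open>mset (z # w) = add_mset y M\<close> have "mset w = M" by simp
      with True show ?thesis by (auto simp: not_in_iff)
    next
      case False
      with True obtain K where "mset w = add_mset y K" "M = add_mset z K"
        by (auto simp: add_eq_conv_ex)
      with False show ?thesis by simp
    qed
  next
    case False
    have "mset w \<noteq> add_mset y (M - {#z#})" if "z \<in># M"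
      using False multi_member_split[OF that] by auto
    with False show ?thesis by auto
  qed
  finally show ?case .
qed simp

text \<open>The product of the factorials of the multiplicities in the list: the number of ways to
  match its entries with the factors of a word having the same multiset.\<close>

primrec test_const :: "'a list \<Rightarrow> complex" where
  "test_const [] = 1"
| "test_const (y # r) = of_nat (Suc (count (mset r) y)) * test_const r"

lemma test_const_nonzero: "test_const r \<noteq> 0"
  by (induction r) (simp_all del: of_nat_Suc)

lemma test_fun_Cons:
  "test_fun (y # r) = tens (\<lambda>x. if x = None \<or> x = Some (Proper (snd y)) then 1 else 0) (test_fun r)"
  by (auto simp: fun_eq_iff tens_def split: list.splits)

lemma test_ev_Cons:
  "test_ev (y # r) (tens f \<psi>) =
     (f (Some (Proper (fst y))) - (if fst y = snd y then f None else 0)) * test_ev r \<psi>"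
  by (simp add: tens_def test_ev_scale left_diff_distrib)

lemma sum_list_indicator: "(\<Sum>i\<leftarrow>is. if P i then c else 0) = of_nat (length (filter P is)) * (c :: complex)"
  by (induction "is") (simp_all add: algebra_simps)

text \<open>Every position must receive a factor, since otherwise it contributes 0. With at most as
  many factors as positions each receives exactly one, and this has to be the pair attached to it.
  Shorter words are included because they occur as tails in the induction.\<close>

lemma test_proper_word:
  "length w \<le> length r \<Longrightarrow>
     test_word r (proper_word w :: (('p, 'q, 'l) letter \<times> ('p, 'q, 'l) letter) list)
       = (if mset w = mset r then test_const r else 0)"
proof (induction r arbitrary: w)
  case Nil
  then show ?case by (simp add: test_word_def)
next
  case (Cons y r)
  define \<phi> :: "('p, 'q, 'l) letter option \<Rightarrow> complex"
    where "\<phi> = (\<lambda>x. if x = None \<or> x = Some (Proper (snd y)) then 1 else 0)"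
  let ?\<epsilon> = "\<lambda>f :: ('p, 'q, 'l) letter option \<Rightarrow> complex.
    f (Some (Proper (fst y))) - (if fst y = snd y then f None else 0)"
  let ?\<psi> = "test_fun r :: ('p, 'q, 'l) letter option list \<Rightarrow> complex"
  have term_eq: "?\<epsilon> (foldr act_letter I \<phi>) * test_ev r (act_word (proper_word J) ?\<psi>) =
      (if I = [y] \<and> mset J = mset r then test_const r else 0)"
    if "(I, J) \<in> set (splits w)" for I J
  proof (cases "I = []")
    \<comment> \<open>With no factor acting on this position, the value at
      \<open>Proper (fst y)\<close> is 1 just when the two indices agree, and the subtracted value
      at \<open>None\<close> cancels it.\<close>
    case True
    then show ?thesis by (simp add: \<phi>_def)
  next
    case False
    with length_splits[OF that] Cons.prems have "length J \<le> length r"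
      by (cases I) auto
    note IH = Cons.IH[OF this, unfolded test_word_def]
    show ?thesis
    proof (cases "mset J = mset r")
      case True
      then have "length J = length r" by (rule mset_eq_length)
      moreover have "length I > 0"
        using False by simp
      ultimately have "length I = 1"
        using length_splits[OF that] Cons.prems by (simp del: length_greater_0_conv)
      then obtain z where "I = [z]" by (auto simp: length_Suc_conv)
      then show ?thesis
        by (auto simp: IH True act_letter_def \<phi>_def prod_eq_iff)
    next
      case False
      then show ?thesis by (simp add: IH)
    qed
  qed
  have "test_word (y # r) (proper_word w :: (('p, 'q, 'l) letter \<times> ('p, 'q, 'l) letter) list) =
     (\<Sum>p\<leftarrow>splits w. ?\<epsilon> (foldr act_letter (fst p) \<phi>) *
        test_ev r (act_word (proper_word (snd p)) ?\<psi>))"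
    unfolding test_word_def test_fun_Cons \<phi>_def[symmetric] act_word_tens
    by (simp only: test_ev_sum_list test_ev_Cons)
  also have "\<dots> = (\<Sum>p\<leftarrow>splits w. if fst p = [y] \<and> mset (snd p) = mset r then test_const r else 0)"
    using term_eq by (intro arg_cong[of _ _ sum_list] map_cong refl) (metis prod.collapse)
  also have "\<dots> = of_nat (if mset w = mset (y # r) then count (mset w) y else 0) * test_const r"
    using count_splits_single[of y "mset r" w] by (simp add: sum_list_indicator)
  also have "\<dots> = (if mset w = mset (y # r) then test_const (y # r) else 0)"
    by simp
  finally show ?case .
qed


subsection \<open>The filtration of $\mathbf{U}(gl(n))$ by degree\<close>

abbreviation pword :: "('l \<times> 'l) list \<Rightarrow> ('p, 'q, 'l) Ugl" where
  "pword w \<equiv> uword (proper_word w)"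

definition degree_le :: "nat \<Rightarrow> ('p, 'q, 'l) Ugl set" where
  "degree_le d = ugl.span {pword w | w. length w \<le> d}"

lemma pword_degree_le: "length w \<le> d \<Longrightarrow> pword w \<in> degree_le d"
  unfolding degree_le_def by (rule ugl.span_base) blast

lemma degree_le_mono: "d \<le> e \<Longrightarrow> degree_le d \<subseteq> degree_le e"
  unfolding degree_le_def by (rule ugl.span_mono) auto

lemma degree_le_minus: "x \<in> degree_le d \<Longrightarrow> y \<in> degree_le d \<Longrightarrow> x - y \<in> degree_le d"
  unfolding degree_le_def by (rule ugl.span_diff)

lemma degree_le_add: "x \<in> degree_le d \<Longrightarrow> y \<in> degree_le d \<Longrightarrow> x + y \<in> degree_le d"
  unfolding degree_le_def by (rule ugl.span_add)

lemma degree_le_scale: "x \<in> degree_le d \<Longrightarrow> uscale c x \<in> degree_le d"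
  unfolding degree_le_def by (rule ugl.span_scale)

lemma degree_le_zero: "0 \<in> degree_le d"
  unfolding degree_le_def by (rule ugl.span_zero)

lemma degree_le_mult:
  assumes "x \<in> degree_le d" "y \<in> degree_le e"
  shows "x * y \<in> degree_le (d + e)"
proof -
  have "pword w * y \<in> degree_le (d + e)" if "length w \<le> d" for w
    using assms(2) unfolding degree_le_def
  proof (induction rule: ugl.span_induct_alt)
    case base
    then show ?case by (simp add: ugl.span_zero)
  next
    case (step c z y)
    then obtain v where v: "z = pword v" "length v \<le> e" by blast
    have "pword w * z \<in> degree_le (d + e)"
      using pword_degree_le[of "w @ v" "d + e"] v that by simp
    with step show ?case
      unfolding degree_le_def
      by (simp add: distrib_left uscale_mult_right ugl.span_add ugl.span_scale)
  qed
  with assms(1) show ?thesis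
    unfolding degree_le_def[of d]
  proof (induction rule: ugl.span_induct_alt)
    case base
    then show ?case by (simp add: degree_le_zero)
  next
    case (step c z x)
    then show ?case
      by (auto simp: distrib_right uscale_mult_left intro!: degree_le_add degree_le_scale)
  qed
qed

lemma Ugln_degree_le: "x \<in> Ugln \<Longrightarrow> \<exists>d. x \<in> degree_le d"
proof (induction rule: Ugln.induct)
  case (scalar c)
  have "uscale c 1 \<in> degree_le 0"
    using degree_le_scale[OF pword_degree_le[of "[]" 0]] by simp
  then show ?case ..
next
  case (gen i j)
  have "egl (Proper i, Proper j) \<in> degree_le 1"
    using pword_degree_le[of "[(i, j)]" 1] by simp
  then show ?case ..
next
  case (add x y)
  then obtain d e where "x \<in> degree_le d" "y \<in> degree_le e" by blast
  then have "x + y \<in> degree_le (max d e)"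
    by (meson degree_le_add degree_le_mono max.cobounded1 max.cobounded2 subsetD)
  then show ?case ..
next
  case (mult x y)
  then show ?case using degree_le_mult by blast
qed

lemma egl_proper_commute:
  "egl (map_prod Proper Proper y) * egl (map_prod Proper Proper z)
     - egl (map_prod Proper Proper z) * egl (map_prod Proper Proper y)
     \<in> (degree_le 1 :: ('p, 'q, 'l) Ugl set)"
proof -
  obtain a b c d where yz: "y = (a, b)" "z = (c, d)" by fastforce
  let ?e = "\<lambda>i j. egl (Proper i, Proper j) :: ('p, 'q, 'l) Ugl"
  have "?e i j \<in> degree_le 1" for i j
    using pword_degree_le[of "[(i, j)]" 1] by simp
  then have "(if b = c then ?e a d else 0) - (if a = d then ?e c b else 0) \<in> degree_le 1"
    by (intro degree_le_minus) (auto simp: degree_le_zero)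
  moreover have "?e a b * ?e c d - ?e c d * ?e a b =
      (if b = c then ?e a d else 0) - (if a = d then ?e c b else 0)"
    by (subst egl_relation) (simp add: gl_sign_def)
  ultimately show ?thesis
    by (simp only: yz map_prod_simp)
qed

lemma pword_move:
  "pword (y # u @ v) - pword (u @ y # v)
     \<in> (degree_le (length u + length v) :: ('p, 'q, 'l) Ugl set)"
proof (induction u)
  case Nil
  then show ?case by (simp add: degree_le_zero)
next
  case (Cons z u)
  let ?e = "\<lambda>y. egl (map_prod Proper Proper y) :: ('p, 'q, 'l) Ugl"
  let ?P = "\<lambda>w. pword w :: ('p, 'q, 'l) Ugl"
  have "(?e y * ?e z - ?e z * ?e y) * ?P (u @ v) \<in> degree_le (1 + (length u + length v))"
    by (rule degree_le_mult[OF egl_proper_commute pword_degree_le]) simp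
  moreover have "?e z * (?P (y # u @ v) - ?P (u @ y # v)) \<in> degree_le (1 + (length u + length v))"
    using degree_le_mult[OF pword_degree_le[of "[z]" 1] Cons.IH] by simp
  moreover have "?P (y # (z # u) @ v) - ?P ((z # u) @ y # v) =
      (?e y * ?e z - ?e z * ?e y) * ?P (u @ v) + ?e z * (?P (y # u @ v) - ?P (u @ y # v))"
    by (simp add: left_diff_distrib right_diff_distrib mult.assoc)
  ultimately have *: "?P (y # (z # u) @ v) - ?P ((z # u) @ y # v) \<in> degree_le (1 + (length u + length v))"
    by (simp only: degree_le_add)
  moreover have "1 + (length u + length v) = length (z # u) + length v"
    by simp
  ultimately show ?case by (simp only:)
qed

text \<open>The associated graded algebra is commutative: each transposition of neighbours costs
  only a commutator of lower degree.\<close>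

lemma pword_mset:
  "mset w = mset w' \<Longrightarrow> length w \<le> Suc d \<Longrightarrow>
     pword w - pword w' \<in> (degree_le d :: ('p, 'q, 'l) Ugl set)"
proof (induction w arbitrary: w' d)
  case Nil
  then show ?case by (simp add: degree_le_zero)
next
  case (Cons y w)
  have "y \<in> set w'"
    using mset_eq_setD[OF Cons.prems(1)] by auto
  then obtain u v where w': "w' = u @ y # v"
    by (meson split_list)
  with Cons.prems have mset: "mset w = mset (u @ v)" by simp
  have len: "length w = length u + length v"
    using mset_eq_length[OF mset] by simp
  let ?P = "\<lambda>w. pword w :: ('p, 'q, 'l) Ugl"
  have 1: "?P (y # u @ v) - ?P w' \<in> (degree_le d :: ('p, 'q, 'l) Ugl set)"
    using pword_move[of y u v] degree_le_mono[of "length u + length v" d] Cons.prems(2) len w' by auto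
  have 2: "?P (y # w) - ?P (y # u @ v) \<in> (degree_le d :: ('p, 'q, 'l) Ugl set)"
  \<comment> \<open>For \<open>d = 0\<close> the tail \<open>w\<close> is empty, and the truncated
    degree \<open>d - 1\<close> must not be used.\<close>
  proof (cases "d = 0")
    case True
    with Cons.prems(2) len show ?thesis by (simp add: degree_le_zero)
  next
    case False
    then have "pword w - pword (u @ v) \<in> (degree_le (d - 1) :: ('p, 'q, 'l) Ugl set)"
      using Cons.prems(2) by (intro Cons.IH mset) simp
    from degree_le_mult[OF pword_degree_le[of "[y]" 1] this] False show ?thesis
      by (simp add: right_diff_distrib)
  qed
  show ?case
    using degree_le_add[OF 2 1] by simp
qed

lemma finite_words_length_le: "finite {w :: 'a::finite list. length w \<le> d}"
  using finite_lists_length_le[of "UNIV :: 'a set" d] by simp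

lemma degree_le_explicit:
  fixes x :: "('p, 'q, 'l::finite) Ugl"
  assumes "x \<in> degree_le d"
  shows "\<exists>c. x = (\<Sum>w | length w \<le> d. uscale (c w) (pword w))"
  using assms unfolding degree_le_def
proof (induction rule: ugl.span_induct_alt)
  case base
  then show ?case by (intro exI[of _ "\<lambda>_. 0"]) simp
next
  case (step k z x)
  then obtain v c where v: "z = pword v" "length v \<le> d"
    and c: "x = (\<Sum>w | length w \<le> d. uscale (c w) (pword w))" by blast
  have fin: "finite {w :: ('l \<times> 'l) list. length w \<le> d}"
    by (rule finite_words_length_le)
  have "(\<Sum>w | length w \<le> d. uscale (if w = v then k else 0) (pword w) :: ('p, 'q, 'l) Ugl) =
      (\<Sum>w | length w \<le> d. if w = v then uscale k (pword w) else 0)"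
    by (intro sum.cong) auto
  also have "\<dots> = uscale k z"
    using v fin by simp
  finally have "uscale k z + x = (\<Sum>w | length w \<le> d. uscale (c w + (if w = v then k else 0)) (pword w))"
    by (simp add: c ugl.scale_left_distrib sum.distrib)
  then show ?case by (rule exI[of _ "\<lambda>w. c w + (if w = v then k else 0)"])
qed

lemma iota_pword: "inj f \<Longrightarrow> iota f (pword w) = pword w"
  by (subst iota_word) (simp_all add: o_def map_prod_def case_prod_beta)

text \<open>
  The symbol of \<open>x\<close> in degree \<open>d\<close> is determined by the sums of its coefficients over all words with
  the same underlying multiset, and these are the values of the test functionals.
\<close>

lemma separation_step:
  fixes x :: "('p, 'q, 'l::finite) Ugl"
  assumes f: "inj f" and x: "x \<in> degree_le (Suc d)" and zero: "\<And>r. test r (iota f x) = 0"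
  shows "x \<in> degree_le d"
proof -
  have fin: "finite {w :: ('l \<times> 'l) list. length w \<le> Suc d}"
    by (rule finite_words_length_le)
  obtain c where c: "x = (\<Sum>w | length w \<le> Suc d. uscale (c w) (pword w))"
    using degree_le_explicit[OF x] by blast
  \<comment> \<open>One ordering is fixed for each multiset, as a normal form of a top-degree word
    modulo lower degree.\<close>
  define rep where "rep M = (SOME w. mset w = M)" for M :: "('l \<times> 'l) multiset"
  have rep: "mset (rep M) = M" for M
    unfolding rep_def by (rule someI_ex) (metis ex_mset)
  let ?W = "{w :: ('l \<times> 'l) list. length w = Suc d}"
  have fin': "finite ?W" by (rule finite_subset[OF _ fin]) auto
  have eval: "test r (iota f (pword w :: ('p, 'q, 'l) Ugl)) = (if mset w = mset r then test_const r else 0)"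
    if "length w \<le> length r" for w r
    using test_proper_word[OF that] by (simp only: iota_pword[OF f] test_uword)
  \<comment> \<open>Applying the functional of \<open>r\<close> isolates the words with the multiset
    of \<open>r\<close>; all words of other multisets contribute 0, and the common factor
    \<open>test_const r\<close> is nonzero.\<close>
  have coeff: "(\<Sum>w | length w \<le> Suc d \<and> mset w = mset r. c w) = 0" if "length r = Suc d" for r
  proof -
    have "0 = (\<Sum>w | length w \<le> Suc d. c w * test r (iota f (pword w :: ('p, 'q, 'l) Ugl)))"
      unfolding zero[of r, symmetric]
      by (subst c) (simp only: iota_sum[OF f] iota_scale[OF f] test_sum test_scale)
    also have "\<dots> = (\<Sum>w | length w \<le> Suc d. c w * (if mset w = mset r then test_const r else 0))"
      using that by (intro sum.cong refl) (simp only: eval mem_Collect_eq)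
    also have "\<dots> = (\<Sum>w | length w \<le> Suc d \<and> mset w = mset r. c w * test_const r)"
      using fin by (intro sum.mono_neutral_cong_right) auto
    finally show ?thesis
      using test_const_nonzero[of r] by (simp flip: sum_distrib_right)
  qed
  \<comment> \<open>After the passage to normal forms, the coefficient of each normal form is one of
    the vanishing sums \<open>coeff\<close>.\<close>
  have group: "(\<Sum>w\<in>?W. uscale (c w) (pword (rep (mset w)) :: ('p, 'q, 'l) Ugl)) = 0"
  proof -
    have "(\<Sum>w\<in>?W. uscale (c w) (pword (rep (mset w)) :: ('p, 'q, 'l) Ugl)) =
      (\<Sum>M\<in>mset ` ?W. \<Sum>w | w \<in> ?W \<and> mset w = M. uscale (c w) (pword (rep (mset w))))"
      by (rule sum.image_gen[OF fin'])
    also have "\<dots> = (\<Sum>M\<in>mset ` ?W. 0)"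
    proof (rule sum.cong[OF refl])
      fix M assume "M \<in> mset ` ?W"
      then obtain r where r: "M = mset r" "length r = Suc d" by blast
      have "(\<Sum>w | w \<in> ?W \<and> mset w = M. uscale (c w) (pword (rep (mset w)) :: ('p, 'q, 'l) Ugl)) =
        uscale (\<Sum>w | w \<in> ?W \<and> mset w = M. c w) (pword (rep M))"
        by (simp add: ugl.scale_sum_left)
      moreover have "{w. w \<in> ?W \<and> mset w = M} = {w. length w \<le> Suc d \<and> mset w = mset r}"
        using r by (auto dest: mset_eq_length)
      then have "(\<Sum>w | w \<in> ?W \<and> mset w = M. c w) = 0"
        using coeff[OF r(2)] by (simp only:)
      ultimately show "(\<Sum>w | w \<in> ?W \<and> mset w = M. uscale (c w) (pword (rep (mset w)) :: ('p, 'q, 'l) Ugl)) = 0"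
        by (simp only: ugl.scale_zero_left)
    qed
    finally show ?thesis by simp
  qed
  have "{w :: ('l \<times> 'l) list. length w \<le> Suc d} = {w. length w \<le> d} \<union> ?W"
    by auto
  then have "x = (\<Sum>w | length w \<le> d. uscale (c w) (pword w)) + (\<Sum>w\<in>?W. uscale (c w) (pword w))"
    unfolding c using fin by (subst sum.union_disjoint[symmetric]) auto
  also have "(\<Sum>w\<in>?W. uscale (c w) (pword w)) = (\<Sum>w\<in>?W. uscale (c w) (pword w - pword (rep (mset w)) :: ('p, 'q, 'l) Ugl))"
    using group by (simp add: ugl.scale_right_diff_distrib sum_subtractf)
  finally have eq: "x = (\<Sum>w | length w \<le> d. uscale (c w) (pword w))
    + (\<Sum>w\<in>?W. uscale (c w) (pword w - pword (rep (mset w))))" .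
  have "(\<Sum>w | length w \<le> d. uscale (c w) (pword w)) \<in> (degree_le d :: ('p, 'q, 'l) Ugl set)"
    unfolding degree_le_def by (intro ugl.span_sum ugl.span_scale ugl.span_base) auto
  moreover have "(\<Sum>w\<in>?W. uscale (c w) (pword w - pword (rep (mset w)))) \<in> (degree_le d :: ('p, 'q, 'l) Ugl set)"
    unfolding degree_le_def
    by (intro ugl.span_sum ugl.span_scale, unfold degree_le_def[symmetric], rule pword_mset)
      (simp_all add: rep)
  ultimately show ?thesis
    unfolding eq by (rule degree_le_add)
qed

lemma test_one: "test [] 1 = 1"
  using test_uword[of "[]" "[]"] by (simp add: test_word_def)

text \<open>The vanishing of all functionals lowers the degree down to 0, where only a scalar is
  left, and the functional of the empty list reads it off.\<close>

lemma separation: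
  fixes x :: "('p, 'q, 'l::finite) Ugl"
  assumes f: "inj f" and "x \<in> Ugln" and zero: "\<And>r. test r (iota f x) = 0"
  shows "x = 0"
proof -
  obtain d where "x \<in> degree_le d"
    using Ugln_degree_le[OF assms(2)] by blast
  then have "x \<in> degree_le 0"
    by (induction d) (auto intro: separation_step[OF f _ zero])
  then obtain c where c: "x = (\<Sum>w | length w \<le> 0. uscale (c w) (pword w))"
    using degree_le_explicit by blast
  then have x: "x = uscale (c []) 1" by simp
  have "test [] (iota f x) = c []"
    by (simp add: x iota_scale[OF f] iota_one[OF f] test_scale test_one)
  with zero[of "[]"] x show ?thesis by simp
qed

text \<open>Directness of U(gl(n)) + Irr, in the form needed for comparisons after an enlargement of
  A_0: \<open>x\<close> is zero as soon as its image becomes irregular there.\<close>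

theorem Ugln_Irr:
  fixes x :: "('p, 'q, 'l::finite) Ugl"
  assumes "inj f" "x \<in> Ugln" "iota f x \<in> Irr"
  shows "x = 0"
  using separation[OF assms(1,2)] test_Irr[OF assms(3)] by blast


subsection \<open>Congruence modulo irregular products\<close>

lemma Irr_word:
  assumes "irregular ys"
  shows "u * uword (rev ys) \<in> Irr"
  using Irr.add_irregular[OF Irr.zero assms, of u] by simp

lemma Irr_add:
  assumes "x \<in> Irr" "y \<in> Irr"
  shows "x + y \<in> Irr"
  using assms(2)
proof induction
  case zero
  then show ?case using assms(1) by simp
next
  case (add_irregular z ys u)
  then show ?case
    using Irr.add_irregular[of "x + z" ys u] by (simp add: add.assoc)
qed

lemma Irr_mult_left: "x \<in> Irr \<Longrightarrow> v * x \<in> Irr"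
proof (induction x rule: Irr.induct)
  case (add_irregular z ys u)
  then show ?case
    using Irr.add_irregular[of "v * z" ys "v * u"] by (simp add: distrib_left mult.assoc)
qed (simp add: Irr.zero)

lemma Irr_scale: "x \<in> Irr \<Longrightarrow> uscale c x \<in> Irr"
  using Irr_mult_left[of x "uscale c 1"] by (simp add: uscale_mult_left)

lemma Irr_uminus: "x \<in> Irr \<Longrightarrow> - x \<in> Irr"
  using Irr_mult_left[of x "- 1"] by simp

definition irr_eq :: "('p, 'q, 'l) Ugl \<Rightarrow> ('p, 'q, 'l) Ugl \<Rightarrow> bool" (infix "\<approx>" 50) where
  "x \<approx> y \<longleftrightarrow> x - y \<in> Irr"

lemma irr_eq_refl: "x \<approx> x"
  by (simp add: irr_eq_def Irr.zero)

lemma irr_eq_trans [trans]: "x \<approx> y \<Longrightarrow> y \<approx> z \<Longrightarrow> x \<approx> z"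
  using Irr_add[of "x - y" "y - z"] by (simp add: irr_eq_def)

lemma irr_eq_sym: "x \<approx> y \<Longrightarrow> y \<approx> x"
  using Irr_uminus[of "x - y"] by (simp add: irr_eq_def)

lemma irr_eq_add: "x \<approx> y \<Longrightarrow> x' \<approx> y' \<Longrightarrow> x + x' \<approx> y + y'"
  using Irr_add[of "x - y" "x' - y'"] by (simp add: irr_eq_def algebra_simps)

lemma irr_eq_mult_left: "x \<approx> y \<Longrightarrow> u * x \<approx> u * y"
  using Irr_mult_left[of "x - y" u] by (simp add: irr_eq_def right_diff_distrib)

lemma irr_eq_scale: "x \<approx> y \<Longrightarrow> uscale c x \<approx> uscale c y"
  using Irr_scale[of "x - y" c] by (simp add: irr_eq_def ugl.scale_right_diff_distrib)

lemma irr_eq_sum: "(\<And>i. i \<in> A \<Longrightarrow> f i \<approx> g i) \<Longrightarrow> (\<Sum>i\<in>A. f i) \<approx> (\<Sum>i\<in>A. g i)"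
  by (induction A rule: infinite_finite_induct) (simp_all add: irr_eq_refl irr_eq_add)

lemma irr_eq_add_Irr: "y \<in> Irr \<Longrightarrow> x + y \<approx> x"
  by (simp add: irr_eq_def)

lemma irr_eq_iota: "inj f \<Longrightarrow> x \<approx> y \<Longrightarrow> iota f x \<approx> iota f y"
  using iota_Irr[of f "x - y"] by (simp add: irr_eq_def iota_minus)

text \<open>Read from the right, \<open>\<gamma>\<close> is annihilated before any factor has
  created it. Factors further to the left are harmless, as \<open>Irr\<close> is a left
  ideal.\<close>

lemma annihilator_Irr:
  assumes "virtual \<gamma>" "\<gamma> \<notin> fst ` set us"
  shows "u * egl (a, \<gamma>) * uword us \<in> Irr"
proof -
  have "{j. j < length us \<and> fst ((rev us @ [(a, \<gamma>)]) ! j) = \<gamma>} = {}"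
    using assms(2) nth_mem[of _ "rev us"] by (fastforce simp: nth_append)
  moreover have "card {j. j \<le> length us \<and> snd ((rev us @ [(a, \<gamma>)]) ! j) = \<gamma>} > 0"
    by (subst card_gt_0_iff) (auto intro!: exI[of _ "length us"] simp: nth_append)
  ultimately have "irregular (rev us @ [(a, \<gamma>)])"
    unfolding irregular_def using assms(1)
    by (intro exI[of _ "length us"] conjI exI[of _ \<gamma>]) (simp, assumption, simp only: card.empty)
  from Irr_word[OF this, of u] show ?thesis by (simp add: mult.assoc)
qed


subsection \<open>The projection on balanced products\<close>

definition Virt :: "('p, 'q, 'l) Ugl set" where
  "Virt = {z. \<exists>x\<in>Ugln. z \<approx> x}"

text \<open>A sufficient condition for membership in \<open>Virt\<close> that is stable under
  exchanging neighbours and under taking the commutator terms, see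
  \<open>balanced_contract\<close>.\<close>

definition balanced :: "(('p, 'q, 'l) letter \<times> ('p, 'q, 'l) letter) list \<Rightarrow> bool" where
  "balanced us \<longleftrightarrow> (\<forall>\<gamma>. virtual \<gamma> \<longrightarrow> count_list (map fst us) \<gamma> = count_list (map snd us) \<gamma>)"

lemma count_list_Cons_of_bool: "count_list (x # xs) y = of_bool (x = y) + count_list xs y"
  by simp

lemma balanced_contract:
  "balanced (us @ (a, b) # (b, d) # vs) \<Longrightarrow> balanced (us @ (a, d) # vs)"
  "balanced (us @ (d, b) # (c, d) # vs) \<Longrightarrow> balanced (us @ (c, b) # vs)"
  "balanced (us @ (a, b) # (c, d) # vs) \<Longrightarrow> balanced (us @ (c, d) # (a, b) # vs)"
  unfolding balanced_def map_append count_list_append list.map fst_conv snd_conv count_list_Cons_of_bool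
  by (intro allI impI, drule spec, drule (1) mp, linarith)+

lemma Ugln_scale: "x \<in> Ugln \<Longrightarrow> uscale c x \<in> Ugln"
  using Ugln.mult[OF Ugln.scalar[of c], of x] by (simp add: uscale_mult_left)

lemma Ugln_zero: "0 \<in> Ugln"
  using Ugln.scalar[of 0] by simp

lemma Ugln_minus: "x \<in> Ugln \<Longrightarrow> y \<in> Ugln \<Longrightarrow> x - y \<in> Ugln"
  using Ugln.add[OF _ Ugln_scale[of y "- 1"], of x] by simp

lemma Ugln_sum: "(\<And>i. i \<in> A \<Longrightarrow> f i \<in> Ugln) \<Longrightarrow> (\<Sum>i\<in>A. f i) \<in> Ugln"
  by (induction A rule: infinite_finite_induct) (simp_all add: Ugln_zero Ugln.add)

lemma Virt_add: "x \<in> Virt \<Longrightarrow> y \<in> Virt \<Longrightarrow> x + y \<in> Virt"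
  unfolding Virt_def using irr_eq_add Ugln.add by blast

lemma Virt_scale: "x \<in> Virt \<Longrightarrow> uscale c x \<in> Virt"
  unfolding Virt_def using irr_eq_scale Ugln_scale by blast

lemma Virt_minus: "x \<in> Virt \<Longrightarrow> y \<in> Virt \<Longrightarrow> x - y \<in> Virt"
  using Virt_add[OF _ Virt_scale[of y "- 1"], of x] by simp

lemma Irr_Virt: "x \<in> Irr \<Longrightarrow> x \<in> Virt"
  unfolding Virt_def irr_eq_def by (auto intro!: bexI[of _ 0] Ugln_zero)

lemma uword_commute:
  "uword (us @ (a, b) # (c, d) # vs) = uscale (gl_sign a b c d) (uword (us @ (c, d) # (a, b) # vs))
     + (if b = c then uword (us @ (a, d) # vs) else 0)
     - uscale (gl_sign a b c d) (if a = d then uword (us @ (c, b) # vs) else 0)"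
proof -
  have "uword (us @ (a, b) # (c, d) # vs) = uword us * ((egl (a, b) * egl (c, d)) * uword vs)"
    by (simp add: mult.assoc)
  then show ?thesis
    unfolding egl_relation[of a b c d]
    by (simp add: distrib_left distrib_right left_diff_distrib right_diff_distrib
        uscale_mult_left uscale_mult_right mult.assoc)
qed

lemma uword_proper_Ugln:
  "(\<And>x. x \<in> set us \<Longrightarrow> \<not> virtual (fst x) \<and> \<not> virtual (snd x)) \<Longrightarrow> uword us \<in> Ugln"
proof (induction us)
  case Nil
  then show ?case using Ugln.scalar[of 1] by simp
next
  case (Cons x us)
  obtain i j where "x = (Proper i, Proper j)"
    using Cons.prems[of x] by (cases x; cases "fst x"; cases "snd x") auto
  with Cons show ?case by (auto intro: Ugln.mult Ugln.gen)
qed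

text \<open>
  An annihilator of a virtual symbol is moved to the far right, where it makes the product irregular;
  the commutators are shorter balanced products.
\<close>

lemma balanced_Virt: "balanced us \<Longrightarrow> uword us \<in> Virt"
proof (induction us rule: length_induct)
  case (1 us)
  show ?case
  proof (cases "\<forall>x\<in>set us. \<not> virtual (fst x) \<and> \<not> virtual (snd x)")
    case True
    then have "uword us \<in> Ugln" by (intro uword_proper_Ugln) blast
    then show ?thesis unfolding Virt_def using irr_eq_refl by blast
  next
    case False
    then obtain \<gamma> where \<gamma>: "virtual \<gamma>" "\<gamma> \<in> set (map fst us) \<or> \<gamma> \<in> set (map snd us)"
      by (auto; metis imageI)
    \<comment> \<open>By balance, a virtual symbol that is created somewhere is also annihilated
      somewhere, so an annihilator can always be chosen.\<close>
    with "1.prems" have "\<gamma> \<in> set (map snd us)"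
      unfolding balanced_def by (metis count_list_0_iff)
    then obtain us1 a us2 where us: "us = us1 @ (a, \<gamma>) # us2"
      by (auto dest!: split_list)
    \<comment> \<open>Inner induction on the factors to the right of the annihilator. Keeping the
      total length fixed lets the outer hypothesis apply to the commutator terms, which are shorter
      by one.\<close>
    have "uword (us1 @ (a, \<gamma>) # us2) \<in> Virt"
      if "length (us1 @ (a, \<gamma>) # us2) = length us" "balanced (us1 @ (a, \<gamma>) # us2)" for us1 us2
      using that
    proof (induction us2 arbitrary: us1)
      case Nil
      then show ?case
        using annihilator_Irr[OF \<gamma>(1), of "[]" "uword us1" a] by (auto intro: Irr_Virt)
    next
      case (Cons x us2)
      obtain c d where x: "x = (c, d)" by fastforce
      have "uword ((us1 @ [(c, d)]) @ (a, \<gamma>) # us2) \<in> Virt"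
        using Cons.prems by (intro Cons.IH) (auto simp: x intro: balanced_contract(3))
      then have "uword (us1 @ (c, d) # (a, \<gamma>) # us2) \<in> Virt"
        by simp
      moreover have "uword (us1 @ (a, d) # us2) \<in> Virt" if "\<gamma> = c"
        using Cons.prems that by (intro "1.IH"[rule_format]) (auto simp: x intro: balanced_contract)
      moreover have "uword (us1 @ (c, \<gamma>) # us2) \<in> Virt" if "a = d"
        using Cons.prems that by (intro "1.IH"[rule_format]) (auto simp: x intro: balanced_contract)
      ultimately show ?case
        unfolding x uword_commute[of us1 a \<gamma> c d us2]
        by (intro Virt_minus Virt_add Virt_scale) (simp_all add: Irr_Virt[OF Irr.zero])
    qed
    with us "1.prems" show ?thesis by blast
  qed
qed

lemma devirt_unique:
  fixes x x' :: "('p, 'q, 'l::finite) Ugl"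
  assumes "x \<in> Ugln" "x' \<in> Ugln" "x \<approx> x'"
  shows "x = x'"
proof -
  have "iota id (x - x') \<in> Irr"
    using assms(3) unfolding irr_eq_def by (intro iota_Irr) simp_all
  then have "x - x' = 0"
    by (intro Ugln_Irr[of id] Ugln_minus assms) simp_all
  then show ?thesis by simp
qed

lemma devirt:
  fixes z :: "('p, 'q, 'l::finite) Ugl"
  assumes "z \<in> Virt"
  shows "devirt z \<in> Ugln" "z \<approx> devirt z"
proof -
  have iff: "(\<exists>y\<in>Irr. z = x + y) \<longleftrightarrow> z \<approx> x" for x
    by (auto simp: irr_eq_def algebra_simps intro!: bexI[of _ "z - x"])
  obtain x where x: "x \<in> Ugln" "z \<approx> x"
    using assms unfolding Virt_def by blast
  have "devirt z = x"
    unfolding devirt_def iff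
  proof (rule the_equality)
    show "x \<in> Ugln \<and> z \<approx> x" using x by blast
    show "x' = x" if "x' \<in> Ugln \<and> z \<approx> x'" for x'
      using that x by (meson devirt_unique irr_eq_sym irr_eq_trans)
  qed
  with x show "devirt z \<in> Ugln" "z \<approx> devirt z" by simp_all
qed

text \<open>
  Identities between devirtualized elements may be checked after enlarging $A_0$, and then with a
  different embedding of $A_0$ on each side.
\<close>

lemma devirt_eqI:
  fixes z :: "('p, 'q, 'l::finite) Ugl"
  assumes f: "inj f" and g: "inj g" and z: "z \<in> Virt" and w: "\<And>i. i \<in> A \<Longrightarrow> w i \<in> Virt"
    and eq: "iota f z \<approx> (\<Sum>i\<in>A. uscale (c i) (iota g (w i)))"
  shows "devirt z = (\<Sum>i\<in>A. uscale (c i) (devirt (w i)))"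
proof -
  have mem: "(\<Sum>i\<in>A. uscale (c i) (devirt (w i))) \<in> Ugln"
    by (intro Ugln_sum Ugln_scale devirt w)
  have "iota f (devirt z) \<approx> iota f z"
    by (rule irr_eq_sym[OF irr_eq_iota[OF f devirt(2)[OF z]]])
  also note eq
  also have "(\<Sum>i\<in>A. uscale (c i) (iota g (w i))) \<approx> (\<Sum>i\<in>A. uscale (c i) (iota g (devirt (w i))))"
    by (intro irr_eq_sum irr_eq_scale irr_eq_iota g devirt w)
  also have "\<dots> = iota g (\<Sum>i\<in>A. uscale (c i) (devirt (w i)))"
    by (simp add: iota_sum[OF g] iota_scale[OF g])
  also have "\<dots> = iota f (\<Sum>i\<in>A. uscale (c i) (devirt (w i)))"
    by (rule iota_Ugln[OF g f mem])
  finally have "iota f (devirt z - (\<Sum>i\<in>A. uscale (c i) (devirt (w i)))) \<in> Irr"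
    by (simp add: irr_eq_def iota_minus[OF f])
  then have "devirt z - (\<Sum>i\<in>A. uscale (c i) (devirt (w i))) = 0"
    by (rule Ugln_Irr[OF f Ugln_minus[OF devirt(1)[OF z] mem]])
  then show ?thesis by simp
qed


subsection \<open>Contraction of adjacent products\<close>

lemma egl_commute:
  assumes "even ((parity a + parity b) * (parity c + parity d))" "b \<noteq> c" "a \<noteq> d"
  shows "egl (a, b) * egl (c, d) = egl (c, d) * egl (a, b)"
  using assms by (subst egl_relation) (simp add: gl_sign_def minus_one_power_iff del: even_mult_iff)

lemma egl_anticommute:
  assumes "odd (parity a + parity b)" "odd (parity c + parity d)" "b \<noteq> c" "a \<noteq> d"
  shows "egl (a, b) * egl (c, d) = - (egl (c, d) * egl (a, b))"
  using assms by (subst egl_relation) (simp add: gl_sign_def minus_one_power_iff)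

lemma uword_commute_all:
  assumes "\<And>c d. (c, d) \<in> set us \<Longrightarrow>
      even ((parity a + parity b) * (parity c + parity d)) \<and> b \<noteq> c \<and> a \<noteq> d"
  shows "egl (a, b) * uword us = uword us * egl (a, b)"
  using assms
proof (induction us)
  case (Cons x us)
  obtain c d where x: "x = (c, d)" by fastforce
  have "egl (a, b) * egl x = egl x * egl (a, b)"
    unfolding x using Cons.prems[of c d] by (intro egl_commute) (simp_all add: x)
  then have "egl (a, b) * uword (x # us) = egl x * (egl (a, b) * uword us)"
    by (simp flip: mult.assoc)
  also have "egl (a, b) * uword us = uword us * egl (a, b)"
    by (rule Cons.IH, rule Cons.prems, simp)
  finally show ?case by (simp add: mult.assoc)
qed simp

text \<open>The factors passed are even, so no sign appears, and each factor creating
  \<open>b\<close> leaves one contraction \<open>(a, c k)\<close>. Disjointness of the symbols lets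
  this contraction commute to the far right.\<close>

lemma annihilate_product:
  assumes "distinct L" "\<And>k. k \<in> set L \<Longrightarrow> even (parity (b' k) + parity (c k))"
    and "a \<notin> c ` set L" "b \<notin> c ` set L" "c ` set L \<inter> b' ` set L = {}"
  shows "egl (a, b) * uword (map (\<lambda>k. (b' k, c k)) L) = uword (map (\<lambda>k. (b' k, c k)) L) * egl (a, b)
     + (\<Sum>k | k \<in> set L \<and> b' k = b. uword (map (\<lambda>k. (b' k, c k)) (remove1 k L)) * egl (a, c k))"
  using assms
proof (induction L)
  case (Cons l L)
  let ?P = "\<lambda>L. uword (map (\<lambda>k. (b' k, c k)) L)"
  let ?e = "egl (b' l, c l)"
  let ?K = "{k. k \<in> set L \<and> b' k = b}"
  have IH: "egl (a, b) * ?P L = ?P L * egl (a, b) + (\<Sum>k\<in>?K. ?P (remove1 k L) * egl (a, c k))"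
    using Cons.prems by (intro Cons.IH) auto
  have "egl (a, b) * ?e = ?e * egl (a, b) + (if b' l = b then egl (a, c l) else 0)"
    using Cons.prems(2)[of l] Cons.prems(3)
    by (subst egl_relation) (auto simp: gl_sign_def minus_one_power_iff)
  then have "egl (a, b) * ?P (l # L) = (?e * egl (a, b) + (if b' l = b then egl (a, c l) else 0)) * ?P L"
    by (simp flip: mult.assoc)
  also have "\<dots> = ?e * (egl (a, b) * ?P L) + (if b' l = b then egl (a, c l) * ?P L else 0)"
    by (simp add: distrib_right mult.assoc)
  also have "egl (a, c l) * ?P L = ?P L * egl (a, c l)"
    using Cons.prems by (intro uword_commute_all) (auto 4 3 simp: disjoint_iff)
  also have "?e * (egl (a, b) * ?P L) = ?P (l # L) * egl (a, b) + (\<Sum>k\<in>?K. ?P (l # remove1 k L) * egl (a, c k))"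
    unfolding IH by (simp add: distrib_left sum_distrib_left mult.assoc)
  also have "(\<Sum>k\<in>?K. ?P (l # remove1 k L) * egl (a, c k)) = (\<Sum>k\<in>?K. ?P (remove1 k (l # L)) * egl (a, c k))"
    using Cons.prems(1) by (intro sum.cong) auto
  also have "?P (l # L) * egl (a, b) + (\<Sum>k\<in>?K. ?P (remove1 k (l # L)) * egl (a, c k)) +
      (if b' l = b then ?P L * egl (a, c l) else 0) =
    ?P (l # L) * egl (a, b) + (\<Sum>k\<in>?K \<union> (if b' l = b then {l} else {}). ?P (remove1 k (l # L)) * egl (a, c k))"
    using Cons.prems(1) by (auto simp: add.commute)
  also have "?K \<union> (if b' l = b then {l} else {}) = {k. k \<in> set (l # L) \<and> b' k = b}"
    by auto
  finally show ?case .
qed simp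

lemma sum_permutations_of_set_Cons:
  assumes "finite K" "K \<noteq> {}"
  shows "(\<Sum>zs | zs \<in> permutations_of_set K \<and> list_all2 R (x # xs) zs. F zs) =
    (\<Sum>k | k \<in> K \<and> R x k. \<Sum>zs | zs \<in> permutations_of_set (K - {k}) \<and> list_all2 R xs zs. F (k # zs))"
proof -
  have "(\<Sum>k | k \<in> K \<and> R x k. \<Sum>zs | zs \<in> permutations_of_set (K - {k}) \<and> list_all2 R xs zs. F (k # zs)) =
    (\<Sum>(k, zs)\<in>(SIGMA k:{k. k \<in> K \<and> R x k}. {zs. zs \<in> permutations_of_set (K - {k}) \<and> list_all2 R xs zs}).
       F (k # zs))"
    by (rule sum.Sigma) (use assms in auto)
  also have "\<dots> = (\<Sum>zs | zs \<in> permutations_of_set K \<and> list_all2 R (x # xs) zs. F zs)"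
    by (rule sum.reindex_bij_witness[of _ "\<lambda>zs. (hd zs, tl zs)" "\<lambda>(k, zs). k # zs"])
      (auto simp: permutations_of_set_nonempty[OF assms(2)] list_all2_Cons1)
  finally show ?thesis ..
qed

text \<open>The head of \<open>xs\<close> is the annihilator nearest to the product over
  \<open>L\<close>; it is contracted first, and the result joins \<open>X\<close>, which is why
  \<open>X\<close> varies in the induction. The surviving terms record which factor each annihilator
  met, that is, an ordering of \<open>L\<close>.\<close>

lemma contract_list:
  assumes "distinct L" "length xs = length L"
    and "\<And>k. k \<in> set L \<Longrightarrow> even (parity (b' k) + parity (c k))"
    and "\<And>x. x \<in> set xs \<Longrightarrow> virtual (snd x)"
    and "fst ` set xs \<inter> c ` set L = {}"
    and "(fst ` set xs \<union> c ` set L \<union> fst ` set X) \<inter> (snd ` set xs \<union> b' ` set L) = {}"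
  shows "uword (rev xs @ map (\<lambda>k. (b' k, c k)) L @ X) \<approx>
    (\<Sum>zs | zs \<in> permutations_of_set (set L) \<and> list_all2 (\<lambda>x k. b' k = snd x) xs zs.
       uword (rev (map2 (\<lambda>x k. (fst x, c k)) xs zs) @ X))"
  using assms
proof (induction xs arbitrary: L X)
  case Nil
  then have "{zs. zs \<in> permutations_of_set (set L) \<and> list_all2 (\<lambda>x k. b' k = snd x) [] zs} = {[]}"
    by auto
  with Nil show ?case by (simp add: irr_eq_refl)
next
  case (Cons x xs)
  obtain a b where x: "x = (a, b)" by fastforce
  let ?P = "\<lambda>L. map (\<lambda>k. (b' k, c k)) L"
  let ?K = "{k. k \<in> set L \<and> b' k = b}"
  have "uword (rev (x # xs) @ ?P L @ X) = uword (rev xs) * (egl (a, b) * uword (?P L)) * uword X"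
    by (simp add: x mult.assoc)
  also have "egl (a, b) * uword (?P L) = uword (?P L) * egl (a, b)
      + (\<Sum>k\<in>?K. uword (?P (remove1 k L)) * egl (a, c k))"
    using Cons.prems by (intro annihilate_product) (auto simp: x)
  also have "uword (rev xs) * (uword (?P L) * egl (a, b)
      + (\<Sum>k\<in>?K. uword (?P (remove1 k L)) * egl (a, c k))) * uword X =
    (\<Sum>k\<in>?K. uword (rev xs @ ?P (remove1 k L) @ (a, c k) # X))
      + (uword (rev xs) * uword (?P L)) * egl (a, b) * uword X"
    by (simp add: distrib_left distrib_right sum_distrib_left sum_distrib_right mult.assoc add.commute)
  \<comment> \<open>In the dropped term the annihilator has passed all of \<open>L\<close> and faces
    only \<open>X\<close>, where nothing creates its symbol.\<close>
  also have "\<dots> \<approx> (\<Sum>k\<in>?K. uword (rev xs @ ?P (remove1 k L) @ (a, c k) # X))"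
    using Cons.prems Cons.prems(4)[of x] by (intro irr_eq_add_Irr annihilator_Irr) (auto simp: x)
  also have "\<dots> \<approx> (\<Sum>k\<in>?K. \<Sum>zs | zs \<in> permutations_of_set (set (remove1 k L)) \<and> list_all2 (\<lambda>x k. b' k = snd x) xs zs.
       uword (rev (map2 (\<lambda>x k. (fst x, c k)) xs zs) @ (a, c k) # X))"
  proof (rule irr_eq_sum)
    fix k assume k: "k \<in> ?K"
    have "set (remove1 k L) \<subseteq> set L" by (rule set_remove1_subset)
    with k Cons.prems show "uword (rev xs @ ?P (remove1 k L) @ (a, c k) # X) \<approx>
      (\<Sum>zs | zs \<in> permutations_of_set (set (remove1 k L)) \<and> list_all2 (\<lambda>x k. b' k = snd x) xs zs.
         uword (rev (map2 (\<lambda>x k. (fst x, c k)) xs zs) @ (a, c k) # X))"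
      by (intro Cons.IH) (auto simp: x length_remove1)
  qed
  also have "\<dots> = (\<Sum>zs | zs \<in> permutations_of_set (set L) \<and> list_all2 (\<lambda>x k. b' k = snd x) (x # xs) zs.
       uword (rev (map2 (\<lambda>x k. (fst x, c k)) (x # xs) zs) @ X))"
    using Cons.prems(1,2) by (subst sum_permutations_of_set_Cons) (auto simp: x)
  finally show ?case .
qed

text \<open>The reversal matches the order in which \<open>contract_list\<close> consumes the
  annihilators, from right to left.\<close>

lemma bij_betw_permutes_lists:
  "bij_betw (\<lambda>p. rev (map p [0..<h])) {p. p permutes {..<h}} (permutations_of_set {..<h})"
proof (rule bij_betw_imageI)
  show inj: "inj_on (\<lambda>p. rev (map p [0..<h])) {p. p permutes {..<h}}"
  proof (rule inj_onI)
    fix p q assume "p \<in> {p. p permutes {..<h}}" "q \<in> {p. p permutes {..<h}}"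
      and "rev (map p [0..<h]) = rev (map q [0..<h])"
    then have pq: "p permutes {..<h}" "q permutes {..<h}" "\<forall>k<h. p k = q k"
      by auto
    then show "p = q"
      by (metis ext lessThan_iff permutes_not_in)
  qed
  have "rev (map p [0..<h]) \<in> permutations_of_set {..<h}" if "p permutes {..<h}" for p
    using permutes_image[OF that] permutes_inj_on[OF that]
    by (intro permutations_of_setI) (auto simp: distinct_map atLeast0LessThan)
  then have "(\<lambda>p. rev (map p [0..<h])) ` {p. p permutes {..<h}} \<subseteq> permutations_of_set {..<h}"
    by blast
  moreover have "card ((\<lambda>p. rev (map p [0..<h])) ` {p. p permutes {..<h}}) = card (permutations_of_set {..<h})"
    by (simp add: card_image[OF inj] card_permutations)
  ultimately show "(\<lambda>p. rev (map p [0..<h])) ` {p. p permutes {..<h}} = permutations_of_set {..<h}"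
    by (intro card_subset_eq) auto
qed

text \<open>A Wick-type formula: annihilator \<open>k\<close> is paired with creator
  \<open>p k\<close> of the same symbol, and repeated symbols allow several pairings. The creating
  factors must be even here.\<close>

lemma contract:
  fixes h :: nat
  assumes "\<And>k. k < h \<Longrightarrow> even (parity (b' k) + parity (c k))"
    and "\<And>k. k < h \<Longrightarrow> virtual (b k)"
    and "a ` {..<h} \<inter> c ` {..<h} = {}"
    and "(a ` {..<h} \<union> c ` {..<h} \<union> fst ` set X) \<inter> (b ` {..<h} \<union> b' ` {..<h}) = {}"
  shows "uword (map (\<lambda>k. (a k, b k)) [0..<h] @ map (\<lambda>k. (b' k, c k)) [0..<h] @ X) \<approx>
    (\<Sum>p | p permutes {..<h} \<and> (\<forall>k<h. b' (p k) = b k). uword (map (\<lambda>k. (a k, c (p k))) [0..<h] @ X))"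
proof -
  have "uword (rev (rev (map (\<lambda>k. (a k, b k)) [0..<h])) @ map (\<lambda>k. (b' k, c k)) [0..<h] @ X) \<approx>
    (\<Sum>zs | zs \<in> permutations_of_set (set [0..<h]) \<and>
        list_all2 (\<lambda>x k. b' k = snd x) (rev (map (\<lambda>k. (a k, b k)) [0..<h])) zs.
       uword (rev (map2 (\<lambda>x k. (fst x, c k)) (rev (map (\<lambda>k. (a k, b k)) [0..<h])) zs) @ X))"
    using assms by (intro contract_list) (auto simp: image_image atLeast0LessThan)
  also have "\<dots> = (\<Sum>p | p permutes {..<h} \<and> (\<forall>k<h. b' (p k) = b k).
      uword (map (\<lambda>k. (a k, c (p k))) [0..<h] @ X))"
  proof -
    have all2: "list_all2 (\<lambda>x k. b' k = snd x) (rev (map (\<lambda>k. (a k, b k)) [0..<h])) (rev (map p [0..<h]))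
        \<longleftrightarrow> (\<forall>k<h. b' (p k) = b k)" for p
      by (simp only: list_all2_rev) (auto simp: list_all2_conv_all_nth)
    have "bij_betw (\<lambda>p. rev (map p [0..<h]))
       {p \<in> {p. p permutes {..<h}}. \<forall>k<h. b' (p k) = b k}
       {zs \<in> permutations_of_set {..<h}.
        list_all2 (\<lambda>x k. b' k = snd x) (rev (map (\<lambda>k. (a k, b k)) [0..<h])) zs}"
      by (rule bij_betw_Collect[OF bij_betw_permutes_lists]) (simp only: all2)
    then have bij: "bij_betw (\<lambda>p. rev (map p [0..<h]))
       {p. p permutes {..<h} \<and> (\<forall>k<h. b' (p k) = b k)}
       {zs. zs \<in> permutations_of_set (set [0..<h]) \<and>
        list_all2 (\<lambda>x k. b' k = snd x) (rev (map (\<lambda>k. (a k, b k)) [0..<h])) zs}"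
      by (simp add: atLeast0LessThan)
    have "rev (map2 (\<lambda>x k. (fst x, c k)) (rev (map (\<lambda>k. (a k, b k)) [0..<h])) (rev (map p [0..<h])))
        = map (\<lambda>k. (a k, c (p k))) [0..<h]" for p
      by (simp add: zip_rev rev_map zip_map_map zip_same_conv_map flip: rev_map)
    then show ?thesis
      by (subst sum.reindex_bij_betw[OF bij, symmetric]) simp
  qed
  finally show ?thesis by simp
qed

text \<open>The counterpart of \<open>contract\<close> with even annihilating factors, where the
  creating ones may be odd. Distinct symbols leave a single pairing; used from right to left, it
  inserts fresh symbols.\<close>

lemma contract_unique:
  assumes "distinct L" "inj_on b (set L)"
    and "\<And>k. k \<in> set L \<Longrightarrow> virtual (b k)"
    and "\<And>k. k \<in> set L \<Longrightarrow> even (parity (a k) + parity (b k))"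
    and "a ` set L \<inter> c ` set L = {}"
    and "(a ` set L \<union> c ` set L \<union> fst ` set X) \<inter> b ` set L = {}"
  shows "uword (map (\<lambda>k. (a k, b k)) L @ map (\<lambda>k. (b k, c k)) L @ X) \<approx> uword (map (\<lambda>k. (a k, c k)) L @ X)"
  using assms
proof (induction L arbitrary: X rule: rev_induct)
  case Nil
  then show ?case by (simp add: irr_eq_refl)
next
  case (snoc l L)
  let ?AB = "uword (map (\<lambda>k. (a k, b k)) L)" and ?BC = "uword (map (\<lambda>k. (b k, c k)) L)"
  have comm: "egl (a l, b l) * ?BC = ?BC * egl (a l, b l)"
  proof (rule uword_commute_all)
    fix c' d assume "(c', d) \<in> set (map (\<lambda>k. (b k, c k)) L)"
    then obtain k where k: "k \<in> set L" "c' = b k" "d = c k" by auto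
    have "l \<noteq> k" using k(1) snoc.prems(1) by auto
    then have "b l \<noteq> b k" using snoc.prems(2) k(1) by (auto simp: inj_on_def)
    moreover have "a l \<noteq> c k" using snoc.prems(5) k(1) by auto
    ultimately show "even ((parity (a l) + parity (b l)) * (parity c' + parity d)) \<and> b l \<noteq> c' \<and> a l \<noteq> d"
      using snoc.prems(4)[of l] k by simp
  qed
  have rel: "egl (a l, b l) * egl (b l, c l) = egl (b l, c l) * egl (a l, b l) + egl (a l, c l)"
    using snoc.prems(4)[of l] snoc.prems(5)
    by (subst egl_relation) (auto simp: gl_sign_def minus_one_power_iff)
  have "uword (map (\<lambda>k. (a k, b k)) (L @ [l]) @ map (\<lambda>k. (b k, c k)) (L @ [l]) @ X) =
     ?AB * (egl (a l, b l) * ?BC) * egl (b l, c l) * uword X"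
    by (simp add: mult.assoc)
  also have "\<dots> = ?AB * ?BC * (egl (a l, b l) * egl (b l, c l)) * uword X"
    unfolding comm by (simp add: mult.assoc)
  also have "\<dots> = ?AB * ?BC * egl (a l, c l) * uword X + ?AB * ?BC * egl (b l, c l) * egl (a l, b l) * uword X"
    unfolding rel by (simp add: distrib_left distrib_right mult.assoc)
  also have "\<dots> \<approx> ?AB * ?BC * egl (a l, c l) * uword X"
    using snoc.prems by (intro irr_eq_add_Irr annihilator_Irr) auto
  also have "\<dots> = uword (map (\<lambda>k. (a k, b k)) L @ map (\<lambda>k. (b k, c k)) L @ (a l, c l) # X)"
    by (simp add: mult.assoc)
  also have "\<dots> \<approx> uword (map (\<lambda>k. (a k, c k)) L @ (a l, c l) # X)"
    using snoc.prems by (intro snoc.IH) (auto simp: inj_on_def)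
  finally show ?case by simp
qed


subsection \<open>Products of anticommuting elements\<close>

lemma anticommute_prod_list:
  fixes x :: "'a :: ring_1"
  assumes "\<And>y. y \<in> set ys \<Longrightarrow> x * y = - (y * x)"
  shows "x * prod_list ys = (- 1) ^ length ys * (prod_list ys * x)"
  using assms
proof (induction ys)
  case (Cons y ys)
  have "x * prod_list (y # ys) = - (y * (x * prod_list ys))"
    using Cons.prems[of y] by (simp flip: mult.assoc)
  also have "x * prod_list ys = (- 1) ^ length ys * (prod_list ys * x)"
    by (rule Cons.IH, rule Cons.prems, simp)
  finally show ?case
    by (cases "even (length ys)") (simp_all add: mult.assoc)
qed simp

text \<open>Both elements cross the block in between and pick up the same sign, so only the sign of
  their mutual exchange remains.\<close>

lemma anticommute_swap:
  fixes x y :: "'a :: ring_1"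
  assumes "\<And>z. z \<in> set zs \<Longrightarrow> x * z = - (z * x)" "\<And>z. z \<in> set zs \<Longrightarrow> y * z = - (z * y)"
    and "x * y = - (y * x)"
  shows "x * prod_list zs * y = - (y * prod_list zs * x)"
proof -
  have "x * prod_list zs * y = (- 1) ^ length zs * (prod_list zs * (x * y))"
    using anticommute_prod_list[OF assms(1)] by (simp add: mult.assoc)
  also have "\<dots> = - ((- 1) ^ length zs * (prod_list zs * y) * x)"
    by (simp add: assms(3) mult.assoc)
  also have "(- 1) ^ length zs * (prod_list zs * y) = y * prod_list zs"
    by (rule anticommute_prod_list[OF assms(2), symmetric])
  finally show ?thesis by simp
qed

lemma prod_list_transpose:
  fixes f :: "nat \<Rightarrow> 'a :: ring_1"
  assumes anti: "\<And>i j. i < h \<Longrightarrow> j < h \<Longrightarrow> i \<noteq> j \<Longrightarrow> f i * f j = - (f j * f i)"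
    and ab: "a < h" "b < h" "a \<noteq> b"
  shows "prod_list (map (\<lambda>k. f (transpose a b k)) [0..<h]) = - prod_list (map f [0..<h])"
proof -
  have *: "prod_list (map (\<lambda>k. f (transpose a b k)) [0..<h]) = - prod_list (map f [0..<h])"
    if "a < b" "b < h" for a b
  proof -
    have split: "[0..<h] = [0..<a] @ a # [Suc a..<b] @ b # [Suc b..<h]"
      using that upt_add_eq_append[of 0 a "h - a"] upt_conv_Cons[of a h]
        upt_add_eq_append[of "Suc a" b "h - b"] upt_conv_Cons[of b h] by simp
    have outer: "map (\<lambda>k. f (transpose a b k)) [0..<a] = map f [0..<a]"
      "map (\<lambda>k. f (transpose a b k)) [Suc a..<b] = map f [Suc a..<b]"
      "map (\<lambda>k. f (transpose a b k)) [Suc b..<h] = map f [Suc b..<h]"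
      using that by (auto simp: transpose_def)
    have "f b * prod_list (map f [Suc a..<b]) * f a = - (f a * prod_list (map f [Suc a..<b]) * f b)"
      using that by (intro anticommute_swap) (auto intro!: anti)
    then have "prod_list (map f [0..<a]) * (f b * prod_list (map f [Suc a..<b]) * f a) * prod_list (map f [Suc b..<h]) =
      - (prod_list (map f [0..<a]) * (f a * prod_list (map f [Suc a..<b]) * f b) * prod_list (map f [Suc b..<h]))"
      by (simp only: mult_minus_left mult_minus_right)
    then show ?thesis
      unfolding split map_append list.map outer by (simp add: mult.assoc)
  qed
  show ?thesis
    using *[of a b] *[of b a] ab by (metis linorder_neqE_nat transpose_commute)
qed

lemma prod_list_permute:
  fixes f :: "nat \<Rightarrow> 'a :: ring_1"
  assumes anti: "\<And>i j. i < h \<Longrightarrow> j < h \<Longrightarrow> i \<noteq> j \<Longrightarrow> f i * f j = - (f j * f i)"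
    and p: "p permutes {..<h}"
  shows "prod_list (map (\<lambda>k. f (p k)) [0..<h]) = of_int (sign p) * prod_list (map f [0..<h])"
  using finite_lessThan p
proof (induction rule: permutes_rev_induct)
  case id
  then show ?case by simp
next
  case (swap a b p)
  have "prod_list (map (\<lambda>k. f (p (transpose a b k))) [0..<h]) = - prod_list (map (\<lambda>k. f (p k)) [0..<h])"
    using swap permutes_in_image[OF swap.hyps(4)] permutes_inj[OF swap.hyps(4)]
    by (intro prod_list_transpose[where f = "\<lambda>k. f (p k)"] anti) (auto simp: inj_eq)
  moreover have "sign (p \<circ> transpose a b) = - sign p"
    using permutes_imp_permutation[OF finite_lessThan swap.hyps(4)] swap.hyps(3)
    by (simp add: sign_compose permutation_swap_id sign_swap_id)
  ultimately show ?case
    by (simp only: o_def swap.IH of_int_minus mult_minus_left)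
qed

lemma uscale_of_int: "of_int k * x = uscale (of_int k) (x :: ('p, 'q, 'l) Ugl)"
proof -
  have n: "of_nat n = uscale (of_nat n) (1 :: ('p, 'q, 'l) Ugl)" for n
    by (induction n) (simp_all add: ugl.scale_left_distrib)
  have "of_int k = uscale (of_int k) (1 :: ('p, 'q, 'l) Ugl)"
    by (cases k rule: int_diff_cases) (simp add: n ugl.scale_left_diff_distrib)
  then show ?thesis by (metis mult_1 uscale_mult_left)
qed

text \<open>All factors are odd and no bracket between two of them survives, so reordering gives the
  sign exactly and not merely modulo irregular products.\<close>

lemma uword_permute:
  assumes p: "p permutes {..<h}"
    and "\<And>i j. i < h \<Longrightarrow> j < h \<Longrightarrow> odd (parity (a i) + parity (b i)) \<and> b i \<noteq> a j"
  shows "uword (map (\<lambda>k. (a (p k), b (p k))) [0..<h]) = uscale (of_int (sign p)) (uword (map (\<lambda>k. (a k, b k)) [0..<h]))"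
proof -
  have "prod_list (map (\<lambda>k. egl (a (p k), b (p k))) [0..<h]) =
      of_int (sign p) * prod_list (map (\<lambda>k. egl (a k, b k)) [0..<h])"
    by (rule prod_list_permute[OF _ p]) (intro egl_anticommute; use assms(2) in metis)
  then show ?thesis
    by (simp add: uscale_of_int o_def)
qed


subsection \<open>Young--Capelli bitableaux as combinations of column Capelli bitableaux\<close>

text \<open>
  The odd symbols \<open>d\<close> are contracted first. Fresh even symbols \<open>m\<close>, one for each cell, then let the
  repeated symbols \<open>c\<close> be contracted without producing commutators between proper symbols.
\<close>

lemma Young_Capelli_contract:
  fixes s t :: "nat \<Rightarrow> 'l" and c m :: "nat \<Rightarrow> 'p" and d :: "nat \<Rightarrow> 'q" and h :: nat
  assumes m: "inj_on m {..<h}" and cm: "c ` {..<h} \<inter> m ` {..<h} = {}"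
  defines "L \<equiv> [0..<h]"
  shows "(uword (map (\<lambda>k. (Proper (s k), Alpha (c k))) L @ map (\<lambda>k. (Alpha (c k), Beta (d k))) L
       @ map (\<lambda>k. (Beta (d k), Proper (t k))) L) :: ('p, 'q, 'l) Ugl) \<approx>
    (\<Sum>q | q permutes {..<h} \<and> (\<forall>k<h. d (q k) = d k). \<Sum>p | p permutes {..<h} \<and> (\<forall>k<h. c (p k) = c k).
       uscale (of_int (sign p)) (uword (map (\<lambda>k. (Proper (s (inv p (inv q k))), Alpha (m k))) L
         @ map (\<lambda>k. (Alpha (m k), Proper (t k))) L)))"
proof -
  let ?Q = "{q. q permutes {..<h} \<and> (\<forall>k<h. d (q k) = d k)}"
  let ?R = "{p. p permutes {..<h} \<and> (\<forall>k<h. c (p k) = c k)}"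
  let ?W = "\<lambda>us. uword us :: ('p, 'q, 'l) Ugl"
  have cm': "c i \<noteq> m j" "m j \<noteq> c i" if "i < h" "j < h" for i j
    using cm that by auto
  have cm_inv: "c (inv q i) \<noteq> m j" "m j \<noteq> c (inv q i)" if "q permutes {..<h}" "i < h" "j < h" for q i j
    using cm'[of "inv q i" j] that permutes_in_image[OF permutes_inv[OF that(1)], of i] by auto
  let ?SC = "map (\<lambda>k. (Proper (s k), Alpha (c k))) L"
  let ?AT = "map (\<lambda>k. (Alpha (m k), Proper (t k))) L"
  \<comment> \<open>The factors \<open>(Beta, Proper)\<close> are even, so \<open>contract\<close>
    applies; equality of the symbols \<open>d\<close> restricts the pairing \<open>q\<close> to
    column permutations.\<close>
  have "?W (map (\<lambda>k. (Alpha (c k), Beta (d k))) L @ map (\<lambda>k. (Beta (d k), Proper (t k))) L @ []) \<approx>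
    (\<Sum>q | q permutes {..<h} \<and> (\<forall>k<h. Beta (d (q k)) = (Beta (d k) :: ('p, 'q, 'l) letter)).
       ?W (map (\<lambda>k. (Alpha (c k), Proper (t (q k)))) L @ []))"
    unfolding L_def by (rule contract) auto
  then have 1: "?W (map (\<lambda>k. (Alpha (c k), Beta (d k))) L @ map (\<lambda>k. (Beta (d k), Proper (t k))) L) \<approx>
    (\<Sum>q\<in>?Q. ?W (map (\<lambda>k. (Alpha (c k), Proper (t (q k)))) L))"
    by simp
  \<comment> \<open>Sorting the odd factors so that \<open>t\<close> reads in its natural order
    costs \<open>sign q\<close>; the fresh symbols \<open>m\<close> are then inserted by
    \<open>contract_unique\<close> in reverse.\<close>
  have 2: "?W (map (\<lambda>k. (Alpha (c k), Proper (t (q k)))) L) \<approx>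
      uscale (of_int (sign q)) (?W (map (\<lambda>k. (Alpha (c (inv q k)), Alpha (m k))) L @ ?AT))"
    if q: "q \<in> ?Q" for q
  proof -
    have perm: "q permutes {..<h}" using q by simp
    have "?W (map (\<lambda>k. (Alpha (c k), Proper (t (q k)))) L) =
        ?W (map (\<lambda>k. (Alpha (c (inv q (q k))), Proper (t (q k)))) L)"
      by (simp add: permutes_inverses[OF perm])
    also have "\<dots> = uscale (of_int (sign q)) (?W (map (\<lambda>k. (Alpha (c (inv q k)), Proper (t k))) L))"
      unfolding L_def by (rule uword_permute[OF perm]) simp
    also have "?W (map (\<lambda>k. (Alpha (c (inv q k)), Alpha (m k))) L @ ?AT @ []) \<approx>
        ?W (map (\<lambda>k. (Alpha (c (inv q k)), Proper (t k))) L @ [])"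
      unfolding L_def using m
      by (intro contract_unique) (auto simp: inj_on_def cm_inv[OF perm])
    then have "uscale (of_int (sign q)) (?W (map (\<lambda>k. (Alpha (c (inv q k)), Proper (t k))) L)) \<approx>
        uscale (of_int (sign q)) (?W (map (\<lambda>k. (Alpha (c (inv q k)), Alpha (m k))) L @ ?AT))"
      by (simp only: append_Nil2 irr_eq_scale[OF irr_eq_sym])
    finally show ?thesis .
  qed
  \<comment> \<open>Now the creators of the symbols \<open>c\<close> pair two even letters, so
    \<open>contract\<close> applies to them as well, and its results pair \<open>s\<close> with
    \<open>m\<close> rather than with proper letters.\<close>
  have 3: "?W (?SC @ map (\<lambda>k. (Alpha (c (inv q k)), Alpha (m k))) L @ ?AT) \<approx>
      (\<Sum>p\<in>?R. uscale (of_int (sign q * sign p))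
         (?W (map (\<lambda>k. (Proper (s (inv p (inv q k))), Alpha (m k))) L @ ?AT)))"
    if q: "q \<in> ?Q" for q
  proof -
    have perm: "q permutes {..<h}" using q by simp
    let ?Z = "{z. z permutes {..<h} \<and> (\<forall>k<h. Alpha (c (inv q (z k))) = (Alpha (c k) :: ('p, 'q, 'l) letter))}"
    have "?W (?SC @ map (\<lambda>k. (Alpha (c (inv q k)), Alpha (m k))) L @ ?AT) \<approx>
       (\<Sum>z\<in>?Z. ?W (map (\<lambda>k. (Proper (s k), Alpha (m (z k)))) L @ ?AT))"
      unfolding L_def by (intro contract) (auto simp: cm' cm_inv[OF perm])
    \<comment> \<open>Writing the pairing as \<open>q \<circ> p\<close> turns the matching condition
      into invariance of \<open>c\<close> under \<open>p\<close>, which no longer depends on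
      \<open>q\<close>.\<close>
    also have "\<dots> = (\<Sum>p\<in>?R. ?W (map (\<lambda>k. (Proper (s k), Alpha (m (q (p k))))) L @ ?AT))"
      by (rule sum.reindex_bij_witness[of _ "\<lambda>p. q \<circ> p" "\<lambda>z. inv q \<circ> z"])
        (auto simp: permutes_inverses[OF perm] fun_eq_iff
          intro!: permutes_compose permutes_inv perm)
    also have "\<dots> = (\<Sum>p\<in>?R. uscale (of_int (sign q * sign p))
         (?W (map (\<lambda>k. (Proper (s (inv p (inv q k))), Alpha (m k))) L @ ?AT)))"
    proof (rule sum.cong[OF refl])
      fix p assume "p \<in> ?R"
      then have p: "p permutes {..<h}" by simp
      have qp: "q \<circ> p permutes {..<h}" by (rule permutes_compose[OF p perm])
      have "?W (map (\<lambda>k. (Proper (s k), Alpha (m (q (p k))))) L) =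
        ?W (map (\<lambda>k. (Proper (s (inv p (inv q ((q \<circ> p) k)))), Alpha (m ((q \<circ> p) k)))) L)"
        by (simp add: permutes_inverses[OF perm] permutes_inverses[OF p])
      also have "\<dots> = uscale (of_int (sign (q \<circ> p))) (?W (map (\<lambda>k. (Proper (s (inv p (inv q k))), Alpha (m k))) L))"
        unfolding L_def by (rule uword_permute[OF qp]) simp
      also have "sign (q \<circ> p) = sign q * sign p"
        using perm p by (intro sign_compose permutes_imp_permutation[OF finite_lessThan])
      finally show "?W (map (\<lambda>k. (Proper (s k), Alpha (m (q (p k))))) L @ ?AT) =
        uscale (of_int (sign q * sign p)) (?W (map (\<lambda>k. (Proper (s (inv p (inv q k))), Alpha (m k))) L @ ?AT))"
        by (simp only: map_append prod_list.append uscale_mult_left)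
    qed
    finally show ?thesis .
  qed
  \<comment> \<open>The two sortings contribute \<open>sign q\<close> twice, so only the sign of the
    row permutation is left.\<close>
  have sg: "of_int (sign q) * of_int (sign q * sign p) = (of_int (sign p) :: complex)"
    for p q :: "nat \<Rightarrow> nat"
    by (simp add: sign_def)
  have "?W (?SC @ map (\<lambda>k. (Alpha (c k), Beta (d k))) L @ map (\<lambda>k. (Beta (d k), Proper (t k))) L) =
      ?W ?SC * ?W (map (\<lambda>k. (Alpha (c k), Beta (d k))) L @ map (\<lambda>k. (Beta (d k), Proper (t k))) L)"
    by simp
  also have "\<dots> \<approx> ?W ?SC * (\<Sum>q\<in>?Q. ?W (map (\<lambda>k. (Alpha (c k), Proper (t (q k)))) L))"
    by (rule irr_eq_mult_left[OF 1])
  also have "\<dots> \<approx> ?W ?SC * (\<Sum>q\<in>?Q. uscale (of_int (sign q))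
      (?W (map (\<lambda>k. (Alpha (c (inv q k)), Alpha (m k))) L @ ?AT)))"
    by (intro irr_eq_mult_left irr_eq_sum 2)
  also have "\<dots> = (\<Sum>q\<in>?Q. uscale (of_int (sign q))
      (?W (?SC @ map (\<lambda>k. (Alpha (c (inv q k)), Alpha (m k))) L @ ?AT)))"
    by (simp add: sum_distrib_left uscale_mult_right)
  also have "\<dots> \<approx> (\<Sum>q\<in>?Q. uscale (of_int (sign q)) (\<Sum>p\<in>?R. uscale (of_int (sign q * sign p))
         (?W (map (\<lambda>k. (Proper (s (inv p (inv q k))), Alpha (m k))) L @ ?AT))))"
    by (intro irr_eq_sum irr_eq_scale 3)
  also have "\<dots> = (\<Sum>q\<in>?Q. \<Sum>p\<in>?R. uscale (of_int (sign p))
         (?W (map (\<lambda>k. (Proper (s (inv p (inv q k))), Alpha (m k))) L @ ?AT)))"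
    by (simp only: ugl.scale_sum_right ugl.scale_scale sg)
  finally show ?thesis .
qed


subsection \<open>Cells of a diagram\<close>

definition cells :: "nat list \<Rightarrow> (nat \<times> nat) list" where
  "cells mu = concat (map (\<lambda>r. map (\<lambda>c. (r, c)) [0..<mu ! r]) [0..<length mu])"

lemma cell_eq: "cell mu k = cells mu ! k"
  by (simp add: cell_def cells_def)

lemma length_cells: "length (cells mu) = sum_list mu"
proof -
  have "length (cells mu) = sum_list (map (\<lambda>r. mu ! r) [0..<length mu])"
    by (simp add: cells_def length_concat o_def)
  then show ?thesis by (simp only: map_nth)
qed

lemma set_cells: "set (cells mu) = {(r, c). r < length mu \<and> c < mu ! r}"
  by (auto simp: cells_def)

lemma distinct_cells: "distinct (cells mu)"
proof -
  have "distinct (concat (map (\<lambda>r. map (\<lambda>c. (r, c)) [0..<mu ! r]) L))" if "distinct L" for L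
    using that by (induction L) (auto simp: distinct_map inj_on_def)
  then show ?thesis by (simp add: cells_def)
qed

lemma map_cell: "map (\<lambda>k. f (cell mu k)) [0..<sum_list mu] = map f (cells mu)"
  by (rule nth_equalityI) (simp_all add: cell_eq length_cells)

lemma bij_betw_cell: "bij_betw (cell mu) {..<sum_list mu} {(r, c). r < length mu \<and> c < mu ! r}"
  using bij_betw_nth[OF distinct_cells refl refl, of mu]
  by (simp add: cell_eq[abs_def] length_cells set_cells)

lemma cell_bounds:
  assumes "k < sum_list mu"
  shows "fst (cell mu k) < length mu" "snd (cell mu k) < mu ! fst (cell mu k)"
  using bij_betwE[OF bij_betw_cell[of mu]] assms by (auto simp: case_prod_beta)

lemma upt_from_1: "[1..<n + 1] = map Suc [0..<n]"
  by (simp add: map_Suc_upt del: upt_Suc)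

lemma concat_Cstar:
  "concat (Cstar \<alpha> mu :: ('p, 'q, 'l) letter tableau) = map (\<lambda>k. Alpha (\<alpha> (Suc (fst (cell mu k))))) [0..<sum_list mu]"
proof -
  have "(Cstar \<alpha> mu :: ('p, 'q, 'l) letter tableau) = map (\<lambda>r. map (\<lambda>c. Alpha (\<alpha> (Suc r))) [0..<mu ! r]) [0..<length mu]"
    unfolding Cstar_def upt_from_1 by (simp add: map_replicate_const o_def)
  then have "concat (Cstar \<alpha> mu :: ('p, 'q, 'l) letter tableau) = map (\<lambda>x. Alpha (\<alpha> (Suc (fst x)))) (cells mu)"
    by (simp add: cells_def map_concat o_def)
  then show ?thesis by (simp only: map_cell[of "\<lambda>x. Alpha (\<alpha> (Suc (fst x)))"])
qed

lemma concat_Dstar: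
  "concat (Dstar \<beta> mu :: ('p, 'q, 'l) letter tableau) = map (\<lambda>k. Beta (\<beta> (Suc (snd (cell mu k))))) [0..<sum_list mu]"
proof -
  have "(map (\<lambda>c. Beta (\<beta> c)) [1..<n + 1] :: ('p, 'q, 'l) letter list) = map (\<lambda>c. Beta (\<beta> (Suc c))) [0..<n]" for n
    unfolding upt_from_1 by (simp add: o_def)
  then have "(Dstar \<beta> mu :: ('p, 'q, 'l) letter tableau) = map (\<lambda>n. map (\<lambda>c. Beta (\<beta> (Suc c))) [0..<n]) (map (\<lambda>r. mu ! r) [0..<length mu])"
    by (simp add: Dstar_def map_nth)
  then have "concat (Dstar \<beta> mu :: ('p, 'q, 'l) letter tableau) = map (\<lambda>x. Beta (\<beta> (Suc (snd x)))) (cells mu)"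
    by (simp add: cells_def map_concat o_def)
  then show ?thesis by (simp only: map_cell[of "\<lambda>x. Beta (\<beta> (Suc (snd x)))"])
qed

lemma length_partition: "is_partition lam h \<Longrightarrow> length lam \<le> h"
proof -
  have "length xs \<le> sum_list xs" if "0 \<notin> set xs" for xs :: "nat list"
    using that by (induction xs) auto
  then show "is_partition lam h \<Longrightarrow> length lam \<le> h"
    by (auto simp: is_partition_def)
qed

lemma partition_le_hd: "is_partition lam h \<Longrightarrow> r < length lam \<Longrightarrow> lam ! r \<le> hd lam"
  by (cases lam; cases r) (auto simp: is_partition_def)

lemma length_concat_shape: "length (concat T) = sum_list (shape T)"
  by (simp add: length_concat shape_def)


subsection \<open>Bitableaux as products indexed by cells\<close>

lemma concat_proper_tab:
  "length (concat T) = h \<Longrightarrow> concat (proper_tab T) = map (\<lambda>k. Proper (concat T ! k)) [0..<h]"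
  by (auto simp: proper_tab_def map_concat[symmetric] intro!: nth_equalityI)

lemma e_tab_cells:
  assumes "concat S = map f [0..<h]" "concat T = map g [0..<h]"
  shows "e_tab S T = uword (map (\<lambda>k. (f k, g k)) [0..<h])"
  by (simp add: e_tab_def assms zip_map_map zip_same_conv_map o_def)

lemma count_list_Proper: "virtual \<gamma> \<Longrightarrow> count_list (map (\<lambda>k. Proper (s k)) xs) \<gamma> = 0"
  by (induction xs) auto

abbreviation column_word ::
    "(nat \<Rightarrow> 'p) \<Rightarrow> nat \<Rightarrow> (nat \<Rightarrow> 'l) \<Rightarrow> (nat \<Rightarrow> 'l) \<Rightarrow> (('p, 'q, 'l) letter \<times> ('p, 'q, 'l) letter) list" where
  "column_word a h s t \<equiv> map (\<lambda>k. (Proper (s k), Alpha (a k))) [0..<h]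
     @ map (\<lambda>k. (Alpha (a k), Proper (t k))) [0..<h]"

lemma column_word_Virt: "uword (column_word a h s t) \<in> Virt"
  by (intro balanced_Virt) (auto simp: balanced_def o_def count_list_Proper)

text \<open>In a diagram with one column, cell \<open>k\<close> lies in row \<open>k\<close>; the
  auxiliary tableau thus carries one even symbol per cell, shifted by one because the symbols are
  numbered from 1.\<close>

lemma Capelli_column:
  assumes "length i = h" "length j = h"
  shows "(Capelli \<alpha> (column_tab i) (column_tab j) :: ('p, 'q, 'l) Ugl) =
    devirt (uword (column_word (\<lambda>k. \<alpha> (Suc k)) h ((!) i) ((!) j)))"
proof -
  have conc: "concat (column_tab w) = w" for w :: "'l list"
    by (simp add: column_tab_def)
  have shape: "shape (column_tab i) = replicate h (Suc 0)"
    by (rule nth_equalityI) (simp_all add: shape_def column_tab_def assms(1))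
  have single: "map (\<lambda>r. map (\<lambda>c. (r, c)) [0..<replicate h (Suc 0) ! r]) [0..<h] = map (\<lambda>r. [(r, 0)]) [0..<h]"
    by (rule map_cong) simp_all
  have "cells (replicate h (Suc 0)) = map (\<lambda>r. (r, 0)) [0..<h]"
    unfolding cells_def length_replicate single by simp
  then have "fst (cell (replicate h (Suc 0)) k) = k" if "k < h" for k
    using that by (simp add: cell_eq)
  then have C: "concat (Cstar \<alpha> (replicate h (Suc 0))) = map (\<lambda>k. Alpha (\<alpha> (Suc k))) [0..<h]"
    by (simp add: concat_Cstar sum_list_replicate)
  have i: "concat (proper_tab (column_tab i)) = map (\<lambda>k. Proper (i ! k)) [0..<h]"
    and j: "concat (proper_tab (column_tab j)) = map (\<lambda>k. Proper (j ! k)) [0..<h]"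
    using concat_proper_tab[of "column_tab i" h] concat_proper_tab[of "column_tab j" h] assms
    by (simp_all add: conc)
  show ?thesis
    by (simp add: Capelli_def Let_def shape e_tab_cells[OF i C] e_tab_cells[OF C j])
qed

lemma row_group_inv: "p \<in> row_group lam \<Longrightarrow> inv p \<in> row_group lam"
proof -
  assume p: "p \<in> row_group lam"
  then have perm: "p permutes {..<sum_list lam}" by (simp add: row_group_def)
  have "fst (cell lam (inv p k)) = fst (cell lam k)" if "k < sum_list lam" for k
  proof -
    have "inv p k < sum_list lam"
      using permutes_in_image[OF permutes_inv[OF perm], of k] that by simp
    with p show ?thesis
      using permutes_inverses(1)[OF perm, of k] by (auto simp: row_group_def)
  qed
  then show ?thesis
    by (simp add: row_group_def permutes_inv[OF perm])
qed

lemma col_group_inv: "p \<in> col_group lam \<Longrightarrow> inv p \<in> col_group lam"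
proof -
  assume p: "p \<in> col_group lam"
  then have perm: "p permutes {..<sum_list lam}" by (simp add: col_group_def)
  have "snd (cell lam (inv p k)) = snd (cell lam k)" if "k < sum_list lam" for k
  proof -
    have "inv p k < sum_list lam"
      using permutes_in_image[OF permutes_inv[OF perm], of k] that by simp
    with p show ?thesis
      using permutes_inverses(1)[OF perm, of k] by (auto simp: col_group_def)
  qed
  then show ?thesis
    by (simp add: col_group_def permutes_inv[OF perm])
qed

theorem YoungCapelli_expansion:
  fixes \<alpha> :: "nat \<Rightarrow> 'p::finite" and \<beta> :: "nat \<Rightarrow> 'q::finite" and U V :: "'l::finite tableau"
  assumes \<alpha>: "inj_on \<alpha> {1..h}" and \<beta>: "inj_on \<beta> {1..hd lam}"
    and lam: "is_partition lam h" and U: "shape U = lam" and V: "shape V = lam"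
  shows "(YoungCapelli \<alpha> \<beta> U V :: ('p, 'q, 'l) Ugl) =
    (\<Sum>p\<in>row_group lam. \<Sum>q\<in>col_group lam. uscale (of_int (sign p))
       (Capelli \<alpha> (column_tab (map (\<lambda>k. concat U ! p (q k)) [0..<h])) (column_tab (concat V))))"
proof -
  have h: "sum_list lam = h" using lam by (simp add: is_partition_def)
  define s where "s k = concat U ! k" for k
  define t where "t k = concat V ! k" for k
  define row where "row k = fst (cell lam k)" for k
  define col where "col k = snd (cell lam k)" for k
  have row: "Suc (row k) \<in> {1..h}" if "k < h" for k
    using cell_bounds(1)[of k lam] that h length_partition[OF lam] by (simp add: row_def)
  have col: "Suc (col k) \<in> {1..hd lam}" if "k < h" for k
    using cell_bounds[of k lam] that h partition_le_hd[OF lam, of "fst (cell lam k)"]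
    by (simp add: col_def)
  define z :: "('p, 'q, 'l) Ugl" where
    "z = uword (map (\<lambda>k. (Proper (s k), Alpha (\<alpha> (Suc (row k))))) [0..<h]
       @ map (\<lambda>k. (Alpha (\<alpha> (Suc (row k))), Beta (\<beta> (Suc (col k))))) [0..<h]
       @ map (\<lambda>k. (Beta (\<beta> (Suc (col k))), Proper (t k))) [0..<h])"
  define w :: "(nat \<Rightarrow> nat) \<times> (nat \<Rightarrow> nat) \<Rightarrow> ('p, 'q, 'l) Ugl" where
    "w x = uword (column_word (\<lambda>k. \<alpha> (Suc k)) h (\<lambda>k. s (inv (snd x) (inv (fst x) k))) t)" for x
  have len: "length (concat U) = h" "length (concat V) = h"
    by (simp_all add: length_concat_shape U V h)
  have cs: "concat (proper_tab U :: ('p, 'q, 'l) letter tableau) = map (\<lambda>k. Proper (s k)) [0..<h]"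
    "concat (proper_tab V :: ('p, 'q, 'l) letter tableau) = map (\<lambda>k. Proper (t k)) [0..<h]"
    "concat (Cstar \<alpha> lam :: ('p, 'q, 'l) letter tableau) = map (\<lambda>k. Alpha (\<alpha> (Suc (row k)))) [0..<h]"
    "concat (Dstar \<beta> lam :: ('p, 'q, 'l) letter tableau) = map (\<lambda>k. Beta (\<beta> (Suc (col k)))) [0..<h]"
    using concat_proper_tab[OF len(1)] concat_proper_tab[OF len(2)]
    by (simp_all add: concat_Cstar concat_Dstar h s_def t_def row_def col_def)
  have YC: "(YoungCapelli \<alpha> \<beta> U V :: ('p, 'q, 'l) Ugl) = devirt z"
    unfolding YoungCapelli_def Let_def U z_def e_tab_cells[OF cs(1,3)] e_tab_cells[OF cs(3,4)]
      e_tab_cells[OF cs(4,2)] map_append prod_list.append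
    by (simp only: mult.assoc)
  have "z \<in> Virt"
    unfolding z_def by (intro balanced_Virt) (auto simp: balanced_def o_def count_list_Proper)
  moreover have "w x \<in> Virt" for x
    unfolding w_def by (rule column_word_Virt)
  \<comment> \<open>The left copy holds the row symbols of the Young-Capelli bitableau, the right
    copy the cell symbols of the column bitableaux. Inside the original alphabet these two families
    would overlap.\<close>
  moreover have "iota Inl z \<approx> (\<Sum>x\<in>col_group lam \<times> row_group lam. uscale (of_int (sign (snd x))) (iota Inr (w x)))"
  proof -
    define c m :: "nat \<Rightarrow> 'p + 'p" where "c k = Inl (\<alpha> (Suc (row k)))" and "m k = Inr (\<alpha> (Suc k))" for k
    define d where "d k = \<beta> (Suc (col k))" for k
    \<comment> \<open>Injectivity of \<open>\<beta>\<close> on the columns in use makes equal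
      symbols mean equal columns; \<open>R\<close> does the same for \<open>\<alpha>\<close> and
      rows.\<close>
    have Q: "{q. q permutes {..<h} \<and> (\<forall>k<h. d (q k) = d k)} = col_group lam"
    proof -
      have "d (q k) = d k \<longleftrightarrow> col (q k) = col k" if "q permutes {..<h}" "k < h" for q k
        using inj_on_eq_iff[OF \<beta> col[of "q k"] col[of k]] permutes_in_image[OF that(1), of k] that(2)
        by (simp add: d_def)
      then show ?thesis by (auto simp: col_group_def h col_def)
    qed
    have R: "{p. p permutes {..<h} \<and> (\<forall>k<h. c (p k) = c k)} = row_group lam"
    proof -
      have "c (p k) = c k \<longleftrightarrow> row (p k) = row k" if "p permutes {..<h}" "k < h" for p k
        using inj_on_eq_iff[OF \<alpha> row[of "p k"] row[of k]] permutes_in_image[OF that(1), of k] that(2)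
        by (simp add: c_def)
      then show ?thesis by (auto simp: row_group_def h row_def)
    qed
    have "iota Inl z = uword (map (\<lambda>k. (Proper (s k), Alpha (c k))) [0..<h]
       @ map (\<lambda>k. (Alpha (c k), Beta (d k))) [0..<h] @ map (\<lambda>k. (Beta (d k), Proper (t k))) [0..<h])"
      unfolding z_def by (subst iota_word) (simp_all add: c_def d_def o_def)
    moreover have "iota Inr (w x) = uword (column_word m h (\<lambda>k. s (inv (snd x) (inv (fst x) k))) t)" for x
      unfolding w_def by (subst iota_word) (simp_all add: m_def o_def)
    moreover have "inj_on m {..<h}"
      by (rule inj_onI) (use inj_on_eq_iff[OF \<alpha>] in \<open>simp add: m_def\<close>)
    moreover have "c ` {..<h} \<inter> m ` {..<h} = {}"
      by (auto simp: c_def m_def)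
    ultimately show ?thesis
      using Young_Capelli_contract[of m h c s d t] unfolding Q R
      by (simp add: sum.cartesian_product case_prod_beta)
  qed
  ultimately have "devirt z = (\<Sum>x\<in>col_group lam \<times> row_group lam. uscale (of_int (sign (snd x))) (devirt (w x)))"
    by (intro devirt_eqI[of Inl Inr]) simp_all
  also have "\<dots> = (\<Sum>p\<in>row_group lam. \<Sum>q\<in>col_group lam. uscale (of_int (sign p)) (devirt (w (q, p))))"
    by (subst sum.swap) (simp add: sum.cartesian_product case_prod_beta)
  \<comment> \<open>Both groups are reindexed by inversion to replace the inverses inside
    \<open>w\<close> by the permutations themselves; the sign is unaffected.\<close>
  also have "\<dots> = (\<Sum>p\<in>row_group lam. \<Sum>q\<in>col_group lam. uscale (of_int (sign (inv p))) (devirt (w (inv q, inv p))))"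
  proof -
    have r: "bij_betw inv (row_group lam) (row_group lam)"
      by (rule bij_betw_byWitness[where f' = inv])
        (auto simp: row_group_inv, auto simp: row_group_def permutes_inv_inv)
    have c: "bij_betw inv (col_group lam) (col_group lam)"
      by (rule bij_betw_byWitness[where f' = inv])
        (auto simp: col_group_inv, auto simp: col_group_def permutes_inv_inv)
    define F :: "(nat \<Rightarrow> nat) \<Rightarrow> (nat \<Rightarrow> nat) \<Rightarrow> ('p, 'q, 'l) Ugl" where
      "F = (\<lambda>p q. uscale (of_int (sign p)) (devirt (w (q, p))))"
    have "(\<Sum>p\<in>row_group lam. sum (F p) (col_group lam)) =
        (\<Sum>p\<in>row_group lam. sum (F (inv p)) (col_group lam))"
      by (rule sum.reindex_bij_betw[OF r, symmetric])
    also have "\<dots> = (\<Sum>p\<in>row_group lam. \<Sum>q\<in>col_group lam. F (inv p) (inv q))"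
      by (intro sum.cong refl sum.reindex_bij_betw[OF c, symmetric])
    finally show ?thesis
      by (simp only: F_def)
  qed
  also have "\<dots> = (\<Sum>p\<in>row_group lam. \<Sum>q\<in>col_group lam. uscale (of_int (sign p))
       (Capelli \<alpha> (column_tab (map (\<lambda>k. concat U ! p (q k)) [0..<h])) (column_tab (concat V))))"
  proof (intro sum.cong refl)
    fix p q assume "p \<in> row_group lam" "q \<in> col_group lam"
    then have pq: "p permutes {..<h}" "q permutes {..<h}"
      by (simp_all add: row_group_def col_group_def h)
    let ?u = "map (\<lambda>k. concat U ! p (q k)) [0..<h]"
    have word: "(map (\<lambda>k. (Proper (?u ! k), Alpha (\<alpha> (Suc k)))) [0..<h] :: (('p, 'q, 'l) letter \<times> _) list)
        = map (\<lambda>k. (Proper (s (p (q k))), Alpha (\<alpha> (Suc k)))) [0..<h]"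
      by (rule map_cong) (simp_all add: s_def)
    have "w (inv q, inv p) = uword (column_word (\<lambda>k. \<alpha> (Suc k)) h ((!) ?u) ((!) (concat V)))"
      unfolding word by (simp add: w_def permutes_inv_inv[OF pq(1)] permutes_inv_inv[OF pq(2)] t_def)
    then have "devirt (w (inv q, inv p)) = Capelli \<alpha> (column_tab ?u) (column_tab (concat V))"
      by (subst Capelli_column[of _ h]) (simp_all only: length_map length_upt len diff_zero)
    moreover have "sign (inv p) = sign p"
      by (rule sign_inverse[OF permutes_imp_permutation[OF finite_lessThan pq(1)]])
    ultimately show "uscale (of_int (sign (inv p))) (devirt (w (inv q, inv p))) = uscale (of_int (sign p))
       (Capelli \<alpha> (column_tab ?u) (column_tab (concat V)))"
      by (simp only:)
  qed
  finally show ?thesis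
    by (simp only: YC)
qed


subsection \<open>The group algebra of the symmetric group as a Hermitian space\<close>

abbreviation Sym :: "nat \<Rightarrow> (nat \<Rightarrow> nat) set" where
  "Sym h \<equiv> {p. p permutes {..<h}}"

text \<open>On arbitrary functions this form is only semidefinite, as values outside
  \<open>Sym h\<close> are ignored; it is definite on functions supported on
  \<open>Sym h\<close>.\<close>

definition ip :: "nat \<Rightarrow> ((nat \<Rightarrow> nat) \<Rightarrow> complex) \<Rightarrow> ((nat \<Rightarrow> nat) \<Rightarrow> complex) \<Rightarrow> complex" where
  "ip h f g = (\<Sum>\<pi>\<in>Sym h. f \<pi> * cnj (g \<pi>))"

lemma finite_Sym: "finite (Sym h)"
  by (simp add: finite_permutations)

lemma sum_fun_apply: "(\<Sum>i\<in>A. f i) x = (\<Sum>i\<in>A. f i x)"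
  by (induction A rule: infinite_finite_induct) simp_all

lemma ip_diff_left: "ip h (f - f') g = ip h f g - ip h f' g"
  by (simp add: ip_def left_diff_distrib sum_subtractf)

lemma ip_scale_left: "ip h (\<lambda>\<pi>. c * f \<pi>) g = c * ip h f g"
  by (simp add: ip_def sum_distrib_left mult.assoc)

lemma ip_sum_left: "ip h (\<Sum>i\<in>A. f i) g = (\<Sum>i\<in>A. ip h (f i) g)"
  unfolding ip_def by (simp add: sum_fun_apply sum_distrib_right sum.swap[of _ A])

lemma ip_cnj: "cnj (ip h f g) = ip h g f"
  by (simp add: ip_def mult.commute)

lemma ip_self_zero: "ip h f f = 0 \<longleftrightarrow> (\<forall>\<pi>\<in>Sym h. f \<pi> = 0)"
proof -
  have "ip h f f = of_real (\<Sum>\<pi>\<in>Sym h. (cmod (f \<pi>))\<^sup>2)"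
    by (simp add: ip_def complex_norm_square[symmetric])
  then show ?thesis
    unfolding of_real_eq_0_iff by (simp only: of_real_eq_0_iff sum_nonneg_eq_0_iff finite_Sym
      zero_le_power2 power_eq_0_iff norm_eq_zero zero_less_numeral simp_thms)
qed

lemma ip_zero_right: "\<forall>\<pi>\<in>Sym h. g \<pi> = 0 \<Longrightarrow> ip h f g = 0"
  by (simp add: ip_def)

lemma orthogonal_span:
  assumes "\<And>v. v \<in> B \<Longrightarrow> ip h f v = 0" "v \<in> gralg.span B"
  shows "ip h f v = 0"
  using assms(2)
proof (induction rule: gralg.span_induct_alt)
  case base
  then show ?case by (simp add: ip_def)
next
  case (step c x y)
  then show ?case
    using assms(1)[of x]
    by (simp add: ip_def distrib_left sum.distrib mult.left_commute[of _ "cnj c"] flip: sum_distrib_left)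
qed

text \<open>Gram-Schmidt: the new generator is first made orthogonal to the old span, then the
  projection is corrected along it.\<close>

lemma orthogonal_projection:
  "finite B \<Longrightarrow> \<exists>w\<in>gralg.span B. \<forall>v\<in>gralg.span B. ip h (f - w) v = 0"
proof (induction B arbitrary: f rule: finite_induct)
  case empty
  then show ?case by (auto simp: ip_def)
next
  case (insert b B)
  obtain wb where wb: "wb \<in> gralg.span B" "\<forall>v\<in>gralg.span B. ip h (b - wb) v = 0"
    using insert.IH by blast
  obtain wf where wf: "wf \<in> gralg.span B" "\<forall>v\<in>gralg.span B. ip h (f - wf) v = 0"
    using insert.IH by blast
  define b' where "b' = b - wb"
  \<comment> \<open>If the denominator is 0, division gives \<open>k = 0\<close>; then
    \<open>b'\<close> vanishes on \<open>Sym h\<close> and everything is orthogonal to it.\<close>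
  define k where "k = ip h (f - wf) b' / ip h b' b'"
  define w where "w = wf + (\<lambda>\<pi>. k * b' \<pi>)"
  have sub: "gralg.span B \<subseteq> gralg.span (insert b B)"
    by (rule gralg.span_mono) auto
  have "b' \<in> gralg.span (insert b B)"
    unfolding b'_def using wb(1) by (intro gralg.span_diff gralg.span_base[of b] subsetD[OF sub]) auto
  then have w: "w \<in> gralg.span (insert b B)"
    unfolding w_def using subsetD[OF sub wf(1)] by (intro gralg.span_add gralg.span_scale)
  have split: "ip h (f - w) v = ip h (f - wf) v - k * ip h b' v" for v
    by (simp add: w_def ip_def distrib_right left_diff_distrib sum.distrib sum_subtractf
        sum_distrib_left algebra_simps)
  have orth: "ip h (f - w) v = 0" if "v \<in> gralg.span B" for v
    using that wf(2) wb(2) by (simp add: split b'_def)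
  have "ip h (f - w) b' = 0"
  proof (cases "ip h b' b' = 0")
    case True
    then show ?thesis
      unfolding ip_self_zero by (rule ip_zero_right)
  next
    case False
    then show ?thesis by (simp add: split k_def)
  qed
  moreover have "ip h (f - w) b = ip h (f - w) b' + ip h (f - w) wb"
    by (simp add: b'_def ip_def right_diff_distrib sum_subtractf)
  ultimately have "ip h (f - w) b = 0"
    using orth[OF wb(1)] by simp
  then have "ip h (f - w) v = 0" if "v \<in> insert b B" for v
    using that orth[OF gralg.span_base[of v B]] by auto
  then have "\<forall>v\<in>gralg.span (insert b B). ip h (f - w) v = 0"
    by (blast intro: orthogonal_span)
  with w show ?case by blast
qed

text \<open>The coefficients are indexed by \<open>A\<close> instead of its image, so that
  coinciding values of \<open>f\<close> cause no trouble.\<close>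

lemma span_image_explicit:
  assumes "finite A" "x \<in> gralg.span (f ` A)"
  shows "\<exists>c. x = (\<lambda>\<pi>. \<Sum>a\<in>A. c a * f a \<pi>)"
  using assms(2)
proof (induction rule: gralg.span_induct_alt)
  case base
  then show ?case by (intro exI[of _ "\<lambda>_. 0"]) (simp add: fun_eq_iff)
next
  case (step k z y)
  then obtain a c where a: "a \<in> A" "z = f a" and y: "y = (\<lambda>\<pi>. \<Sum>a\<in>A. c a * f a \<pi>)"
    by blast
  have "k * f a \<pi> + y \<pi> = (\<Sum>a'\<in>A. (c a' + (if a' = a then k else 0)) * f a' \<pi>)" for \<pi>
    using assms(1) a(1) by (simp add: y distrib_right sum.distrib if_distrib[of "\<lambda>t. t * _"] cong: if_cong)
  then show ?case
    by (intro exI[of _ "\<lambda>a'. c a' + (if a' = a then k else 0)"]) (simp add: fun_eq_iff a(2))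
qed

section \<open>Left translations by permutations\<close>

lemma Sym_compose: "\<sigma> \<in> Sym h \<Longrightarrow> \<tau> \<in> Sym h \<Longrightarrow> \<sigma> \<circ> \<tau> \<in> Sym h"
  by (simp add: permutes_compose)

lemma Sym_inv: "\<sigma> \<in> Sym h \<Longrightarrow> inv \<sigma> \<in> Sym h"
  by (simp add: permutes_inv)

lemma Sym_cancel:
  assumes "\<sigma> \<in> Sym h"
  shows "inv \<sigma> \<circ> (\<sigma> \<circ> \<tau>) = \<tau>" "\<sigma> \<circ> (inv \<sigma> \<circ> \<tau>) = \<tau>" "(\<tau> \<circ> \<sigma>) \<circ> inv \<sigma> = \<tau>" "(\<tau> \<circ> inv \<sigma>) \<circ> \<sigma> = \<tau>"
  using assms by (simp_all add: fun_eq_iff permutes_inverses)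

lemma Sym_inv_compose: "\<sigma> \<in> Sym h \<Longrightarrow> \<tau> \<in> Sym h \<Longrightarrow> inv (\<sigma> \<circ> \<tau>) = inv \<tau> \<circ> inv \<sigma>"
  by (simp add: o_inv_distrib permutes_bij)

lemma Sym_inv_inv: "\<sigma> \<in> Sym h \<Longrightarrow> inv (inv \<sigma>) = \<sigma>"
  by (simp add: permutes_inv_inv)

lemma sum_Sym_left: "\<sigma> \<in> Sym h \<Longrightarrow> (\<Sum>\<pi>\<in>Sym h. F (\<sigma> \<circ> \<pi>)) = (\<Sum>\<pi>\<in>Sym h. F \<pi>)"
  by (rule sum.reindex_bij_witness[of _ "\<lambda>\<pi>. inv \<sigma> \<circ> \<pi>" "\<lambda>\<pi>. \<sigma> \<circ> \<pi>"])
    (simp_all only: Sym_cancel Sym_compose Sym_inv)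

lemma left_mult_compose:
  "\<sigma> \<in> Sym h \<Longrightarrow> \<tau> \<in> Sym h \<Longrightarrow> left_mult \<sigma> (left_mult \<tau> f) = left_mult (\<sigma> \<circ> \<tau>) f"
  by (simp add: left_mult_def Sym_inv_compose[of _ h] comp_assoc del: mem_Collect_eq)

lemma left_mult_add: "left_mult \<sigma> (f + g) = left_mult \<sigma> f + left_mult \<sigma> g"
  by (simp add: left_mult_def fun_eq_iff)

lemma left_mult_scale: "left_mult \<sigma> (\<lambda>\<pi>. c * f \<pi>) = (\<lambda>\<pi>. c * left_mult \<sigma> f \<pi>)"
  by (simp add: left_mult_def)

lemma ip_left_mult:
  assumes "\<sigma> \<in> Sym h"
  shows "ip h (left_mult \<sigma> f) g = ip h f (left_mult (inv \<sigma>) g)"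
proof -
  have "ip h f (left_mult (inv \<sigma>) g) = (\<Sum>\<pi>\<in>Sym h. left_mult \<sigma> f (\<sigma> \<circ> \<pi>) * cnj (g (\<sigma> \<circ> \<pi>)))"
    using assms by (simp only: ip_def left_mult_def Sym_inv_inv Sym_cancel)
  also have "\<dots> = ip h (left_mult \<sigma> f) g"
    unfolding ip_def by (rule sum_Sym_left[OF assms])
  finally show ?thesis ..
qed


subsection \<open>Left ideals and their characters\<close>

text \<open>
  The orthogonal projection of the unit onto a left ideal \<open>W\<close> is a self-adjoint idempotent \<open>e\<close>, and
  right multiplication by \<open>e\<close> is the orthogonal projection onto \<open>W\<close>.
\<close>

locale left_ideal =
  fixes h :: nat and W :: "((nat \<Rightarrow> nat) \<Rightarrow> complex) set" and S :: "((nat \<Rightarrow> nat) \<Rightarrow> complex) set"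
    and e :: "(nat \<Rightarrow> nat) \<Rightarrow> complex"
  assumes W: "W = gralg.span S" and finite_S: "finite S"
    and support: "f \<in> W \<Longrightarrow> \<pi> \<notin> Sym h \<Longrightarrow> f \<pi> = 0"
    and invariant: "f \<in> W \<Longrightarrow> \<sigma> \<in> Sym h \<Longrightarrow> left_mult \<sigma> f \<in> W"
    and e: "e \<in> W" and e_orth: "v \<in> W \<Longrightarrow> ip h ((\<lambda>\<pi>. if \<pi> = id then 1 else 0) - e) v = 0"
begin

text \<open>A reproducing property: on \<open>W\<close> the element \<open>e\<close> may be replaced
  by the unit, whose translates evaluate a function at a point.\<close>

lemma ip_e:
  assumes v: "v \<in> W" and \<rho>: "\<rho> \<in> Sym h"
  shows "ip h (left_mult \<rho> e) v = cnj (v \<rho>)"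
proof -
  let ?\<delta> = "\<lambda>\<pi> :: nat \<Rightarrow> nat. if \<pi> = id then 1 else (0 :: complex)"
  have "ip h e (left_mult (inv \<rho>) v) = ip h ?\<delta> (left_mult (inv \<rho>) v)"
    using e_orth[OF invariant[OF v Sym_inv[OF \<rho>]]] by (simp add: ip_diff_left)
  also have "\<dots> = (\<Sum>\<pi>\<in>Sym h. if \<pi> = id then cnj (left_mult (inv \<rho>) v id) else 0)"
    unfolding ip_def by (intro sum.cong) auto
  also have "\<dots> = cnj (left_mult (inv \<rho>) v id)"
    using finite_Sym by (subst sum.delta) (auto simp: permutes_id)
  also have "left_mult (inv \<rho>) v id = v \<rho>"
    using Sym_inv_inv[OF \<rho>] by (simp add: left_mult_def)
  finally show ?thesis
    using ip_left_mult[OF \<rho>] by simp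
qed

text \<open>Self-adjointness. The reproducing property, applied to a translate of \<open>e\<close>
  and to \<open>e\<close> itself, computes the same inner product in two ways.\<close>

lemma e_inv:
  assumes "\<rho> \<in> Sym h"
  shows "e (inv \<rho>) = cnj (e \<rho>)"
proof -
  have "left_mult id e = e" "left_mult \<rho> e id = e (inv \<rho>)"
    by (simp_all add: left_mult_def inv_id)
  then have "cnj (e (inv \<rho>)) = ip h e (left_mult \<rho> e)"
    using ip_e[OF invariant[OF e assms], of id] by (simp add: permutes_id)
  then have "e (inv \<rho>) = ip h (left_mult \<rho> e) e"
    by (metis complex_cnj_cnj ip_cnj)
  then show ?thesis
    by (simp add: ip_e[OF e assms])
qed

text \<open>Right convolution by \<open>e\<close> is the identity on \<open>W\<close>: the
  convolution lies in \<open>W\<close> and, by \<open>ip_e\<close>, has the same inner products with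
  \<open>W\<close> as \<open>x\<close>. Their difference has norm zero, and \<open>support\<close>
  takes care of the points outside \<open>Sym h\<close>.\<close>

lemma mult_e:
  assumes "x \<in> W"
  shows "x = (\<Sum>\<rho>\<in>Sym h. (\<lambda>\<pi>. x \<rho> * left_mult \<rho> e \<pi>))"
proof -
  define y where "y = (\<Sum>\<rho>\<in>Sym h. (\<lambda>\<pi>. x \<rho> * left_mult \<rho> e \<pi>))"
  have "y \<in> W"
    unfolding y_def using invariant[OF e] unfolding W by (intro gralg.span_sum gralg.span_scale) auto
  with assms have d: "x - y \<in> W"
    unfolding W by (intro gralg.span_diff)
  have "ip h y v = ip h x v" if "v \<in> W" for v
  proof -
    have "ip h y v = (\<Sum>\<rho>\<in>Sym h. x \<rho> * ip h (left_mult \<rho> e) v)"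
      by (simp only: y_def ip_sum_left ip_scale_left)
    also have "\<dots> = ip h x v"
      unfolding ip_def[of h x] using that by (intro sum.cong refl) (simp only: ip_e)
    finally show ?thesis .
  qed
  from this[OF d] have "ip h (x - y) (x - y) = 0"
    by (simp add: ip_diff_left)
  then have "\<forall>\<pi>\<in>Sym h. (x - y) \<pi> = 0"
    by (simp add: ip_self_zero)
  with support[OF d] have "x - y = 0"
    by (metis ext zero_fun_def)
  then show ?thesis by (simp add: y_def)
qed

lemma mult_e_apply:
  assumes "x \<in> W"
  shows "x \<pi> = (\<Sum>\<rho>\<in>Sym h. x \<rho> * e (inv \<rho> \<circ> \<pi>))"
  using arg_cong[OF mult_e[OF assms], of "\<lambda>f. f \<pi>"] by (simp add: sum_fun_apply left_mult_def)

text \<open>Idempotence together with self-adjointness displays the kernel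
  \<open>e (inv a \<circ> b)\<close> as a Gram matrix. This is the source of positivity
  below.\<close>

lemma e_positive:
  assumes "a \<in> Sym h" "b \<in> Sym h"
  shows "e (inv a \<circ> b) = (\<Sum>\<kappa>\<in>Sym h. cnj (e (inv \<kappa> \<circ> a)) * e (inv \<kappa> \<circ> b))"
proof -
  have "e (inv a \<circ> b) = (\<Sum>\<kappa>\<in>Sym h. e (inv a \<circ> \<kappa>) * e (inv (inv a \<circ> \<kappa>) \<circ> (inv a \<circ> b)))"
    unfolding sum_Sym_left[OF Sym_inv[OF assms(1)], of "\<lambda>\<kappa>. e \<kappa> * e (inv \<kappa> \<circ> (inv a \<circ> b))"]
    by (rule mult_e_apply[OF e])
  also have "\<dots> = (\<Sum>\<kappa>\<in>Sym h. cnj (e (inv \<kappa> \<circ> a)) * e (inv \<kappa> \<circ> b))"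
  proof (rule sum.cong[OF refl])
    fix \<kappa> assume \<kappa>: "\<kappa> \<in> Sym h"
    have inv: "inv (inv a \<circ> \<kappa>) = inv \<kappa> \<circ> a"
      using Sym_inv_compose[OF Sym_inv[OF assms(1)] \<kappa>] Sym_inv_inv[OF assms(1)] by simp
    have "e (inv (inv \<kappa> \<circ> a)) = cnj (e (inv \<kappa> \<circ> a))"
      by (rule e_inv[OF Sym_compose[OF Sym_inv[OF \<kappa>] assms(1)]])
    moreover have "inv (inv \<kappa> \<circ> a) = inv a \<circ> \<kappa>"
      using Sym_inv_compose[OF Sym_inv[OF \<kappa>] assms(1)] Sym_inv_inv[OF \<kappa>] by simp
    moreover have "inv \<kappa> \<circ> a \<circ> (inv a \<circ> b) = inv \<kappa> \<circ> b"
      using Sym_cancel(2)[OF assms(1)] by (simp only: comp_assoc)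
    ultimately show "e (inv a \<circ> \<kappa>) * e (inv (inv a \<circ> \<kappa>) \<circ> (inv a \<circ> b)) =
        cnj (e (inv \<kappa> \<circ> a)) * e (inv \<kappa> \<circ> b)"
      by (simp only: inv)
  qed
  finally show ?thesis .
qed

definition char :: "(nat \<Rightarrow> nat) \<Rightarrow> complex" where
  "char \<sigma> = lin_trace W (left_mult \<sigma>)"

text \<open>Right multiplication by \<open>e\<close> projects the group algebra onto
  \<open>W\<close>, so the trace on \<open>W\<close> is that of left multiplication by
  \<open>\<sigma>\<close> followed by this projection on the whole group algebra. The term of
  \<open>g\<close> is its diagonal entry at the basis element \<open>g\<close>.\<close>

lemma char_eq:
  assumes \<sigma>: "\<sigma> \<in> Sym h"
  shows "char \<sigma> = (\<Sum>g\<in>Sym h. e (inv g \<circ> (inv \<sigma> \<circ> g)))"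
proof -
  define B where "B = (SOME B. gralg.independent B \<and> gralg.span B = W)"
  have "\<exists>B. gralg.independent B \<and> gralg.span B = W"
    by (metis W gralg.maximal_independent_subset gralg.span_mono gralg.span_span subset_antisym)
  then have B: "gralg.independent B" "gralg.span B = W"
    unfolding B_def by (metis (mono_tags, lifting) someI_ex)+
  have finB: "finite B"
    using gralg.independent_span_bound[OF finite_S B(1)] gralg.span_superset[of B] B(2) W by auto
  define r where "r = gralg.representation B"
  have expand: "v \<pi> = (\<Sum>b\<in>B. r v b * b \<pi>)" if "v \<in> W" for v \<pi>
  proof -
    have "(\<Sum>b\<in>B. (\<lambda>\<pi>. r v b * b \<pi>)) = v"
      unfolding r_def using gralg.sum_representation_eq[OF B(1) _ finB subset_refl, of v] that B(2) by simp
    from arg_cong[OF this, of "\<lambda>f. f \<pi>"] show ?thesis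
      by (simp add: sum_fun_apply)
  qed
  have lin: "r (left_mult \<sigma> b) b = (\<Sum>g\<in>Sym h. left_mult \<sigma> b g * r (left_mult g e) b)" if "b \<in> B" for b
  proof -
    have mem: "left_mult \<sigma> b \<in> W"
      using that B(2) gralg.span_base[of b B] invariant[OF _ \<sigma>] by auto
    have "r (left_mult \<sigma> b) = r (\<Sum>g\<in>Sym h. (\<lambda>\<pi>. left_mult \<sigma> b g * left_mult g e \<pi>))"
      using mult_e[OF mem] by simp
    also have "\<dots> = (\<lambda>b'. \<Sum>g\<in>Sym h. r (\<lambda>\<pi>. left_mult \<sigma> b g * left_mult g e \<pi>) b')"
      unfolding r_def using invariant[OF e] B(2)
      by (intro gralg.representation_sum[OF B(1)] gralg.span_scale) auto
    also have "\<dots> = (\<lambda>b'. \<Sum>g\<in>Sym h. left_mult \<sigma> b g * r (left_mult g e) b')"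
      unfolding r_def using invariant[OF e] B(2)
      by (intro ext sum.cong refl) (subst gralg.representation_scale[OF B(1)], auto)
    finally show ?thesis by simp
  qed
  have "char \<sigma> = (\<Sum>b\<in>B. r (left_mult \<sigma> b) b)"
    by (simp only: char_def lin_trace_def r_def B_def Let_def)
  also have "\<dots> = (\<Sum>b\<in>B. \<Sum>g\<in>Sym h. left_mult \<sigma> b g * r (left_mult g e) b)"
    by (intro sum.cong refl lin)
  also have "\<dots> = (\<Sum>g\<in>Sym h. \<Sum>b\<in>B. r (left_mult g e) b * b (inv \<sigma> \<circ> g))"
    by (subst sum.swap) (simp add: left_mult_def mult.commute)
  \<comment> \<open>For fixed \<open>g\<close> the inner sum is the expansion of
    \<open>left_mult g e\<close> in the basis \<open>B\<close>, evaluated at one point; the choice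
    of \<open>B\<close> thereby disappears.\<close>
  also have "\<dots> = (\<Sum>g\<in>Sym h. left_mult g e (inv \<sigma> \<circ> g))"
    using expand invariant[OF e] by (intro sum.cong refl) simp
  finally show ?thesis
    by (simp add: left_mult_def)
qed

lemma char_conjugate:
  assumes "\<sigma> \<in> Sym h" "\<tau> \<in> Sym h"
  shows "char (\<tau> \<circ> (\<sigma> \<circ> inv \<tau>)) = char \<sigma>"
proof -
  have inv: "inv (\<tau> \<circ> (\<sigma> \<circ> inv \<tau>)) = \<tau> \<circ> (inv \<sigma> \<circ> inv \<tau>)"
    using Sym_inv_compose[OF assms(2) Sym_compose[OF assms(1) Sym_inv[OF assms(2)]]]
      Sym_inv_compose[OF assms(1) Sym_inv[OF assms(2)]] Sym_inv_inv[OF assms(2)]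
    by (simp add: comp_assoc)
  have "char (\<tau> \<circ> (\<sigma> \<circ> inv \<tau>)) = (\<Sum>g\<in>Sym h. e (inv g \<circ> ((\<tau> \<circ> (inv \<sigma> \<circ> inv \<tau>)) \<circ> g)))"
    using assms by (subst char_eq) (simp_all only: inv Sym_compose Sym_inv)
  also have "\<dots> = (\<Sum>g\<in>Sym h. e (inv (\<tau> \<circ> g) \<circ> ((\<tau> \<circ> (inv \<sigma> \<circ> inv \<tau>)) \<circ> (\<tau> \<circ> g))))"
    by (rule sum_Sym_left[OF assms(2), symmetric])
  also have "\<dots> = (\<Sum>g\<in>Sym h. e (inv g \<circ> (inv \<sigma> \<circ> g)))"
    using assms by (intro sum.cong refl arg_cong[of _ _ e])
      (simp only: Sym_inv_compose[of \<tau> h] comp_assoc Sym_cancel)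
  finally show ?thesis
    by (simp only: char_eq[OF assms(1)])
qed

lemma cnj_char:
  assumes "\<sigma> \<in> Sym h"
  shows "cnj (char \<sigma>) = char (inv \<sigma>)"
proof -
  have "cnj (e (inv g \<circ> (inv \<sigma> \<circ> g))) = e (inv g \<circ> (\<sigma> \<circ> g))" if g: "g \<in> Sym h" for g
  proof -
    have mem: "inv g \<circ> (inv \<sigma> \<circ> g) \<in> Sym h"
      using assms g by (simp only: Sym_compose Sym_inv)
    have "inv (inv g \<circ> (inv \<sigma> \<circ> g)) = inv g \<circ> (\<sigma> \<circ> g)"
      using assms g
      by (simp only: Sym_inv_compose[of _ h] Sym_compose Sym_inv Sym_inv_inv[of _ h] comp_assoc)
    then show ?thesis
      using e_inv[OF mem] by simp
  qed
  then show ?thesis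
    using assms by (simp add: char_eq Sym_inv Sym_inv_inv[OF assms] del: mem_Collect_eq)
qed

text \<open>By \<open>char_eq\<close> and \<open>e_positive\<close> the character is a sum over
  \<open>g\<close> of Gram kernels. Pairing the hypothesis with \<open>r\<close> itself gives a sum
  of squared moduli, all of which must vanish; the terms with \<open>g = id\<close> are the
  claim.\<close>

lemma orthogonal_to_char:
  assumes r: "\<And>\<rho>. \<rho> \<in> Sym h \<Longrightarrow> (\<Sum>\<pi>\<in>Sym h. r \<pi> * char (inv \<rho> \<circ> \<pi>)) = 0" and \<kappa>: "\<kappa> \<in> Sym h"
  shows "ip h r (left_mult \<kappa> e) = 0"
proof -
  define A where "A g \<kappa> = (\<Sum>\<pi>\<in>Sym h. r \<pi> * cnj (e (inv \<kappa> \<circ> (\<pi> \<circ> g))))" for g \<kappa>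
  have char: "char (inv \<rho> \<circ> \<pi>) =
      (\<Sum>g\<in>Sym h. \<Sum>\<kappa>\<in>Sym h. cnj (e (inv \<kappa> \<circ> (\<pi> \<circ> g))) * e (inv \<kappa> \<circ> (\<rho> \<circ> g)))"
    if \<rho>: "\<rho> \<in> Sym h" and \<pi>: "\<pi> \<in> Sym h" for \<rho> \<pi>
  proof -
    have "char (inv \<rho> \<circ> \<pi>) = (\<Sum>g\<in>Sym h. e (inv g \<circ> (inv (inv \<rho> \<circ> \<pi>) \<circ> g)))"
      by (rule char_eq[OF Sym_compose[OF Sym_inv[OF \<rho>] \<pi>]])
    also have "\<dots> = (\<Sum>g\<in>Sym h. e (inv (\<pi> \<circ> g) \<circ> (\<rho> \<circ> g)))"
      using \<rho> \<pi> by (intro sum.cong refl arg_cong[of _ _ e])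
        (simp only: Sym_inv_compose[of _ h] Sym_inv Sym_inv_inv[of _ h] comp_assoc)
    also have "\<dots> = (\<Sum>g\<in>Sym h. \<Sum>\<kappa>\<in>Sym h. cnj (e (inv \<kappa> \<circ> (\<pi> \<circ> g))) * e (inv \<kappa> \<circ> (\<rho> \<circ> g)))"
      using \<rho> \<pi> by (intro sum.cong refl e_positive Sym_compose)
    finally show ?thesis .
  qed
  \<comment> \<open>The hermitian form of the character kernel, evaluated at
    \<open>r\<close>.\<close>
  have "0 = (\<Sum>\<rho>\<in>Sym h. cnj (r \<rho>) * (\<Sum>\<pi>\<in>Sym h. r \<pi> * char (inv \<rho> \<circ> \<pi>)))"
    using r by simp
  also have "\<dots> = (\<Sum>\<rho>\<in>Sym h. \<Sum>\<pi>\<in>Sym h. \<Sum>g\<in>Sym h. \<Sum>\<kappa>\<in>Sym h.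
      (r \<pi> * cnj (e (inv \<kappa> \<circ> (\<pi> \<circ> g)))) * (cnj (r \<rho>) * e (inv \<kappa> \<circ> (\<rho> \<circ> g))))"
    unfolding sum_distrib_left
  proof (intro sum.cong refl)
    fix \<rho> \<pi> assume "\<rho> \<in> Sym h" "\<pi> \<in> Sym h"
    then show "cnj (r \<rho>) * (r \<pi> * char (inv \<rho> \<circ> \<pi>)) = (\<Sum>g\<in>Sym h. \<Sum>\<kappa>\<in>Sym h.
      (r \<pi> * cnj (e (inv \<kappa> \<circ> (\<pi> \<circ> g)))) * (cnj (r \<rho>) * e (inv \<kappa> \<circ> (\<rho> \<circ> g))))"
      by (simp only: char sum_distrib_left mult.assoc mult.left_commute)
  qed
  also have "\<dots> = (\<Sum>g\<in>Sym h. \<Sum>\<kappa>\<in>Sym h. \<Sum>\<rho>\<in>Sym h. \<Sum>\<pi>\<in>Sym h.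
      (r \<pi> * cnj (e (inv \<kappa> \<circ> (\<pi> \<circ> g)))) * (cnj (r \<rho>) * e (inv \<kappa> \<circ> (\<rho> \<circ> g))))"
  proof -
    have swap4: "(\<Sum>a\<in>X. \<Sum>b\<in>X. \<Sum>c\<in>X. \<Sum>d\<in>X. F a b c d) = (\<Sum>c\<in>X. \<Sum>d\<in>X. \<Sum>a\<in>X. \<Sum>b\<in>X. F a b c d)"
      for X :: "(nat \<Rightarrow> nat) set" and F :: "_ \<Rightarrow> _ \<Rightarrow> _ \<Rightarrow> _ \<Rightarrow> complex"
    proof -
      have cp: "(\<Sum>a\<in>X. \<Sum>b\<in>X. H a b) = (\<Sum>x\<in>X\<times>X. H (fst x) (snd x))" for H :: "_ \<Rightarrow> _ \<Rightarrow> complex"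
        by (simp add: sum.cartesian_product case_prod_beta)
      have "(\<Sum>a\<in>X. \<Sum>b\<in>X. \<Sum>c\<in>X. \<Sum>d\<in>X. F a b c d) = (\<Sum>x\<in>X\<times>X. \<Sum>y\<in>X\<times>X. F (fst x) (snd x) (fst y) (snd y))"
        by (simp only: cp)
      also have "\<dots> = (\<Sum>y\<in>X\<times>X. \<Sum>x\<in>X\<times>X. F (fst x) (snd x) (fst y) (snd y))"
        by (rule sum.swap)
      also have "\<dots> = (\<Sum>c\<in>X. \<Sum>d\<in>X. \<Sum>a\<in>X. \<Sum>b\<in>X. F a b c d)"
        by (simp only: cp)
      finally show ?thesis .
    qed
    show ?thesis by (rule swap4)
  qed
  also have "\<dots> = (\<Sum>g\<in>Sym h. \<Sum>\<kappa>\<in>Sym h. A g \<kappa> * cnj (A g \<kappa>))"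
    by (intro sum.cong refl, subst sum.swap)
      (simp only: A_def sum_product cnj_sum complex_cnj_mult complex_cnj_cnj)
  also have "\<dots> = of_real (\<Sum>g\<in>Sym h. \<Sum>\<kappa>\<in>Sym h. (cmod (A g \<kappa>))\<^sup>2)"
    by (simp add: complex_norm_square[symmetric])
  finally have "(\<Sum>g\<in>Sym h. \<Sum>\<kappa>\<in>Sym h. (cmod (A g \<kappa>))\<^sup>2) = 0"
    by (rule iffD1[OF of_real_eq_0_iff[where 'a = complex], OF sym])
  \<comment> \<open>Among the conjugates of \<open>e\<close> only \<open>e\<close> itself, that is
    \<open>g = id\<close>, is kept.\<close>
  then have "(\<Sum>\<kappa>\<in>Sym h. (cmod (A id \<kappa>))\<^sup>2) = 0"
    using sum_nonneg_eq_0_iff[OF finite_Sym[of h], of "\<lambda>g. \<Sum>\<kappa>\<in>Sym h. (cmod (A g \<kappa>))\<^sup>2"]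
    by (simp add: sum_nonneg permutes_id)
  then have "A id \<kappa> = 0"
    using sum_nonneg_eq_0_iff[OF finite_Sym[of h], of "\<lambda>\<kappa>. (cmod (A id \<kappa>))\<^sup>2"] \<kappa> by simp
  then show ?thesis
    by (simp add: A_def ip_def left_mult_def)
qed

text \<open>The residue of \<open>y\<close> after projection onto the translates of the character is
  orthogonal to all translates of \<open>e\<close>, hence to \<open>y\<close>, which is a
  combination of these by \<open>mult_e\<close>. Being orthogonal to its own projection too, it has
  norm zero.\<close>

theorem in_char_ideal:
  assumes y: "y \<in> W"
  shows "\<exists>c. \<forall>\<pi>\<in>Sym h. y \<pi> = (\<Sum>\<rho>\<in>Sym h. c \<rho> * char (inv \<pi> \<circ> \<rho>))"
proof -
  define Z where "Z \<rho> = (\<lambda>\<pi>. char (inv \<pi> \<circ> \<rho>))" for \<rho> :: "nat \<Rightarrow> nat"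
  obtain w where w: "w \<in> gralg.span (Z ` Sym h)" "\<forall>v\<in>gralg.span (Z ` Sym h). ip h (y - w) v = 0"
    using orthogonal_projection[OF finite_imageI[OF finite_Sym]] by blast
  have "(\<Sum>\<pi>\<in>Sym h. (y - w) \<pi> * char (inv \<rho> \<circ> \<pi>)) = 0" if \<rho>: "\<rho> \<in> Sym h" for \<rho>
  proof -
    \<comment> \<open>The inner product conjugates its second argument; for a character this means
      inverting, which gives the form required by \<open>orthogonal_to_char\<close>.\<close>
    have "cnj (char (inv \<pi> \<circ> \<rho>)) = char (inv \<rho> \<circ> \<pi>)" if "\<pi> \<in> Sym h" for \<pi>
      using cnj_char[OF Sym_compose[OF Sym_inv[OF that] \<rho>]]
      by (simp only: Sym_inv_compose[OF Sym_inv[OF that] \<rho>] Sym_inv_inv[OF that])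
    then have "ip h (y - w) (Z \<rho>) = (\<Sum>\<pi>\<in>Sym h. (y - w) \<pi> * char (inv \<rho> \<circ> \<pi>))"
      unfolding ip_def Z_def by (intro sum.cong refl) (simp only:)
    moreover have "ip h (y - w) (Z \<rho>) = 0"
      by (rule bspec[OF w(2) gralg.span_base[OF imageI[OF \<rho>]]])
    ultimately show ?thesis by simp
  qed
  then have orth: "ip h (y - w) (left_mult \<kappa> e) = 0" if "\<kappa> \<in> Sym h" for \<kappa>
    using that by (rule orthogonal_to_char)
  have "cnj (ip h (y - w) y) = ip h (\<Sum>\<kappa>\<in>Sym h. (\<lambda>\<pi>. y \<kappa> * left_mult \<kappa> e \<pi>)) (y - w)"
    using mult_e[OF y] by (simp add: ip_cnj)
  also have "\<dots> = (\<Sum>\<kappa>\<in>Sym h. y \<kappa> * cnj (ip h (y - w) (left_mult \<kappa> e)))"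
    by (simp only: ip_sum_left ip_scale_left ip_cnj)
  also have "\<dots> = 0"
    using orth by simp
  finally have "ip h (y - w) y = 0"
    by simp
  moreover have "ip h (y - w) w = 0"
    using w by blast
  moreover have "ip h (y - w) (y - w) = ip h (y - w) y - ip h (y - w) w"
    by (simp add: ip_def right_diff_distrib sum_subtractf)
  ultimately have "\<forall>\<pi>\<in>Sym h. (y - w) \<pi> = 0"
    unfolding ip_self_zero[symmetric] by (simp only: diff_self)
  moreover obtain c where "w = (\<lambda>\<pi>. \<Sum>\<rho>\<in>Sym h. c \<rho> * Z \<rho> \<pi>)"
    using span_image_explicit[OF finite_Sym w(1)] by blast
  ultimately show ?thesis
    by (intro exI[of _ c]) (simp add: Z_def)
qed

end


subsection \<open>The Specht module as a left ideal\<close>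

lemma young_symmetrizer_support: "\<pi> \<notin> Sym (sum_list mu) \<Longrightarrow> young_symmetrizer mu \<pi> = 0"
proof -
  assume "\<pi> \<notin> Sym (sum_list mu)"
  then have "p \<circ> q \<noteq> \<pi>" if "p \<in> row_group mu" "q \<in> col_group mu" for p q
    using Sym_compose[of p "sum_list mu" q] that by (auto simp: row_group_def col_group_def)
  then show ?thesis by (simp add: young_symmetrizer_def)
qed

lemma specht_support: "f \<in> specht mu \<Longrightarrow> \<pi> \<notin> Sym (sum_list mu) \<Longrightarrow> f \<pi> = 0"
  unfolding specht_def
proof (induction rule: gralg.span_induct_alt)
  case base
  then show ?case by simp
next
  case (step c x y)
  then obtain \<sigma> where \<sigma>: "\<sigma> \<in> Sym (sum_list mu)" "x = left_mult \<sigma> (young_symmetrizer mu)"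
    by blast
  have "inv \<sigma> \<circ> \<pi> \<notin> Sym (sum_list mu)"
    using Sym_compose[OF \<sigma>(1), of "inv \<sigma> \<circ> \<pi>"] Sym_cancel(2)[OF \<sigma>(1), of \<pi>] step.prems by auto
  with step \<sigma>(2) show ?case
    by (simp add: left_mult_def young_symmetrizer_support)
qed

lemma specht_invariant:
  "f \<in> specht mu \<Longrightarrow> \<tau> \<in> Sym (sum_list mu) \<Longrightarrow> left_mult \<tau> f \<in> specht mu"
  unfolding specht_def
proof (induction rule: gralg.span_induct_alt)
  case base
  have "left_mult \<tau> 0 = (0 :: (nat \<Rightarrow> nat) \<Rightarrow> complex)"
    by (simp add: left_mult_def fun_eq_iff)
  then show ?case by (simp only: gralg.span_zero)
next
  case (step c x y)
  then obtain \<sigma> where \<sigma>: "\<sigma> \<in> Sym (sum_list mu)" "x = left_mult \<sigma> (young_symmetrizer mu)"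
    by blast
  then have "left_mult \<tau> x = left_mult (\<tau> \<circ> \<sigma>) (young_symmetrizer mu)"
    using left_mult_compose[OF step.prems \<sigma>(1)] by simp
  moreover have "\<tau> \<circ> \<sigma> permutes {..<sum_list mu}"
    using Sym_compose[OF step.prems \<sigma>(1)] by simp
  ultimately have "left_mult \<tau> x \<in> gralg.span {left_mult \<sigma> (young_symmetrizer mu) |\<sigma>. \<sigma> permutes {..<sum_list mu}}"
    by (intro gralg.span_base) auto
  then show ?case
    unfolding left_mult_add left_mult_scale using step by (intro gralg.span_add gralg.span_scale) auto
qed

text \<open>The translates of the symmetrizer are finite in number, so
  \<open>orthogonal_projection\<close> applied to the unit provides \<open>e\<close>.\<close>

lemma specht_left_ideal:
  "\<exists>e. left_ideal (sum_list mu) (specht mu)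
     {left_mult \<sigma> (young_symmetrizer mu) |\<sigma>. \<sigma> permutes {..<sum_list mu}} e"
proof -
  let ?S = "{left_mult \<sigma> (young_symmetrizer mu) |\<sigma>. \<sigma> permutes {..<sum_list mu}}"
  have fin: "finite ?S"
    using finite_Sym[of "sum_list mu"] by (simp add: setcompr_eq_image)
  obtain e where "e \<in> gralg.span ?S"
    "\<forall>v\<in>gralg.span ?S. ip (sum_list mu) ((\<lambda>\<pi>. if \<pi> = id then 1 else 0) - e) v = 0"
    using orthogonal_projection[OF fin] by blast
  then show ?thesis
    by (intro exI[of _ e] left_ideal.intro fin specht_invariant)
      (simp_all add: specht_def[symmetric] specht_support)
qed

lemma specht_character_conjugate:
  assumes "\<sigma> \<in> Sym (sum_list mu)" "\<tau> \<in> Sym (sum_list mu)"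
  shows "specht_character mu (\<tau> \<circ> (\<sigma> \<circ> inv \<tau>)) = specht_character mu \<sigma>"
proof -
  obtain e where "left_ideal (sum_list mu) (specht mu)
     {left_mult \<sigma> (young_symmetrizer mu) |\<sigma>. \<sigma> permutes {..<sum_list mu}} e"
    using specht_left_ideal by blast
  then interpret left_ideal "sum_list mu" "specht mu"
    "{left_mult \<sigma> (young_symmetrizer mu) |\<sigma>. \<sigma> permutes {..<sum_list mu}}" e .
  show ?thesis
    using char_conjugate[OF assms] by (simp add: char_def specht_character_def)
qed

text \<open>The symmetrizer belongs to the left ideal it generates, so \<open>in_char_ideal\<close>
  applies to it.\<close>

lemma young_symmetrizer_expansion:
  "\<exists>c. \<forall>\<pi>\<in>Sym (sum_list mu). young_symmetrizer mu \<pi> =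
     (\<Sum>\<rho>\<in>Sym (sum_list mu). c \<rho> * specht_character mu (inv \<pi> \<circ> \<rho>))"
proof -
  obtain e where "left_ideal (sum_list mu) (specht mu)
     {left_mult \<sigma> (young_symmetrizer mu) |\<sigma>. \<sigma> permutes {..<sum_list mu}} e"
    using specht_left_ideal by blast
  then interpret left_ideal "sum_list mu" "specht mu"
    "{left_mult \<sigma> (young_symmetrizer mu) |\<sigma>. \<sigma> permutes {..<sum_list mu}}" e .
  have "left_mult id (young_symmetrizer mu) \<in> specht mu"
    unfolding specht_def by (intro gralg.span_base) (use permutes_id in blast)
  then have "young_symmetrizer mu \<in> specht mu"
    by (simp add: left_mult_def inv_id)
  from in_char_ideal[OF this] show ?thesis
    by (simp add: char_def specht_character_def)
qed


subsection \<open>Transposing a diagram\<close>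

text \<open>In a weakly decreasing list the entries exceeding \<open>c\<close> form an initial
  segment, so counting them gives the length of a column.\<close>

lemma nth_filter_length:
  "sorted_wrt (\<ge>) lam \<Longrightarrow> r < length (filter (\<lambda>l. c < l) lam) \<longleftrightarrow> r < length lam \<and> c < (lam ! r :: nat)"
proof (induction lam arbitrary: r)
  case (Cons x lam)
  show ?case
  proof (cases "c < x")
    case True
    with Cons show ?thesis by (cases r) auto
  next
    case False
    then have "\<not> c < l" if "l \<in> set lam" for l
      using Cons.prems that by auto
    then have "filter (\<lambda>l. c < l) (x # lam) = []"
      using False by (auto simp: filter_empty_conv)
    moreover have "\<not> c < (x # lam) ! r" if "r < length (x # lam)"
      using nth_mem[OF that] \<open>\<And>l. l \<in> set lam \<Longrightarrow> \<not> c < l\<close> False by auto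
    ultimately show ?thesis by auto
  qed
qed simp

lemma conjugate_cells:
  assumes "sorted_wrt (\<ge>) lam"
  shows "{(c, r). c < length (conjugate lam) \<and> r < conjugate lam ! c} =
    prod.swap ` {(r, c). r < length lam \<and> c < lam ! r}"
proof -
  have max: "x \<le> foldr max lam 0" if "x \<in> set lam" for x
    using that by (induction lam) auto
  have "c < length (conjugate lam) \<and> r < conjugate lam ! c \<longleftrightarrow> r < length lam \<and> c < lam ! r" for r c
    using nth_filter_length[OF assms, of r c] max[OF nth_mem, of r]
    by (auto simp: conjugate_def intro: less_le_trans)
  then show ?thesis by (auto simp: image_iff)
qed

lemma sum_list_conjugate:
  assumes "sorted_wrt (\<ge>) lam"
  shows "sum_list (conjugate lam) = sum_list lam"
proof -
  have "sum_list mu = card {(r, c). r < length mu \<and> c < mu ! r}" for mu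
    using bij_betw_same_card[OF bij_betw_cell[of mu]] by simp
  then show ?thesis
    by (simp add: conjugate_cells[OF assms] card_image)
qed

text \<open>Both diagrams number their cells row by row; \<open>t\<close> translates the number of a
  cell into that of its mirror image, and is the identity beyond the diagram.\<close>

lemma transposition:
  assumes "sorted_wrt (\<ge>) lam"
  shows "\<exists>t. t permutes {..<sum_list lam} \<and>
    (\<forall>k<sum_list lam. cell (conjugate lam) (t k) = prod.swap (cell lam k))"
proof -
  let ?h = "sum_list lam" and ?D = "{(r, c). r < length lam \<and> c < lam ! r}"
  let ?inv = "inv_into {..<?h} (cell (conjugate lam))"
  have conj: "bij_betw (cell (conjugate lam)) {..<?h} (prod.swap ` ?D)"
    using bij_betw_cell[of "conjugate lam"] by (simp add: conjugate_cells[OF assms] sum_list_conjugate[OF assms])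
  have "bij_betw (?inv \<circ> (prod.swap \<circ> cell lam)) {..<?h} {..<?h}"
    by (intro bij_betw_trans[OF bij_betw_trans[OF bij_betw_cell inj_on_imp_bij_betw] bij_betw_inv_into[OF conj]])
      simp
  then have bij: "bij_betw (\<lambda>k. if k < ?h then ?inv (prod.swap (cell lam k)) else k) {..<?h} {..<?h}"
    by (rule bij_betw_cong[THEN iffD1, rotated]) simp
  have "cell (conjugate lam) (?inv (prod.swap (cell lam k))) = prod.swap (cell lam k)" if "k < ?h" for k
    using bij_betwE[OF bij_betw_cell[of lam]] that
    by (intro bij_betw_inv_into_right[OF conj]) auto
  with bij show ?thesis
    by (intro exI[of _ "\<lambda>k. if k < ?h then ?inv (prod.swap (cell lam k)) else k"] conjI bij_imp_permutes) auto
qed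

text \<open>Reflection exchanges the two coordinates of a cell, so conjugation by \<open>t\<close>
  exchanges row and column groups.\<close>

lemma conjugate_row_group:
  assumes "sorted_wrt (\<ge>) lam" and t: "t permutes {..<sum_list lam}"
    and cell: "\<forall>k<sum_list lam. cell (conjugate lam) (t k) = prod.swap (cell lam k)"
  shows "p \<in> row_group (conjugate lam) \<longleftrightarrow> inv t \<circ> (p \<circ> t) \<in> col_group lam"
    and "p \<in> col_group (conjugate lam) \<longleftrightarrow> inv t \<circ> (p \<circ> t) \<in> row_group lam"
proof -
  let ?h = "sum_list lam" and ?q = "inv t \<circ> (p \<circ> t)"
  have T: "t \<in> Sym ?h" using t by simp
  have perm: "p permutes {..<?h} \<longleftrightarrow> ?q permutes {..<?h}"
  proof
    assume "?q permutes {..<?h}"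
    then have "t \<circ> (?q \<circ> inv t) permutes {..<?h}"
      using Sym_compose[OF T Sym_compose[OF _ Sym_inv[OF T]], of ?q] by simp
    moreover have "t \<circ> (?q \<circ> inv t) = p"
      by (simp add: fun_eq_iff permutes_inverses[OF t])
    ultimately show "p permutes {..<?h}" by simp
  qed (use Sym_compose[OF Sym_inv[OF T] Sym_compose[OF _ T], of p] in simp)
  have eq: "cell (conjugate lam) (p (t k)) = prod.swap (cell lam (?q k))"
    if "?q permutes {..<?h}" "k < ?h" for k
  proof -
    have "?q k < ?h" using permutes_in_image[OF that(1), of k] that(2) by simp
    with cell have "cell (conjugate lam) (t (?q k)) = prod.swap (cell lam (?q k))" by blast
    then show ?thesis by (simp add: permutes_inverses[OF t])
  qed
  \<comment> \<open>Every cell number of the conjugate diagram has the form \<open>t k\<close>, so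
    the conditions can be checked on the cells of \<open>lam\<close>.\<close>
  have all: "(\<forall>k<?h. P k) \<longleftrightarrow> (\<forall>k<?h. P (t k))" for P
  proof
    assume *: "\<forall>k<?h. P (t k)"
    show "\<forall>k<?h. P k"
    proof (intro allI impI)
      fix k assume "k < ?h"
      then have "inv t k < ?h"
        using permutes_in_image[OF permutes_inv[OF t], of k] by simp
      with * have "P (t (inv t k))" by blast
      then show "P k" by (simp add: permutes_inverses[OF t])
    qed
  next
    assume "\<forall>k<?h. P k"
    then show "\<forall>k<?h. P (t k)"
      using permutes_in_image[OF t] by simp
  qed
  show "p \<in> row_group (conjugate lam) \<longleftrightarrow> ?q \<in> col_group lam"
    unfolding row_group_def col_group_def sum_list_conjugate[OF assms(1)] mem_Collect_eq perm
      all[of "\<lambda>k. fst (cell (conjugate lam) (p k)) = fst (cell (conjugate lam) k)"]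
    using eq cell by auto
  show "p \<in> col_group (conjugate lam) \<longleftrightarrow> ?q \<in> row_group lam"
    unfolding row_group_def col_group_def sum_list_conjugate[OF assms(1)] mem_Collect_eq perm
      all[of "\<lambda>k. snd (cell (conjugate lam) (p k)) = snd (cell (conjugate lam) k)"]
    using eq cell by auto
qed

text \<open>
  Transposition turns the antisymmetrization over the rows of \<open>lam\<close> into the Young symmetrizer of the
  conjugate partition, up to inversion.
\<close>

lemma sum_young_symmetrizer:
  fixes F :: "(nat \<Rightarrow> nat) \<Rightarrow> ('p, 'q, 'l) Ugl"
  assumes sorted: "sorted_wrt (\<ge>) lam" and t: "t permutes {..<sum_list lam}"
    and cell: "\<forall>k<sum_list lam. cell (conjugate lam) (t k) = prod.swap (cell lam k)"
  shows "(\<Sum>p\<in>row_group lam. \<Sum>q\<in>col_group lam. uscale (of_int (sign p)) (F (p \<circ> q))) =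
    (\<Sum>\<tau>\<in>Sym (sum_list lam). uscale (young_symmetrizer (conjugate lam) \<tau>) (F (inv t \<circ> (inv \<tau> \<circ> t))))"
proof -
  let ?h = "sum_list lam" and ?R = "row_group (conjugate lam)" and ?C = "col_group (conjugate lam)"
  have T: "t \<in> Sym ?h" using t by simp
  have RC: "?R \<subseteq> Sym ?h" "?C \<subseteq> Sym ?h" "row_group lam \<subseteq> Sym ?h" "col_group lam \<subseteq> Sym ?h"
    by (auto simp: row_group_def col_group_def sum_list_conjugate[OF sorted])
  have fin: "finite ?R" "finite ?C"
    using RC finite_Sym finite_subset by blast+
  note grp = conjugate_row_group[OF sorted t cell]
  have conj_inv: "inv t \<circ> ((t \<circ> (q \<circ> inv t)) \<circ> t) = q" "t \<circ> ((inv t \<circ> (q \<circ> t)) \<circ> inv t) = q" for q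
    by (simp_all add: fun_eq_iff permutes_inverses[OF t])
  have inv_conj: "inv (t \<circ> (inv q \<circ> inv t)) = t \<circ> (q \<circ> inv t)" if "q \<in> Sym ?h" for q
    using Sym_inv_compose[OF T Sym_compose[OF Sym_inv[OF that] Sym_inv[OF T]]]
      Sym_inv_compose[OF Sym_inv[OF that] Sym_inv[OF T]] Sym_inv_inv[OF T] Sym_inv_inv[OF that]
    by (simp add: comp_assoc)
  have inv_conj': "inv (inv t \<circ> (p \<circ> t)) = inv t \<circ> (inv p \<circ> t)" if "p \<in> Sym ?h" for p
    using Sym_inv_compose[OF Sym_inv[OF T] Sym_compose[OF that T]]
      Sym_inv_compose[OF that T] Sym_inv_inv[OF T]
    by (simp add: comp_assoc)
  \<comment> \<open>Besides conjugation by \<open>t\<close>, the bijection inverts, because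
    \<open>F\<close> is evaluated at inverses: inverting a product reverses it and restores the
    order rows before columns.\<close>
  have bR: "bij_betw (\<lambda>q. t \<circ> (inv q \<circ> inv t)) (col_group lam) ?R"
  proof (rule bij_betw_byWitness[where f' = "\<lambda>p. inv t \<circ> (inv p \<circ> t)"])
    show "\<forall>q\<in>col_group lam. inv t \<circ> (inv (t \<circ> (inv q \<circ> inv t)) \<circ> t) = q"
    proof
      fix q assume "q \<in> col_group lam"
      then have q: "q \<in> Sym ?h" using RC(4) by blast
      show "inv t \<circ> (inv (t \<circ> (inv q \<circ> inv t)) \<circ> t) = q"
        by (simp only: inv_conj[OF q] conj_inv)
    qed
    show "\<forall>p\<in>?R. t \<circ> (inv (inv t \<circ> (inv p \<circ> t)) \<circ> inv t) = p"
    proof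
      fix p assume "p \<in> ?R"
      then have p: "p \<in> Sym ?h" using RC(1) by blast
      show "t \<circ> (inv (inv t \<circ> (inv p \<circ> t)) \<circ> inv t) = p"
        by (simp only: inv_conj'[OF Sym_inv[OF p]] Sym_inv_inv[OF p] conj_inv)
    qed
    show "(\<lambda>q. t \<circ> (inv q \<circ> inv t)) ` col_group lam \<subseteq> ?R"
      by (rule image_subsetI) (simp only: grp conj_inv col_group_inv)
    show "(\<lambda>p. inv t \<circ> (inv p \<circ> t)) ` ?R \<subseteq> col_group lam"
      by (rule image_subsetI) (simp only: grp(1)[symmetric] row_group_inv)
  qed
  have bC: "bij_betw (\<lambda>q. t \<circ> (inv q \<circ> inv t)) (row_group lam) ?C"
  proof (rule bij_betw_byWitness[where f' = "\<lambda>p. inv t \<circ> (inv p \<circ> t)"])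
    show "\<forall>q\<in>row_group lam. inv t \<circ> (inv (t \<circ> (inv q \<circ> inv t)) \<circ> t) = q"
    proof
      fix q assume "q \<in> row_group lam"
      then have q: "q \<in> Sym ?h" using RC(3) by blast
      show "inv t \<circ> (inv (t \<circ> (inv q \<circ> inv t)) \<circ> t) = q"
        by (simp only: inv_conj[OF q] conj_inv)
    qed
    show "\<forall>p\<in>?C. t \<circ> (inv (inv t \<circ> (inv p \<circ> t)) \<circ> inv t) = p"
    proof
      fix p assume "p \<in> ?C"
      then have p: "p \<in> Sym ?h" using RC(2) by blast
      show "t \<circ> (inv (inv t \<circ> (inv p \<circ> t)) \<circ> inv t) = p"
        by (simp only: inv_conj'[OF Sym_inv[OF p]] Sym_inv_inv[OF p] conj_inv)
    qed
    show "(\<lambda>q. t \<circ> (inv q \<circ> inv t)) ` row_group lam \<subseteq> ?C"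
      by (rule image_subsetI) (simp only: grp conj_inv row_group_inv)
    show "(\<lambda>p. inv t \<circ> (inv p \<circ> t)) ` ?C \<subseteq> row_group lam"
      by (rule image_subsetI) (simp only: grp(2)[symmetric] col_group_inv)
  qed
  let ?F = "\<lambda>\<tau>. F (inv t \<circ> (inv \<tau> \<circ> t))"
  have "(\<Sum>\<tau>\<in>Sym ?h. uscale (young_symmetrizer (conjugate lam) \<tau>) (?F \<tau>)) =
      (\<Sum>\<tau>\<in>Sym ?h. \<Sum>p\<in>?R. \<Sum>q\<in>?C. if \<tau> = p \<circ> q then uscale (of_int (sign q)) (?F (p \<circ> q)) else 0)"
    unfolding young_symmetrizer_def ugl.scale_sum_left by (intro sum.cong refl) auto
  also have "\<dots> = (\<Sum>p\<in>?R. \<Sum>q\<in>?C. \<Sum>\<tau>\<in>Sym ?h. if \<tau> = p \<circ> q then uscale (of_int (sign q)) (?F (p \<circ> q)) else 0)"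
    by (subst sum.swap) (intro sum.cong refl sum.swap)
  also have "\<dots> = (\<Sum>p\<in>?R. \<Sum>q\<in>?C. uscale (of_int (sign q)) (?F (p \<circ> q)))"
  proof (intro sum.cong refl)
    fix p q assume "p \<in> ?R" "q \<in> ?C"
    then have "p \<circ> q \<in> Sym ?h"
      using Sym_compose[OF subsetD[OF RC(1)] subsetD[OF RC(2)]] by simp
    then show "(\<Sum>\<tau>\<in>Sym ?h. if \<tau> = p \<circ> q then uscale (of_int (sign q)) (?F (p \<circ> q)) else 0) =
        uscale (of_int (sign q)) (?F (p \<circ> q))"
      using finite_Sym by (subst sum.delta) simp_all
  qed
  also have "\<dots> = (\<Sum>q\<in>?C. \<Sum>p\<in>?R. uscale (of_int (sign q)) (?F (p \<circ> q)))"
    by (rule sum.swap)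
  also have "\<dots> = (\<Sum>p\<in>row_group lam. \<Sum>p'\<in>?R. uscale (of_int (sign (t \<circ> (inv p \<circ> inv t)))) (?F (p' \<circ> (t \<circ> (inv p \<circ> inv t)))))"
    by (rule sum.reindex_bij_betw[OF bC, symmetric])
  also have "\<dots> = (\<Sum>p\<in>row_group lam. \<Sum>q\<in>col_group lam.
      uscale (of_int (sign (t \<circ> (inv p \<circ> inv t)))) (?F ((t \<circ> (inv q \<circ> inv t)) \<circ> (t \<circ> (inv p \<circ> inv t)))))"
    by (intro sum.cong refl sum.reindex_bij_betw[OF bR, symmetric])
  also have "\<dots> = (\<Sum>p\<in>row_group lam. \<Sum>q\<in>col_group lam. uscale (of_int (sign p)) (F (p \<circ> q)))"
  proof (intro sum.cong refl)
    fix p q assume "p \<in> row_group lam" "q \<in> col_group lam"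
    then have p: "p \<in> Sym ?h" and q: "q \<in> Sym ?h" using RC by auto
    have perm: "permutation p" "permutation t"
      using p t by (auto intro: permutes_imp_permutation[OF finite_lessThan])
    \<comment> \<open>The sign of \<open>t\<close> enters twice and cancels.\<close>
    have "sign (t \<circ> (inv p \<circ> inv t)) = sign t * (sign p * sign t)"
      using perm by (simp add: sign_compose permutation_inverse permutation_compose sign_inverse)
    then have sign: "sign (t \<circ> (inv p \<circ> inv t)) = sign p"
      by (simp add: sign_def)
    have mem: "t \<circ> (inv r \<circ> inv t) \<in> Sym ?h" if "r \<in> Sym ?h" for r
      by (intro Sym_compose Sym_inv T that)
    have "inv ((t \<circ> (inv q \<circ> inv t)) \<circ> (t \<circ> (inv p \<circ> inv t))) = (t \<circ> (p \<circ> inv t)) \<circ> (t \<circ> (q \<circ> inv t))"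
      by (simp only: Sym_inv_compose[OF mem[OF q] mem[OF p]] inv_conj[OF p] inv_conj[OF q])
    moreover have "inv t \<circ> (((t \<circ> (p \<circ> inv t)) \<circ> (t \<circ> (q \<circ> inv t))) \<circ> t) = p \<circ> q"
      by (simp add: fun_eq_iff permutes_inverses[OF t])
    ultimately show "uscale (of_int (sign (t \<circ> (inv p \<circ> inv t)))) (?F ((t \<circ> (inv q \<circ> inv t)) \<circ> (t \<circ> (inv p \<circ> inv t)))) =
        uscale (of_int (sign p)) (F (p \<circ> q))"
      by (simp only: sign)
  qed
  finally show ?thesis ..
qed

section \<open>Young-Capelli bitableaux in terms of Capelli immanants\<close>

theorem theorem5p3:
  fixes \<alpha> :: "nat \<Rightarrow> 'p::finite" and \<beta> :: "nat \<Rightarrow> 'q::finite"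
    and U V :: "'l::finite tableau" and lam :: "nat list" and h :: nat
  assumes "bij_betw \<alpha> {1..CARD('p)} UNIV" and "bij_betw \<beta> {1..CARD('q)} UNIV"
    and "h \<le> CARD('p)" and "hd lam \<le> CARD('q)"
    and "h \<ge> 1" and "is_partition lam h"
    and "shape U = lam" and "shape V = lam"
  shows "\<exists>c :: 'l list \<Rightarrow> 'l list \<Rightarrow> complex.
    (YoungCapelli \<alpha> \<beta> U V :: ('p, 'q, 'l) Ugl) =
      (\<Sum>i \<in> {w. length w = h}. \<Sum>j \<in> {w. length w = h}.
         uscale (c i j) (Cimm \<alpha> lam i j))"
proof -
  have h: "sum_list lam = h" and sorted: "sorted_wrt (\<ge>) lam"
    using assms(6) by (simp_all add: is_partition_def)
  define mu where "mu = conjugate lam"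
  have mu: "sum_list mu = h"
    using sum_list_conjugate[OF sorted] h by (simp add: mu_def)
  obtain t where t: "t permutes {..<sum_list lam}"
    and cell: "\<forall>k<sum_list lam. cell (conjugate lam) (t k) = prod.swap (cell lam k)"
    using transposition[OF sorted] by blast
  have T: "t \<in> Sym h" using t h by simp
  obtain c where c: "young_symmetrizer mu \<pi> = (\<Sum>\<rho>\<in>Sym h. c \<rho> * specht_character mu (inv \<pi> \<circ> \<rho>))"
    if "\<pi> \<in> Sym h" for \<pi>
    using young_symmetrizer_expansion[of mu] unfolding mu by blast
  define u where "u = (!) (concat U)"
  define v where "v = concat V"
  have v: "length v = h"
    using assms(8) h by (simp add: v_def length_concat_shape)
  define X :: "(nat \<Rightarrow> nat) \<Rightarrow> ('p, 'q, 'l) Ugl" where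
    "X \<pi> = Capelli \<alpha> (column_tab (map (\<lambda>k. u (\<pi> k)) [0..<h])) (column_tab v)" for \<pi>
  \<comment> \<open>These words rearrange the entries of \<open>U\<close> so that a shift of the
    summation in the immanant leaves bitableaux that no longer depend on \<open>\<rho>\<close>,
    while the character is translated by \<open>\<rho>\<close>.\<close>
  define I where "I \<rho> = map (\<lambda>k. u ((inv t \<circ> (inv \<rho> \<circ> t)) k)) [0..<h]" for \<rho>
  have Cimm: "Cimm \<alpha> lam (I \<rho>) v = (\<Sum>\<tau>\<in>Sym h. uscale (specht_character mu (inv \<tau> \<circ> \<rho>))
      (X (inv t \<circ> (inv \<tau> \<circ> t))))" if \<rho>: "\<rho> \<in> Sym h" for \<rho>
  proof -
    \<comment> \<open>The solution of \<open>inv t \<circ> (inv \<rho> \<circ> (t \<circ> \<sigma>))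
      = inv t \<circ> (inv \<tau> \<circ> t)\<close> for \<open>\<sigma>\<close>.\<close>
    let ?\<sigma> = "\<lambda>\<tau>. inv t \<circ> ((\<rho> \<circ> inv \<tau>) \<circ> t)"
    have "Cimm \<alpha> lam (I \<rho>) v = (\<Sum>\<sigma>\<in>Sym h. uscale (specht_character mu \<sigma>)
        (Capelli \<alpha> (column_tab (map (\<lambda>k. I \<rho> ! \<sigma> k) [0..<h])) (column_tab v)))"
      by (simp add: Cimm_def h chi_def mu_def)
    also have "\<dots> = (\<Sum>\<sigma>\<in>Sym h. uscale (specht_character mu \<sigma>) (X (inv t \<circ> (inv \<rho> \<circ> (t \<circ> \<sigma>)))))"
    proof (intro sum.cong refl)
      fix \<sigma> assume "\<sigma> \<in> Sym h"
      then have "\<sigma> k < h" if "k < h" for k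
        using permutes_in_image[of \<sigma> "{..<h}" k] that by simp
      then have "map (\<lambda>k. I \<rho> ! \<sigma> k) [0..<h] = map (\<lambda>k. u ((inv t \<circ> (inv \<rho> \<circ> (t \<circ> \<sigma>))) k)) [0..<h]"
        by (intro map_cong refl) (simp add: I_def)
      then show "uscale (specht_character mu \<sigma>)
          (Capelli \<alpha> (column_tab (map (\<lambda>k. I \<rho> ! \<sigma> k) [0..<h])) (column_tab v)) =
        uscale (specht_character mu \<sigma>) (X (inv t \<circ> (inv \<rho> \<circ> (t \<circ> \<sigma>))))"
        by (simp only: X_def)
    qed
    also have "\<dots> = (\<Sum>\<tau>\<in>Sym h. uscale (specht_character mu (?\<sigma> \<tau>)) (X (inv t \<circ> (inv \<rho> \<circ> (t \<circ> ?\<sigma> \<tau>)))))"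
    proof (rule sum.reindex_bij_betw[symmetric], rule bij_betw_byWitness[where f' = "\<lambda>\<sigma>. t \<circ> ((inv \<sigma> \<circ> inv t) \<circ> \<rho>)"])
      show "?\<sigma> ` Sym h \<subseteq> Sym h"
        by (intro image_subsetI Sym_compose Sym_inv T \<rho>)
      show "(\<lambda>\<sigma>. t \<circ> ((inv \<sigma> \<circ> inv t) \<circ> \<rho>)) ` Sym h \<subseteq> Sym h"
        by (intro image_subsetI Sym_compose Sym_inv T \<rho>)
      show "\<forall>\<tau>\<in>Sym h. t \<circ> ((inv (?\<sigma> \<tau>) \<circ> inv t) \<circ> \<rho>) = \<tau>"
      proof
        fix \<tau> assume \<tau>: "\<tau> \<in> Sym h"
        have "inv (?\<sigma> \<tau>) = inv t \<circ> ((\<tau> \<circ> inv \<rho>) \<circ> t)"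
          using T \<rho> \<tau> by (simp only: Sym_inv_compose[of _ h] Sym_compose Sym_inv Sym_inv_inv[of _ h] comp_assoc)
        then show "t \<circ> ((inv (?\<sigma> \<tau>) \<circ> inv t) \<circ> \<rho>) = \<tau>"
          using T \<rho> by (simp add: fun_eq_iff permutes_inverses)
      qed
      show "\<forall>\<sigma>\<in>Sym h. ?\<sigma> (t \<circ> ((inv \<sigma> \<circ> inv t) \<circ> \<rho>)) = \<sigma>"
      proof
        fix \<sigma> assume \<sigma>: "\<sigma> \<in> Sym h"
        have "inv (t \<circ> ((inv \<sigma> \<circ> inv t) \<circ> \<rho>)) = inv \<rho> \<circ> ((t \<circ> \<sigma>) \<circ> inv t)"
          using T \<rho> \<sigma> by (simp only: Sym_inv_compose[of _ h] Sym_compose Sym_inv Sym_inv_inv[of _ h] comp_assoc)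
        then show "?\<sigma> (t \<circ> ((inv \<sigma> \<circ> inv t) \<circ> \<rho>)) = \<sigma>"
          using T \<rho> by (simp add: fun_eq_iff permutes_inverses)
      qed
    qed
    also have "\<dots> = (\<Sum>\<tau>\<in>Sym h. uscale (specht_character mu (inv \<tau> \<circ> \<rho>)) (X (inv t \<circ> (inv \<tau> \<circ> t))))"
    \<comment> \<open>The character is a class function: conjugating by \<open>\<tau>\<close>
      exchanges the two factors, and conjugating by \<open>inv t\<close> adds the
      transposition.\<close>
    proof (intro sum.cong refl)
      fix \<tau> assume \<tau>: "\<tau> \<in> Sym h"
      have "specht_character mu (inv \<tau> \<circ> \<rho>) = specht_character mu (\<tau> \<circ> ((inv \<tau> \<circ> \<rho>) \<circ> inv \<tau>))"
        by (rule specht_character_conjugate[symmetric]) (simp_all only: mu Sym_compose Sym_inv \<tau> \<rho>)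
      also have "\<tau> \<circ> ((inv \<tau> \<circ> \<rho>) \<circ> inv \<tau>) = \<rho> \<circ> inv \<tau>"
        using \<tau> by (simp add: fun_eq_iff permutes_inverses)
      also have "specht_character mu (\<rho> \<circ> inv \<tau>) = specht_character mu (inv t \<circ> ((\<rho> \<circ> inv \<tau>) \<circ> inv (inv t)))"
        by (rule specht_character_conjugate[symmetric]) (simp_all only: mu Sym_compose Sym_inv \<tau> \<rho> T)
      finally have "specht_character mu (?\<sigma> \<tau>) = specht_character mu (inv \<tau> \<circ> \<rho>)"
        by (simp only: Sym_inv_inv[OF T])
      moreover have "inv t \<circ> (inv \<rho> \<circ> (t \<circ> ?\<sigma> \<tau>)) = inv t \<circ> (inv \<tau> \<circ> t)"
        using T \<rho> by (simp add: fun_eq_iff permutes_inverses)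
      ultimately show "uscale (specht_character mu (?\<sigma> \<tau>)) (X (inv t \<circ> (inv \<rho> \<circ> (t \<circ> ?\<sigma> \<tau>)))) =
          uscale (specht_character mu (inv \<tau> \<circ> \<rho>)) (X (inv t \<circ> (inv \<tau> \<circ> t)))"
        by (simp only:)
    qed
    finally show ?thesis .
  qed
  have "inj_on \<alpha> {1..h}" "inj_on \<beta> {1..hd lam}"
    using assms(1-4) by (auto simp: bij_betw_def elim!: inj_on_subset)
  then have "YoungCapelli \<alpha> \<beta> U V =
      (\<Sum>p\<in>row_group lam. \<Sum>q\<in>col_group lam. uscale (of_int (sign p)) (X (p \<circ> q)))"
    using assms(6-8) by (simp add: YoungCapelli_expansion X_def u_def v_def)
  also have "\<dots> = (\<Sum>\<tau>\<in>Sym h. uscale (young_symmetrizer mu \<tau>) (X (inv t \<circ> (inv \<tau> \<circ> t))))"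
    using sum_young_symmetrizer[OF sorted t cell] by (simp add: mu_def h)
  also have "\<dots> = (\<Sum>\<tau>\<in>Sym h. \<Sum>\<rho>\<in>Sym h. uscale (c \<rho>)
      (uscale (specht_character mu (inv \<tau> \<circ> \<rho>)) (X (inv t \<circ> (inv \<tau> \<circ> t)))))"
    by (intro sum.cong refl) (simp only: c ugl.scale_sum_left ugl.scale_scale)
  \<comment> \<open>With the order of summation exchanged, the translate of the character by
    \<open>\<rho>\<close> assembles one immanant.\<close>
  also have "\<dots> = (\<Sum>\<rho>\<in>Sym h. uscale (c \<rho>) (Cimm \<alpha> lam (I \<rho>) v))"
    by (subst sum.swap) (intro sum.cong refl, simp only: Cimm ugl.scale_sum_right)
  \<comment> \<open>Repeated entries of \<open>U\<close> can make \<open>I \<rho>\<close> coincide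
    for different \<open>\<rho>\<close>, so the coefficients are collected word by word. Only the
    reading word of \<open>V\<close> occurs on the right.\<close>
  also have "\<dots> = (\<Sum>i\<in>{w. length w = h}. \<Sum>\<rho> | \<rho> \<in> Sym h \<and> I \<rho> = i. uscale (c \<rho>) (Cimm \<alpha> lam (I \<rho>) v))"
    by (rule sum.group[symmetric, OF finite_Sym finite_list_length]) (auto simp: I_def)
  also have "\<dots> = (\<Sum>i\<in>{w. length w = h}. \<Sum>j\<in>{w. length w = h}.
      uscale (if j = v then \<Sum>\<rho> | \<rho> \<in> Sym h \<and> I \<rho> = i. c \<rho> else 0) (Cimm \<alpha> lam i j))"
  proof (intro sum.cong refl)
    fix i :: "'l list"
    have "(\<Sum>j\<in>{w. length w = h}.
        uscale (if j = v then \<Sum>\<rho> | \<rho> \<in> Sym h \<and> I \<rho> = i. c \<rho> else 0) (Cimm \<alpha> lam i j :: ('p, 'q, 'l) Ugl)) =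
      (\<Sum>j\<in>{w. length w = h}. if j = v then uscale (\<Sum>\<rho> | \<rho> \<in> Sym h \<and> I \<rho> = i. c \<rho>) (Cimm \<alpha> lam i v) else 0)"
      by (intro sum.cong refl) simp
    also have "\<dots> = uscale (\<Sum>\<rho> | \<rho> \<in> Sym h \<and> I \<rho> = i. c \<rho>) (Cimm \<alpha> lam i v)"
      using v by (subst sum.delta[OF finite_list_length]) simp
    also have "\<dots> = (\<Sum>\<rho> | \<rho> \<in> Sym h \<and> I \<rho> = i. uscale (c \<rho>) (Cimm \<alpha> lam (I \<rho>) v))"
      unfolding ugl.scale_sum_left by (intro sum.cong refl) simp
    finally show "(\<Sum>\<rho> | \<rho> \<in> Sym h \<and> I \<rho> = i. uscale (c \<rho>) (Cimm \<alpha> lam (I \<rho>) v)) =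
      (\<Sum>j\<in>{w. length w = h}.
        uscale (if j = v then \<Sum>\<rho> | \<rho> \<in> Sym h \<and> I \<rho> = i. c \<rho> else 0) (Cimm \<alpha> lam i j :: ('p, 'q, 'l) Ugl))" ..
  qed
  finally show ?thesis
    by (rule exI[of _ "\<lambda>i j. if j = v then \<Sum>\<rho> | \<rho> \<in> Sym h \<and> I \<rho> = i. c \<rho> else 0"])
qed

end
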